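(* Let $d\ge 1$, let $\lambda_w,\lambda_x,\lambda_v>0$, and let $\mu_t$, $t\ge 0$, be the measure-valued solution of the kinetic herding equation subjected to initial data $\mu_0$, a compactly supported Radon measure on $\mathbb{R}^{2d}$ of total mass $1$. Assume that the communication rate $\phi$ is smooth, Lipschitz continuous, satisfies $\phi(r)=\phi(-r)$ and $(\phi(r)-\phi(s))(r-s)\le 0$ for all $r,s\ge 0$, and that $\phi_m\le\phi(r)\le\phi_M$ for some positive constants $\phi_m$ and $\phi_M$. Then $\mu_t$ shows herding behavior in the following sense: \[ \lim_{t\to\infty}\int_{\mathbb{R}^{2d}}\big(|x-x_c(t)|^2+|v-v_c(t)|^2\big)\,\mu_t(dx,dv)=0, \] where \[ x_c(t)=\int_{\mathbb{R}^{2d}}x\,\mu_t(dx,dv),\qquad v_c(t)=\int_{\mathbb{R}^{2d}}v\,\mu_t(dx,dv). \]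
   Context: The kinetic herding equation is \[ \partial_t f+v\cdot\nabla_x f+\nabla_v\cdot(Q(f)f)=0,\qquad (x,v)\in\mathbb{R}^d\times\mathbb{R}^d, \] where, for a measure $\mu_s$ on $\mathbb{R}^{2d}$, the non-local force is \[ Q(x,v,\mu_s)=\int_{\mathbb{R}^{2d}}\Big[\lambda_w(x^*-x)+\lambda_x\phi(|x-x^*|)(x^*-x)+\lambda_v\phi(|x-x^*|)(v^*-v)\Big]\mu_s(dx^*,dv^* ). \] Here $\phi:\mathbb{R}\to[0,\infty)$ is the communication rate and $\lambda_w,\lambda_x,\lambda_v$ are the interaction strengths. $\mathcal{M}(\mathbb{R}^{2d})$ is the space of nonnegative (finite) Radon measures, viewed in the dual of $C_0(\mathbb{R}^{2d})$, with $\langle\nu,g\rangle=\int g(x,v)\,\nu(dx,dv)$. $C_0^1$ denotes $C^1$ functions with compact support. Measure-valued solution: for $T\in(0,\infty)$, $\mu\in L^\infty([0,T);\mathcal{M}(\mathbb{R}^{2d}))$ is a measure-valued solution with initial measure $\mu_0$ if (1) $t\mapsto\langle\mu_t,g\rangle$ is continuous for all $g\in C_0(\mathbb{R}^{2d})$; and (2) for all $g\in C_0^1(\mathbb{R}^{2d}\times[0,T))$, \[ \langle\mu_t,g(\cdot,\cdot,t)\rangle-\langle\mu_0,g(\cdot,\cdot,0)\rangle=\int_0^t\langle\mu_s,\partial_s g+v\cdot\nabla_x g+Q(\cdot,\cdot,\mu_s)\cdot\nabla_v g\rangle\,ds . \] For compactly supported $\mu_0$ such a solution exists and is unique on $[0,T)$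 for every $T$; $\mu_t$, $t\ge0$, denotes the resulting global solution. *)

theory Defs
  imports "HOL-Analysis.Analysis"
begin

text \<open>
  On the Polish space of phase points every finite Borel measure is automatically Radon.
\<close>

definition finite_radon_measure :: "'a::{polish_space} measure \<Rightarrow> bool" where
  "finite_radon_measure M \<longleftrightarrow> sets M = sets borel \<and> finite_measure M"

definition compactly_supported :: "'a::topological_space measure \<Rightarrow> bool" where
  "compactly_supported M \<longleftrightarrow> (\<exists>K. compact K \<and> emeasure M (- K) = 0)"

definition C0_function :: "('a::real_normed_vector \<Rightarrow> real) \<Rightarrow> bool" where
  "C0_function g \<longleftrightarrow> continuous_on UNIV g \<and> (g \<longlongrightarrow> 0) at_infinity"

definition smooth_real :: "(real \<Rightarrow> real) \<Rightarrow> bool" where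
  "smooth_real \<phi> \<longleftrightarrow> (\<forall>k r. (deriv ^^ k) \<phi> differentiable (at r))"

definition herding_force ::
  "real \<Rightarrow> real \<Rightarrow> real \<Rightarrow> (real \<Rightarrow> real) \<Rightarrow> ((real^'n) \<times> (real^'n)) measure
    \<Rightarrow> (real^'n) \<times> (real^'n) \<Rightarrow> real^'n" where
  "herding_force lw lx lv \<phi> M = (\<lambda>(x, v). \<integral>(x', v').
      lw *\<^sub>R (x' - x)
    + (lx * \<phi> (norm (x - x'))) *\<^sub>R (x' - x)
    + (lv * \<phi> (norm (x - x'))) *\<^sub>R (v' - v) \<partial>M)"

text \<open>
  The compactly supported \<open>C\<^sup>1\<close> test functions \<open>g\<close> on phase space times \<open>[0,T)\<close>, together with
  their partial derivatives \<open>gt\<close>, \<open>gx\<close>, \<open>gv\<close> (in time, position and velocity). The time derivative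
  at \<open>0\<close> is one-sided; the support may meet the time \<open>0\<close> but stays away from \<open>T\<close>. The derivatives
  are uniquely determined by \<open>g\<close> on this domain.
\<close>

definition C1_test_function ::
  "real \<Rightarrow> (((real^'n) \<times> (real^'n)) \<times> real \<Rightarrow> real)
    \<Rightarrow> (((real^'n) \<times> (real^'n)) \<times> real \<Rightarrow> real)
    \<Rightarrow> (((real^'n) \<times> (real^'n)) \<times> real \<Rightarrow> real^'n)
    \<Rightarrow> (((real^'n) \<times> (real^'n)) \<times> real \<Rightarrow> real^'n) \<Rightarrow> bool" where
  "C1_test_function T g gt gx gv \<longleftrightarrow>
     (\<forall>p \<in> UNIV \<times> {0..<T}.
        (g has_derivative (\<lambda>((hx, hv), ht). gx p \<bullet> hx + gv p \<bullet> hv + gt p * ht))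
          (at p within UNIV \<times> {0..<T}))
   \<and> continuous_on (UNIV \<times> {0..<T}) gt
   \<and> continuous_on (UNIV \<times> {0..<T}) gx
   \<and> continuous_on (UNIV \<times> {0..<T}) gv
   \<and> (\<exists>K. compact K \<and> K \<subseteq> UNIV \<times> {0..<T} \<and> (\<forall>p \<in> UNIV \<times> {0..<T} - K. g p = 0))"

text \<open>
  Since Bochner integrals of non-integrable functions are \<open>0\<close>, the conditions which make the weak
  formulation meaningful are explicit: finiteness of the first moments, so that the integral
  defining the force converges absolutely at every phase point, and integrability in time of the
  right-hand side. Weak-* measurability in time is a consequence of the continuity condition, so
  the essential bound on the total mass is all that remains of membership in
  \<open>L\<^sup>\<infinity>\<close> on \<open>[0,T)\<close>.
\<close>

definition measure_valued_solution ::
  "real \<Rightarrow> real \<Rightarrow> real \<Rightarrow> (real \<Rightarrow> real) \<Rightarrow> real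
    \<Rightarrow> ((real^'n) \<times> (real^'n)) measure \<Rightarrow> (real \<Rightarrow> ((real^'n) \<times> (real^'n)) measure) \<Rightarrow> bool" where
  "measure_valued_solution lw lx lv \<phi> T \<mu>0 \<mu> \<longleftrightarrow>
     (\<forall>t \<in> {0..<T}. finite_radon_measure (\<mu> t) \<and> integrable (\<mu> t) (\<lambda>z. z))
   \<and> (\<exists>C. AE t in lborel. t \<in> {0..<T} \<longrightarrow> measure (\<mu> t) UNIV \<le> C)
   \<and> (\<forall>g. C0_function g \<longrightarrow> continuous_on {0..<T} (\<lambda>t. \<integral>z. g z \<partial>\<mu> t))
   \<and> (\<forall>g gt gx gv. C1_test_function T g gt gx gv \<longrightarrow>
        (let h = (\<lambda>s. \<integral>z. gt (z, s) + snd z \<bullet> gx (z, s)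
                        + herding_force lw lx lv \<phi> (\<mu> s) z \<bullet> gv (z, s) \<partial>\<mu> s)
         in \<forall>t \<in> {0..<T}.
              set_integrable lborel {0..t} h
            \<and> (\<integral>z. g (z, t) \<partial>\<mu> t) - (\<integral>z. g (z, 0) \<partial>\<mu>0) = (LINT s:{0..t}|lborel. h s)))"

definition mean_position :: "((real^'n) \<times> (real^'n)) measure \<Rightarrow> real^'n" where
  "mean_position M = (\<integral>(x, v). x \<partial>M)"

definition mean_velocity :: "((real^'n) \<times> (real^'n)) measure \<Rightarrow> real^'n" where
  "mean_velocity M = (\<integral>(x, v). v \<partial>M)"

end

theory Submission
  imports Defs
begin

text \<open>
  Write \<open>\<zeta> = (y, u)\<close> for the difference of two phase points. With \<open>\<Psi>'(s) = \<phi>(\<surd>s) / 2\<close> the functional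
  \<open>\<integral>\<integral> |u|\<^sup>2/2 + \<lambda>\<^sub>w|y|\<^sup>2/2 + \<lambda>\<^sub>x\<Psi>(|y|\<^sup>2) + \<delta> y \<bullet> u d\<mu>\<^sub>t d\<mu>\<^sub>t\<close> is, for small \<open>\<delta>\<close>, equivalent to the
  variance of \<open>\<mu>\<^sub>t\<close>. The potential \<open>\<Psi>\<close> makes the position-dependent part of the force conservative,
  the alignment force dissipates \<open>|u|\<^sup>2\<close> and the cross term dissipates \<open>|y|\<^sup>2\<close>, so the functional decays
  exponentially.

  A weak solution is only known to have a finite first moment at each single time. Lower
  semicontinuity in time, a short-time comparison and Baire's theorem show that the first moment is
  locally bounded; mass conservation and bounded second moments follow. The functional is not
  differentiated in time: \<open>\<integral>\<integral> G d\<mu>\<^sub>t d\<mu>\<^sub>t - \<integral>\<integral> G d\<mu>\<^sub>s d\<mu>\<^sub>s\<close> is the increment of the integral of the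
  fixed test function \<open>G * \<mu>\<^sub>t + G * \<mu>\<^sub>s\<close>, which gives the decay inequality up to an error of
  order \<open>(t - s)\<^sup>2\<close> that disappears on refining a partition of the time interval.
\<close>

section \<open>Gradients and cutoffs\<close>

text \<open>Working with pair differences removes the centre of mass: its motion never has to be
  followed, since for a unit mass the double integral of |z - y|^2 is twice the variance. The force
  integrates an odd kernel of z - y, so exchanging the particles turns the dissipation into a double
  integral of one function of \<zeta>, and an inequality pointwise in \<zeta> is enough.

  The obstacle is a circularity. Test functions have compact support, while the field grows linearly
  with a factor containing the first moment of the measure itself. Removing the cutoff by dominated
  convergence in time needs that moment bounded on the time interval, yet the bound should come from
  the formulation without cutoff. Even a Gronwall argument presupposes local boundedness, hence the
  detour through topology.

  Testing with potentials frozen at the endpoints s and t asks only for Lipschitz dependence of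
  their gradients on time. That is obtained by testing once more, now with the components of the
  gradient of G, so control of the second derivatives of G is required.\<close>

definition C1_gradient :: "('a::euclidean_space \<Rightarrow> real) \<Rightarrow> ('a \<Rightarrow> 'a) \<Rightarrow> bool" where
  "C1_gradient g \<gamma> \<longleftrightarrow> (\<forall>z. (g has_derivative (\<lambda>h. \<gamma> z \<bullet> h)) (at z)) \<and> continuous_on UNIV \<gamma>"

lemma C1_gradientD:
  assumes "C1_gradient g \<gamma>"
  shows "(g has_derivative (\<lambda>h. \<gamma> z \<bullet> h)) (at z within S)" "continuous_on UNIV \<gamma>" "continuous_on UNIV g"
    "g \<in> borel_measurable borel" "\<gamma> \<in> borel_measurable borel"
proof -
  have d: "(g has_derivative (\<lambda>h. \<gamma> z \<bullet> h)) (at z)" for z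
    using assms by (auto simp: C1_gradient_def)
  show "(g has_derivative (\<lambda>h. \<gamma> z \<bullet> h)) (at z within S)"
    using d has_derivative_at_withinI by blast
  show c: "continuous_on UNIV \<gamma>"
    using assms by (auto simp: C1_gradient_def)
  show cg: "continuous_on UNIV g"
    using d by (meson continuous_at_imp_continuous_on has_derivative_continuous)
  show "g \<in> borel_measurable borel" "\<gamma> \<in> borel_measurable borel"
    using c cg by (auto intro: borel_measurable_continuous_onI)
qed

lemma C1_gradient_const: "C1_gradient (\<lambda>z. c) (\<lambda>z. 0)"
  by (auto simp: C1_gradient_def)

lemma C1_gradient_add:
  assumes "C1_gradient f \<alpha>" "C1_gradient g \<beta>"
  shows "C1_gradient (\<lambda>z. f z + g z) (\<lambda>z. \<alpha> z + \<beta> z)"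
  unfolding C1_gradient_def
proof safe
  fix z
  show "((\<lambda>z. f z + g z) has_derivative (\<lambda>h. (\<alpha> z + \<beta> z) \<bullet> h)) (at z)"
    unfolding inner_add_left by (intro has_derivative_add assms[THEN C1_gradientD(1)])
  show "continuous_on UNIV (\<lambda>z. \<alpha> z + \<beta> z)"
    by (intro continuous_intros assms[THEN C1_gradientD(2)])
qed

lemma C1_gradient_mult:
  assumes f: "C1_gradient f \<alpha>" and g: "C1_gradient g \<beta>"
  shows "C1_gradient (\<lambda>z. f z * g z) (\<lambda>z. g z *\<^sub>R \<alpha> z + f z *\<^sub>R \<beta> z)"
  unfolding C1_gradient_def
proof safe
  fix z
  show "((\<lambda>z. f z * g z) has_derivative (\<lambda>h. (g z *\<^sub>R \<alpha> z + f z *\<^sub>R \<beta> z) \<bullet> h)) (at z)"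
    by (rule has_derivative_eq_rhs[OF has_derivative_mult[OF C1_gradientD(1)[OF f] C1_gradientD(1)[OF g]]])
      (auto simp: inner_add_left algebra_simps)
  show "continuous_on UNIV (\<lambda>z. g z *\<^sub>R \<alpha> z + f z *\<^sub>R \<beta> z)"
    by (intro continuous_intros C1_gradientD(2)[OF f] C1_gradientD(2)[OF g] C1_gradientD(3)[OF f] C1_gradientD(3)[OF g])
qed

lemma C1_gradient_compose:
  assumes g: "C1_gradient g \<gamma>" and f: "\<And>z. (f has_real_derivative f' (g z)) (at (g z))"
    and f': "continuous_on (range g) f'"
  shows "C1_gradient (\<lambda>z. f (g z)) (\<lambda>z. f' (g z) *\<^sub>R \<gamma> z)"
  unfolding C1_gradient_def
proof safe
  fix z
  have "(f has_derivative (*) (f' (g z))) (at (g z))"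
    using f[of z] by (simp add: has_field_derivative_def)
  from diff_chain_at[OF C1_gradientD(1)[OF g] this]
  show "((\<lambda>z. f (g z)) has_derivative (\<lambda>h. (f' (g z) *\<^sub>R \<gamma> z) \<bullet> h)) (at z)"
    by (simp add: o_def)
  show "continuous_on UNIV (\<lambda>z. f' (g z) *\<^sub>R \<gamma> z)"
    by (intro continuous_on_scaleR C1_gradientD(2)[OF g] continuous_on_compose2[OF f' C1_gradientD(3)[OF g]]) auto
qed

lemma C1_gradient_inner_self: "C1_gradient (\<lambda>z. z \<bullet> z) (\<lambda>z. 2 *\<^sub>R z)"
  unfolding C1_gradient_def
  by (auto intro!: derivative_eq_intros continuous_intros simp: inner_commute)

text \<open>The Japanese bracket: a weight comparable to 1 + |z| that is differentiable at the
  origin, with gradient of norm at most 1. Being at least 1, it also absorbs constants.\<close>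

definition bracket :: "'a::euclidean_space \<Rightarrow> real" where
  "bracket z = sqrt (1 + z \<bullet> z)"

lemma bracket_ge_1: "1 \<le> bracket z"
  by (simp add: bracket_def)

lemma bracket_pos: "0 < bracket z"
  using bracket_ge_1[of z] by linarith

lemma bracket_nonneg[simp]: "0 \<le> bracket z" and abs_bracket[simp]: "\<bar>bracket z\<bar> = bracket z"
  using bracket_pos[of z] by simp_all

lemma bracket_sq: "(bracket z)\<^sup>2 = 1 + z \<bullet> z"
  by (simp add: bracket_def)

lemma norm_le_bracket: "norm z \<le> bracket z"
  by (simp add: bracket_def norm_eq_sqrt_inner)

lemma bracket_le: "bracket z \<le> 1 + norm z"
proof -
  have "1 + z \<bullet> z \<le> (1 + norm z)\<^sup>2"
    by (simp add: power2_eq_square dot_square_norm algebra_simps)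
  then show ?thesis
    by (simp add: bracket_def real_le_lsqrt)
qed

lemma bracket_measurable[measurable]: "bracket \<in> borel_measurable borel"
  unfolding bracket_def by measurable

lemma C1_gradient_bracket: "C1_gradient bracket (\<lambda>z. inverse (bracket z) *\<^sub>R z)"
proof -
  have "C1_gradient (\<lambda>z. sqrt (1 + z \<bullet> z)) (\<lambda>z. (inverse (sqrt (1 + z \<bullet> z)) / 2) *\<^sub>R (0 + 2 *\<^sub>R (z::'a)))"
    by (rule C1_gradient_compose[OF C1_gradient_add[OF C1_gradient_const C1_gradient_inner_self],
          of sqrt "\<lambda>s. inverse (sqrt s) / 2"])
      (auto intro!: DERIV_real_sqrt continuous_intros simp: add_pos_nonneg
        intro: add_pos_nonneg less_imp_neq less_imp_neq[symmetric] simp: add_nonneg_eq_0_iff)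
  then show ?thesis
    unfolding bracket_def[abs_def] by simp
qed

text \<open>The square of the positive part is C^1 and vanishes on a half line; nesting it gives a
  cutoff profile by elementary means.\<close>

definition sqpos :: "real \<Rightarrow> real" where
  "sqpos r = (max 0 r)\<^sup>2"

lemma sqpos_has_derivative: "(sqpos has_real_derivative 2 * max 0 r) (at r)"
proof -
  consider "r < 0" | "r = 0" | "r > 0" by linarith
  then show ?thesis
  proof cases
    case 1
    have "((\<lambda>r. 0) has_real_derivative 2 * max 0 r) (at r)"
      using 1 by simp
    then show ?thesis
      by (rule has_field_derivative_transform_within_open[of _ _ _ "{..<0}"]) (use 1 in \<open>auto simp: sqpos_def\<close>)
  next
    case 2
    have "((\<lambda>h. (sqpos (0 + h) - sqpos 0) / h) \<longlongrightarrow> 0) (at 0)"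
    proof (rule Lim_null_comparison)
      show "\<forall>\<^sub>F h in at 0. norm ((sqpos (0 + h) - sqpos 0) / h) \<le> \<bar>h\<bar>"
        by (rule always_eventually) (auto simp: sqpos_def max_def power2_eq_square)
      show "(abs \<longlongrightarrow> 0) (at (0::real))"
        by (auto intro!: tendsto_eq_intros)
    qed
    then show ?thesis
      using 2 by (simp add: DERIV_def)
  next
    case 3
    have "((\<lambda>r. r\<^sup>2) has_real_derivative 2 * max 0 r) (at r)"
      using 3 by (auto intro!: derivative_eq_intros)
    then show ?thesis
      by (rule has_field_derivative_transform_within_open[of _ _ _ "{0<..}"]) (use 3 in \<open>auto simp: sqpos_def\<close>)
  qed
qed

lemma sqpos_nonneg: "0 \<le> sqpos r"
  by (simp add: sqpos_def)

text \<open>A \<open>C\<^sup>1\<close> transition from \<open>1\<close> on \<open>r \<le> 0\<close> to \<open>0\<close> on \<open>r \<ge> 1\<close>.\<close>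

definition transition :: "real \<Rightarrow> real" where
  "transition r = sqpos (1 - sqpos r)"

definition transition' :: "real \<Rightarrow> real" where
  "transition' r = - 4 * max 0 (1 - sqpos r) * max 0 r"

lemma transition_has_derivative: "(transition has_real_derivative transition' r) (at r within S)"
proof -
  have "((\<lambda>r. 1 - sqpos r) has_real_derivative - (2 * max 0 r)) (at r)"
    by (auto intro!: derivative_eq_intros sqpos_has_derivative)
  from DERIV_chain2[OF sqpos_has_derivative[of "1 - sqpos r"] this]
  have "(transition has_real_derivative transition' r) (at r)"
    unfolding transition_def[abs_def] transition'_def by (simp add: algebra_simps)
  then show ?thesis
    by (rule has_field_derivative_at_within)
qed

lemma continuous_on_sqpos: "continuous_on S sqpos"
  unfolding sqpos_def[abs_def] by (intro continuous_intros)

lemma continuous_on_transition': "continuous_on S transition'"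
  unfolding transition'_def[abs_def] by (intro continuous_intros continuous_on_sqpos)

lemma transition_bounds: "0 \<le> transition r" "transition r \<le> 1"
proof -
  show "0 \<le> transition r" by (simp add: transition_def sqpos_nonneg)
  have "(max 0 (1 - sqpos r))\<^sup>2 \<le> 1\<^sup>2"
    by (rule power_mono) (auto simp: sqpos_nonneg)
  then show "transition r \<le> 1"
    unfolding transition_def sqpos_def[of "1 - sqpos r"] by simp
qed

lemma transition_eq_1: "r \<le> 0 \<Longrightarrow> transition r = 1"
  by (simp add: transition_def sqpos_def)

lemma transition'_eq_0: "r \<le> 0 \<Longrightarrow> transition' r = 0"
  by (simp add: transition'_def)

lemma transition_eq_0:
  assumes "1 \<le> r" shows "transition r = 0" "transition' r = 0"
proof -
  have "1 \<le> sqpos r"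
    using assms by (simp add: sqpos_def max_def)
  then show "transition r = 0" "transition' r = 0"
    by (auto simp: transition_def transition'_def sqpos_def[of "1 - sqpos r"])
qed

lemma transition'_bound: "\<bar>transition' r\<bar> \<le> 4"
proof (cases "1 \<le> r")
  case True
  then show ?thesis by (simp add: transition_eq_0)
next
  case False
  have "\<bar>transition' r\<bar> = 4 * (max 0 (1 - sqpos r) * max 0 r)"
    by (simp add: transition'_def abs_mult)
  also have "max 0 (1 - sqpos r) * max 0 r \<le> 1 * 1"
    using False by (intro mult_mono) (auto simp: sqpos_nonneg)
  finally show ?thesis by simp
qed

text \<open>The profile is applied to |z|^2 / S^2 - 1 instead of |z|, which avoids the kink of the
  norm: the value is 1 for |z| \<le> S and 0 once |z|^2 \<ge> 2 S^2.\<close>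

definition cutoff :: "real \<Rightarrow> 'a::euclidean_space \<Rightarrow> real" where
  "cutoff S z = transition (z \<bullet> z / S\<^sup>2 - 1)"

definition cutoff_grad :: "real \<Rightarrow> 'a::euclidean_space \<Rightarrow> 'a" where
  "cutoff_grad S z = (2 * transition' (z \<bullet> z / S\<^sup>2 - 1) / S\<^sup>2) *\<^sub>R z"

lemma C1_gradient_cutoff: "C1_gradient (cutoff S) (cutoff_grad S)"
proof -
  have "C1_gradient (\<lambda>z. transition (z \<bullet> z * inverse (S\<^sup>2) + - 1))
     (\<lambda>z. transition' (z \<bullet> z * inverse (S\<^sup>2) + - 1) *\<^sub>R
       ((inverse (S\<^sup>2) *\<^sub>R (2 *\<^sub>R z) + (z \<bullet> z) *\<^sub>R 0) + (0::'a)))"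
    by (rule C1_gradient_compose[OF C1_gradient_add[OF C1_gradient_mult[OF C1_gradient_inner_self C1_gradient_const]
          C1_gradient_const], of transition transition'])
      (auto intro: transition_has_derivative continuous_on_transition')
  then show ?thesis
    unfolding cutoff_def[abs_def] cutoff_grad_def[abs_def]
    by (simp add: divide_inverse ac_simps)
qed

lemma cutoff_measurable[measurable]: "cutoff S \<in> borel_measurable borel"
  by (rule C1_gradientD(4)[OF C1_gradient_cutoff])

lemma cutoff_bounds: "0 \<le> cutoff S z" "cutoff S z \<le> 1"
  by (simp_all add: cutoff_def transition_bounds)

lemma cutoff_eq_1:
  assumes "S > 0" "norm z \<le> S" shows "cutoff S z = 1" "cutoff_grad S z = 0"
proof -
  have "z \<bullet> z \<le> S\<^sup>2"
    using assms by (simp add: dot_square_norm power_mono)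
  then have "z \<bullet> z / S\<^sup>2 - 1 \<le> 0"
    using assms by (simp add: field_simps)
  then show "cutoff S z = 1" "cutoff_grad S z = 0"
    by (simp_all add: cutoff_def cutoff_grad_def transition_eq_1 transition'_eq_0)
qed

lemma cutoff_eq_0:
  assumes "S > 0" "2 * S \<le> norm z" shows "cutoff S z = 0" "cutoff_grad S z = 0"
proof -
  have "2 * S\<^sup>2 \<le> (2 * S)\<^sup>2"
    by (simp add: power_mult_distrib)
  also have "\<dots> \<le> z \<bullet> z"
    using assms unfolding dot_square_norm by (intro power_mono) auto
  finally have "1 \<le> z \<bullet> z / S\<^sup>2 - 1"
    using assms by (simp add: field_simps)
  then show "cutoff S z = 0" "cutoff_grad S z = 0"
    by (simp_all add: cutoff_def cutoff_grad_def transition_eq_0)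
qed

lemma cutoff_support: "S > 0 \<Longrightarrow> z \<notin> cball 0 (2 * S) \<Longrightarrow> cutoff S z = 0"
  using cutoff_eq_0(1)[of S z] by auto

text \<open>The gradient is of order 1/S and lives in |z| \<le> 2 S, so a linear weight is
  compensated uniformly in S. The constant is (3 S) (8 / S^2) (2 S), with 1 + 2 S \<le> 3 S from S
  \<ge> 1.\<close>

lemma bracket_cutoff_grad:
  assumes "S \<ge> 1" shows "bracket z * norm (cutoff_grad S z) \<le> 48"
proof (cases "norm z \<le> 2 * S")
  case False
  then show ?thesis using assms by (simp add: cutoff_eq_0)
next
  case True
  have "bracket z * norm (cutoff_grad S z) = bracket z * (2 * \<bar>transition' (z \<bullet> z / S\<^sup>2 - 1)\<bar> / S\<^sup>2 * norm z)"
    by (simp add: cutoff_grad_def abs_mult)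
  also have "\<dots> \<le> (1 + 2 * S) * (2 * 4 / S\<^sup>2 * (2 * S))"
    using bracket_le[of z] True assms bracket_pos[of z]
    by (intro mult_mono divide_right_mono transition'_bound) auto
  also have "\<dots> \<le> (3 * S) * (2 * 4 / S\<^sup>2 * (2 * S))"
    using assms by (intro mult_right_mono) auto
  also have "\<dots> = 48"
    using assms by (simp add: field_simps power2_eq_square)
  finally show ?thesis .
qed

lemma cutoff_tendsto:
  "((\<lambda>k. cutoff (real (Suc k)) z) \<longlongrightarrow> 1) sequentially"
  "((\<lambda>k. cutoff_grad (real (Suc k)) z) \<longlongrightarrow> 0) sequentially"
proof -
  obtain N where N: "norm z \<le> real N"
    using real_arch_simple by blast
  then have "norm z \<le> real (Suc k)" if "k \<ge> N" for k
    using that by (smt (verit) of_nat_mono le_SucI)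
  then have "\<forall>\<^sub>F k in sequentially. cutoff (real (Suc k)) z = 1"
    "\<forall>\<^sub>F k in sequentially. cutoff_grad (real (Suc k)) z = 0"
    unfolding eventually_sequentially using cutoff_eq_1[where z = z] by (metis of_nat_0_less_iff zero_less_Suc)+
  then show "((\<lambda>k. cutoff (real (Suc k)) z) \<longlongrightarrow> 1) sequentially"
    "((\<lambda>k. cutoff_grad (real (Suc k)) z) \<longlongrightarrow> 0) sequentially"
    by (auto intro: tendsto_eventually)
qed

section \<open>Gronwall without derivatives, and estimates for integrals\<close>

text \<open>After multiplication by exp (- C t) every increment is at most of order (t - s)^2, so n
  equal steps add up to an error of order 1/n. The sign of C is free: the rate is nonnegative for
  the second moment and nonpositive for the energy.\<close>

lemma gronwall_approx:
  fixes F :: "real \<Rightarrow> real"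
  assumes T: "0 \<le> T" and nonneg: "\<And>t. t \<in> {0..T} \<Longrightarrow> 0 \<le> F t" and K: "0 \<le> K"
    and step: "\<And>s t. 0 \<le> s \<Longrightarrow> s \<le> t \<Longrightarrow> t \<le> T \<Longrightarrow> F t \<le> F s + C * (t - s) * F s + K * (t - s)\<^sup>2"
  shows "F T \<le> exp (C * T) * F 0"
proof -
  define u where "u t = exp (- C * t) * F t" for t
  define K' where "K' = exp (\<bar>C\<bar> * T) * K"
  have u: "u t \<le> u s + K' * (t - s)\<^sup>2" if "0 \<le> s" "s \<le> t" "t \<le> T" for s t
  proof -
    have "F t \<le> (1 + C * (t - s)) * F s + K * (t - s)\<^sup>2"
      using step[OF that] by (simp add: algebra_simps)
    also have "(1 + C * (t - s)) * F s \<le> exp (C * (t - s)) * F s"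
      by (intro mult_right_mono exp_ge_add_one_self nonneg) (use that in auto)
    finally have "exp (- C * t) * F t \<le> exp (- C * t) * (exp (C * (t - s)) * F s + K * (t - s)\<^sup>2)"
      by simp
    also have "\<dots> = u s + exp (- C * t) * K * (t - s)\<^sup>2"
      by (simp add: u_def algebra_simps exp_diff exp_minus divide_simps)
    also have "exp (- C * t) * K * (t - s)\<^sup>2 \<le> K' * (t - s)\<^sup>2"
    proof -
      have "- C * t \<le> \<bar>C\<bar> * t" using that by (intro mult_right_mono) auto
      also have "\<dots> \<le> \<bar>C\<bar> * T" using that by (intro mult_left_mono) auto
      finally show ?thesis unfolding K'_def using K by (intro mult_right_mono) auto
    qed
    finally show ?thesis by (simp add: u_def)
  qed
  have le: "u T \<le> u 0 + K' * T\<^sup>2 * inverse (real (Suc n))" for n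
  proof -
    define \<tau> where "\<tau> = T / real (Suc n)"
    have ind: "u (real k * \<tau>) \<le> u 0 + real k * (K' * \<tau>\<^sup>2)" if "k \<le> Suc n" for k
      using that
    proof (induction k)
      case (Suc k)
      have "real (Suc k) * \<tau> \<le> real (Suc n) * \<tau>"
        using Suc.prems T by (intro mult_right_mono) (auto simp: \<tau>_def)
      then have "u (real (Suc k) * \<tau>) \<le> u (real k * \<tau>) + K' * (real (Suc k) * \<tau> - real k * \<tau>)\<^sup>2"
        using T by (intro u) (auto simp: \<tau>_def intro!: mult_right_mono divide_right_mono)
      also have "real (Suc k) * \<tau> - real k * \<tau> = \<tau>"
        by (simp add: algebra_simps)
      finally show ?case
        using Suc by (simp add: algebra_simps)
    qed simp
    have "real (Suc n) * (K' * \<tau>\<^sup>2) = K' * T\<^sup>2 * inverse (real (Suc n))"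
      by (simp add: \<tau>_def power_divide power2_eq_square inverse_eq_divide del: of_nat_Suc)
    moreover have "real (Suc n) * \<tau> = T"
      by (simp add: \<tau>_def)
    ultimately show ?thesis
      using ind[OF order.refl] by metis
  qed
  have "(\<lambda>n. u 0 + K' * T\<^sup>2 * inverse (real (Suc n))) \<longlonglongrightarrow> u 0 + K' * T\<^sup>2 * 0"
    by (intro tendsto_intros LIMSEQ_inverse_real_of_nat)
  then have "u T \<le> u 0"
    using le by (intro LIMSEQ_le_const[of _ _ "u T"]) auto
  then have "exp (C * T) * u T \<le> exp (C * T) * u 0"
    by simp
  then show ?thesis
    by (simp add: u_def exp_minus field_simps)
qed

text \<open>For limits without a known integrable majorant: integrability of the limit is part of
  the conclusion.\<close>

lemma integral_Fatou:
  fixes s :: "nat \<Rightarrow> 'a \<Rightarrow> real"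
  assumes int: "\<And>k. integrable M (s k)" and nonneg: "\<And>k z. 0 \<le> s k z"
    and lim: "\<And>z. (\<lambda>k. s k z) \<longlonglongrightarrow> g z" and le: "\<And>k. (\<integral>z. s k z \<partial>M) \<le> K"
  shows "integrable M g" "(\<integral>z. g z \<partial>M) \<le> K"
proof -
  have [measurable]: "s k \<in> borel_measurable M" for k
    using int by auto
  have [measurable]: "g \<in> borel_measurable M"
    using lim by (rule borel_measurable_LIMSEQ_real) auto
  have g0: "0 \<le> g z" for z
    using LIMSEQ_le_const[OF lim[of z], of 0] nonneg by blast
  have K: "0 \<le> K"
    using le[of 0] by (rule order_trans[rotated]) (simp add: nonneg)
  have "(\<integral>\<^sup>+z. ennreal (g z) \<partial>M) = (\<integral>\<^sup>+z. liminf (\<lambda>k. ennreal (s k z)) \<partial>M)"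
    using lim by (intro nn_integral_cong lim_imp_Liminf[symmetric]) (auto intro: tendsto_ennrealI)
  also have "\<dots> \<le> liminf (\<lambda>k. \<integral>\<^sup>+z. ennreal (s k z) \<partial>M)"
    by (rule nn_integral_liminf) simp
  also have "\<dots> = liminf (\<lambda>k. ennreal (\<integral>z. s k z \<partial>M))"
    by (simp add: nn_integral_eq_integral int nonneg)
  also have "\<dots> \<le> ennreal K"
    by (intro Liminf_le sequentially_bot always_eventually allI ennreal_leI le)
  finally have fin: "(\<integral>\<^sup>+z. ennreal (g z) \<partial>M) \<le> ennreal K" .
  then show "integrable M g"
    by (intro integrableI_nonneg) (auto simp: g0 intro: le_less_trans)
  then show "(\<integral>z. g z \<partial>M) \<le> K"
    using fin K by (simp add: nn_integral_eq_integral g0)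
qed

lemma set_integral_le_const:
  fixes h :: "real \<Rightarrow> real"
  assumes "set_integrable lborel {a..t} h" "a \<le> t" "\<And>r. r \<in> {a..t} \<Longrightarrow> h r \<le> K"
  shows "(LINT r:{a..t}|lborel. h r) \<le> K * (t - a)"
proof -
  have "(LINT r:{a..t}|lborel. h r) \<le> (LINT r:{a..t}|lborel. K)"
    by (rule set_integral_mono[OF assms(1)]) (use assms in \<open>auto simp: set_integrable_def\<close>)
  then show ?thesis
    using assms(2) by (simp add: set_lebesgue_integral_def mult.commute)
qed

lemma set_integral_abs_le_const:
  fixes h :: "real \<Rightarrow> real"
  assumes h: "set_integrable lborel {a..t} h" and "a \<le> t" "\<And>r. r \<in> {a..t} \<Longrightarrow> \<bar>h r\<bar> \<le> K"
  shows "\<bar>LINT r:{a..t}|lborel. h r\<bar> \<le> K * (t - a)"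
proof -
  have "(LINT r:{a..t}|lborel. h r) \<le> K * (t - a)"
    using assms by (intro set_integral_le_const) (auto simp: abs_le_iff)
  moreover have "(LINT r:{a..t}|lborel. - h r) \<le> K * (t - a)"
    using assms by (intro set_integral_le_const)
      (auto simp: abs_le_iff set_integrable_def intro: integrable_minus)
  moreover have "(LINT r:{a..t}|lborel. - h r) = - (LINT r:{a..t}|lborel. h r)"
    by (simp add: set_lebesgue_integral_def)
  ultimately show ?thesis by linarith
qed

lemma set_integral_split:
  fixes h :: "real \<Rightarrow> real"
  assumes h: "set_integrable lborel {0..t} h" and "0 \<le> a" "a \<le> t"
  shows "set_integrable lborel {a..t} h"
    "(LINT r:{0..t}|lborel. h r) - (LINT r:{0..a}|lborel. h r) = (LINT r:{a..t}|lborel. h r)"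
proof -
  show i: "set_integrable lborel {a..t} h"
    by (rule set_integrable_subset[OF h]) (use assms in auto)
  have "(LINT r:{0..a} \<union> {a<..t}|lborel. h r) = (LINT r:{0..a}|lborel. h r) + (LINT r:{a<..t}|lborel. h r)"
    by (intro set_integral_Un set_integrable_subset[OF h]) (use assms in auto)
  moreover have "{0..a} \<union> {a<..t} = {0..t}"
    using assms by auto
  moreover have "(LINT r:{a<..t}|lborel. h r) = (LINT r:{a..t}|lborel. h r)"
  proof (rule set_integral_cong_set)
    show "set_borel_measurable lborel {a<..t} h" "set_borel_measurable lborel {a..t} h"
      using i set_integrable_subset[OF h, of "{a<..t}"] assms
      unfolding set_integrable_def set_borel_measurable_def
      by (force intro!: borel_measurable_integrable)+
    show "AE x in lborel. (x \<in> {a..t}) = (x \<in> {a<..t})"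
      using AE_lborel_singleton[of a] by eventually_elim auto
  qed
  ultimately show "(LINT r:{0..t}|lborel. h r) - (LINT r:{0..a}|lborel. h r) = (LINT r:{a..t}|lborel. h r)"
    by simp
qed

section \<open>Extending the weak formulation\<close>

text \<open>The kinetic equation as a transport equation on phase space: velocity and force are
  merged into \<open>b\<close>, test functions are stationary, and the initial measure is
  \<open>\<mu> 0\<close>. The growth bound on \<open>b\<close> contains the first moment of the
  current measure, which is finite at each time but not assumed bounded in time. One constant
  \<open>C\<close> serves for the mass and for the growth.\<close>

locale weak_transport =
  fixes \<mu> :: "real \<Rightarrow> 'a::euclidean_space measure" and b :: "real \<Rightarrow> 'a \<Rightarrow> 'a" and T C :: real
  assumes T_nonneg: "0 \<le> T"
    and sets_\<mu>: "t \<in> {0..T} \<Longrightarrow> sets (\<mu> t) = sets borel"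
    and finite_\<mu>: "t \<in> {0..T} \<Longrightarrow> finite_measure (\<mu> t)"
    and mass_le: "t \<in> {0..T} \<Longrightarrow> measure (\<mu> t) UNIV \<le> C"
    and integrable_id: "t \<in> {0..T} \<Longrightarrow> integrable (\<mu> t) (\<lambda>z. z)"
    and b_measurable: "t \<in> {0..T} \<Longrightarrow> b t \<in> borel_measurable borel"
    and b_bound: "t \<in> {0..T} \<Longrightarrow> norm (b t z) \<le> C * (bracket z + (\<integral>z. bracket z \<partial>\<mu> t))"
    and weakly_continuous: "continuous_on UNIV g \<Longrightarrow> compact K \<Longrightarrow> (\<And>z. z \<notin> K \<Longrightarrow> g z = 0) \<Longrightarrow>
      continuous_on {0..T} (\<lambda>t. \<integral>z. g z \<partial>\<mu> t)"
    and weak: "C1_gradient g \<gamma> \<Longrightarrow> compact K \<Longrightarrow> (\<And>z. z \<notin> K \<Longrightarrow> g z = 0) \<Longrightarrow> t \<in> {0..T} \<Longrightarrow>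
      set_integrable lborel {0..t} (\<lambda>r. \<integral>z. b r z \<bullet> \<gamma> z \<partial>\<mu> r) \<and>
      (\<integral>z. g z \<partial>\<mu> t) - (\<integral>z. g z \<partial>\<mu> 0) = (LINT r:{0..t}|lborel. \<integral>z. b r z \<bullet> \<gamma> z \<partial>\<mu> r)"
begin

definition moment :: "real \<Rightarrow> real" where
  "moment t = (\<integral>z. bracket z \<partial>\<mu> t)"

lemma C_nonneg: "0 \<le> C"
  using mass_le[of 0] T_nonneg by (auto intro: order_trans[OF measure_nonneg])

lemma space_\<mu>: "t \<in> {0..T} \<Longrightarrow> space (\<mu> t) = UNIV"
  using sets_eq_imp_space_eq[OF sets_\<mu>] by simp

lemma measurable_\<mu>: "t \<in> {0..T} \<Longrightarrow> g \<in> borel_measurable borel \<Longrightarrow> g \<in> borel_measurable (\<mu> t)"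
  using measurable_cong_sets[OF sets_\<mu> refl] by blast

lemma integrable_const: "t \<in> {0..T} \<Longrightarrow> integrable (\<mu> t) (\<lambda>z. c :: 'b::{banach, second_countable_topology})"
  using finite_\<mu> finite_measure.integrable_const by blast

lemma integral_const: "t \<in> {0..T} \<Longrightarrow> (\<integral>z. c \<partial>\<mu> t) = measure (\<mu> t) UNIV * (c::real)"
  by (simp add: space_\<mu>)

lemma integrable_bracket: "t \<in> {0..T} \<Longrightarrow> integrable (\<mu> t) bracket"
  by (rule Bochner_Integration.integrable_bound[of _ "\<lambda>z. 1 + norm z"])
    (auto simp: integrable_const integrable_id abs_of_pos[OF bracket_pos] bracket_le
      intro!: measurable_\<mu> AE_I2)

lemma integrable_bound:
  fixes g :: "'a \<Rightarrow> 'b::{banach, second_countable_topology}"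
  assumes "t \<in> {0..T}" "integrable (\<mu> t) w" "g \<in> borel_measurable borel" "\<And>z. norm (g z) \<le> (w z :: real)"
  shows "integrable (\<mu> t) g"
proof (rule Bochner_Integration.integrable_bound[OF assms(2)])
  show "g \<in> borel_measurable (\<mu> t)"
    using assms by (intro measurable_\<mu>)
  show "AE z in \<mu> t. norm (g z) \<le> norm (w z)"
    unfolding real_norm_def by (intro AE_I2 order_trans[OF assms(4) abs_ge_self])
qed

lemma integral_abs_le:
  fixes g :: "'a \<Rightarrow> real"
  assumes "t \<in> {0..T}" "integrable (\<mu> t) w" "g \<in> borel_measurable borel" "\<And>z. \<bar>g z\<bar> \<le> (w z :: real)"
  shows "\<bar>\<integral>z. g z \<partial>\<mu> t\<bar> \<le> (\<integral>z. w z \<partial>\<mu> t)"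
proof -
  have le: "norm (g z) \<le> w z" for z
    using assms(4) by simp
  show ?thesis
    using Bochner_Integration.integral_norm_bound_integral[OF integrable_bound[OF assms(1,2,3) le] assms(2) le] by simp
qed

lemma moment_nonneg: "0 \<le> moment t"
  unfolding moment_def by (rule Bochner_Integration.integral_nonneg) (simp add: bracket_pos less_imp_le)

text \<open>The weight \<open>\<omega>\<close> stays free so that one estimate covers gradients of
  bounded size (\<open>\<omega>\<close> equal to 1) and of linear growth (\<open>\<omega>\<close>
  equal to \<open>bracket\<close>).\<close>

lemma flux_integrable:
  assumes r: "r \<in> {0..T}" and \<gamma>: "\<gamma> \<in> borel_measurable borel" and \<omega>: "\<And>z. 1 \<le> \<omega> z"
    and w: "integrable (\<mu> r) (\<lambda>z. bracket z * \<omega> z)" and le: "\<And>z. norm (\<gamma> z) \<le> c * \<omega> z"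
  shows "integrable (\<mu> r) (\<lambda>z. b r z \<bullet> \<gamma> z)"
    "\<bar>b r z \<bullet> \<gamma> z\<bar> \<le> C * c * (1 + moment r) * (bracket z * \<omega> z)"
    "\<bar>\<integral>z. b r z \<bullet> \<gamma> z \<partial>\<mu> r\<bar> \<le> C * c * (1 + moment r) * (\<integral>z. bracket z * \<omega> z \<partial>\<mu> r)"
proof -
  have c: "0 \<le> c"
    using le[of 0] \<omega>[of 0] norm_ge_zero[of "\<gamma> 0"] by (smt (verit) mult_neg_pos)
  have bd: "\<bar>b r z \<bullet> \<gamma> z\<bar> \<le> C * c * (1 + moment r) * (bracket z * \<omega> z)" for z
  proof -
    have "\<bar>b r z \<bullet> \<gamma> z\<bar> \<le> norm (b r z) * norm (\<gamma> z)"
      by (rule Cauchy_Schwarz_ineq2)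
    also have "\<dots> \<le> (C * (bracket z + moment r)) * (c * \<omega> z)"
      using b_bound[OF r, of z] le[of z] C_nonneg bracket_pos[of z] moment_nonneg[of r]
      by (intro mult_mono) (auto simp: moment_def)
    also have "\<dots> \<le> (C * (bracket z + bracket z * moment r)) * (c * \<omega> z)"
      using C_nonneg c \<omega>[of z] moment_nonneg[of r] bracket_ge_1[of z]
      by (intro mult_right_mono mult_left_mono add_left_mono) (auto simp: mult_le_cancel_right1)
    finally show ?thesis by (simp add: algebra_simps)
  qed
  then show "\<bar>b r z \<bullet> \<gamma> z\<bar> \<le> C * c * (1 + moment r) * (bracket z * \<omega> z)" .
  have m: "(\<lambda>z. b r z \<bullet> \<gamma> z) \<in> borel_measurable borel"
    using \<gamma> b_measurable[OF r] by measurable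
  show "integrable (\<mu> r) (\<lambda>z. b r z \<bullet> \<gamma> z)"
    by (rule integrable_bound[OF r _ m, of "\<lambda>z. C * c * (1 + moment r) * (bracket z * \<omega> z)"])
      (use bd w in auto)
  have "\<bar>\<integral>z. b r z \<bullet> \<gamma> z \<partial>\<mu> r\<bar> \<le> (\<integral>z. C * c * (1 + moment r) * (bracket z * \<omega> z) \<partial>\<mu> r)"
    by (rule integral_abs_le[OF r _ m]) (use bd w in auto)
  then show "\<bar>\<integral>z. b r z \<bullet> \<gamma> z \<partial>\<mu> r\<bar> \<le> C * c * (1 + moment r) * (\<integral>z. bracket z * \<omega> z \<partial>\<mu> r)"
    by simp
qed

text \<open>Linear in the moment, whereas \<open>flux_integrable\<close> would give a quadratic
  bound: integrating the constant \<open>moment r\<close> costs only the mass, at most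
  \<open>C\<close>. Linearity makes the time step in \<open>moment_short_time\<close> independent of
  the size of the moment.\<close>

lemma flux_le_moment:
  assumes r: "r \<in> {0..T}" and \<gamma>: "\<gamma> \<in> borel_measurable borel" and le: "\<And>z. norm (\<gamma> z) \<le> 1"
  shows "\<bar>\<integral>z. b r z \<bullet> \<gamma> z \<partial>\<mu> r\<bar> \<le> C * (1 + C) * moment r"
proof -
  have bd: "\<bar>b r z \<bullet> \<gamma> z\<bar> \<le> C * (bracket z + moment r)" for z
  proof -
    have "\<bar>b r z \<bullet> \<gamma> z\<bar> \<le> norm (b r z) * norm (\<gamma> z)"
      by (rule Cauchy_Schwarz_ineq2)
    also have "\<dots> \<le> (C * (bracket z + moment r)) * 1"
      using b_bound[OF r, of z] le[of z] C_nonneg bracket_pos[of z] moment_nonneg[of r]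
      by (intro mult_mono) (auto simp: moment_def)
    finally show ?thesis by simp
  qed
  have "\<bar>\<integral>z. b r z \<bullet> \<gamma> z \<partial>\<mu> r\<bar> \<le> (\<integral>z. C * (bracket z + moment r) \<partial>\<mu> r)"
    using \<gamma> b_measurable[OF r]
    by (intro integral_abs_le[OF r _ _ bd] integrable_mult_right Bochner_Integration.integrable_add
        integrable_bracket[OF r] integrable_const[OF r]) measurable
  also have "\<dots> = C * (moment r + measure (\<mu> r) UNIV * moment r)"
    by (simp add: moment_def integrable_bracket[OF r] integrable_const[OF r] integral_const[OF r]
        space_\<mu>[OF r])
  also have "\<dots> \<le> C * (moment r + C * moment r)"
    using mass_le[OF r] moment_nonneg[of r] C_nonneg by (intro mult_left_mono add_left_mono mult_right_mono) auto
  finally show ?thesis by (simp add: algebra_simps)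
qed

text \<open>
  The weak formulation extends from compactly supported functions to functions of controlled
  growth by truncation: the gradients of the cutoffs decay like the inverse of the bracket, so
  dominated convergence applies in phase space and in time.
\<close>

lemma weak_extended:
  assumes a: "0 \<le> a" "a \<le> t" "t \<le> T" and g: "C1_gradient g \<gamma>"
    and \<omega>: "\<omega> \<in> borel_measurable borel" "\<And>z. 1 \<le> \<omega> z"
    and g_le: "\<And>z. \<bar>g z\<bar> \<le> c * (bracket z * \<omega> z)" and \<gamma>_le: "\<And>z. norm (\<gamma> z) \<le> c * \<omega> z"
    and w: "\<And>r. r \<in> {a..t} \<Longrightarrow> integrable (\<mu> r) (\<lambda>z. bracket z * \<omega> z)"
    and wB: "\<And>r. r \<in> {a..t} \<Longrightarrow> (\<integral>z. bracket z * \<omega> z \<partial>\<mu> r) \<le> B"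
  shows "set_integrable lborel {a..t} (\<lambda>r. \<integral>z. b r z \<bullet> \<gamma> z \<partial>\<mu> r)"
    "(\<integral>z. g z \<partial>\<mu> t) - (\<integral>z. g z \<partial>\<mu> a) = (LINT r:{a..t}|lborel. \<integral>z. b r z \<bullet> \<gamma> z \<partial>\<mu> r)"
proof -
  define gk where "gk k z = g z * cutoff (real (Suc k)) z" for k z
  define \<gamma>k where "\<gamma>k k z = cutoff (real (Suc k)) z *\<^sub>R \<gamma> z + g z *\<^sub>R cutoff_grad (real (Suc k)) z" for k z
  define h where "h r = (\<integral>z. b r z \<bullet> \<gamma> z \<partial>\<mu> r)" for r
  define hk where "hk k r = (\<integral>z. b r z \<bullet> \<gamma>k k z \<partial>\<mu> r)" for k r
  have c: "0 \<le> c"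
    using \<gamma>_le[of 0] \<omega>(2)[of 0] norm_ge_zero[of "\<gamma> 0"] by (smt (verit) mult_neg_pos)
  have gk: "C1_gradient (gk k) (\<gamma>k k)" for k
    unfolding gk_def[abs_def] \<gamma>k_def[abs_def] by (rule C1_gradient_mult[OF g C1_gradient_cutoff])
  note meas = C1_gradientD(4,5)[OF g] C1_gradientD(4,5)[OF gk]
  have gk_le: "\<bar>gk k z\<bar> \<le> c * (bracket z * \<omega> z)" for k z
    using g_le[of z] cutoff_bounds[of "real (Suc k)" z]
    by (auto simp: gk_def abs_mult intro: order_trans[OF mult_left_le])
  \<comment> \<open>49 is 1 for the truncated gradient plus 48 for the term in which the growth of g
    meets the decay of the cutoff gradient.\<close>
  have \<gamma>k_le: "norm (\<gamma>k k z) \<le> (49 * c) * \<omega> z" for k z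
  proof -
    have "norm (\<gamma>k k z) \<le> cutoff (real (Suc k)) z * norm (\<gamma> z) + \<bar>g z\<bar> * norm (cutoff_grad (real (Suc k)) z)"
      unfolding \<gamma>k_def by (rule order_trans[OF norm_triangle_ineq]) (simp add: cutoff_bounds)
    also have "\<dots> \<le> 1 * (c * \<omega> z) + (c * (bracket z * \<omega> z)) * norm (cutoff_grad (real (Suc k)) z)"
      using \<gamma>_le[of z] g_le[of z] \<omega>(2)[of z] c cutoff_bounds[of "real (Suc k)" z]
      by (intro add_mono mult_mono) auto
    also have "(c * (bracket z * \<omega> z)) * norm (cutoff_grad (real (Suc k)) z)
        = c * \<omega> z * (bracket z * norm (cutoff_grad (real (Suc k)) z))"
      by simp
    also have "\<dots> \<le> c * \<omega> z * 48"
      using c \<omega>(2)[of z] by (intro mult_left_mono bracket_cutoff_grad) auto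
    finally show ?thesis by simp
  qed
  have in_T: "r \<in> {0..T}" if "r \<in> {a..t}" for r
    using that a by auto
  have weak_k: "set_integrable lborel {a..t} (hk k)"
    "(\<integral>z. gk k z \<partial>\<mu> t) - (\<integral>z. gk k z \<partial>\<mu> a) = (LINT r:{a..t}|lborel. hk k r)" for k
  proof -
    have supp: "gk k z = 0" if "z \<notin> cball 0 (2 * real (Suc k))" for z
      using cutoff_support[OF _ that] by (simp add: gk_def)
    have wk: "set_integrable lborel {0..s} (hk k) \<and>
      (\<integral>z. gk k z \<partial>\<mu> s) - (\<integral>z. gk k z \<partial>\<mu> 0) = (LINT r:{0..s}|lborel. hk k r)" if "s \<in> {0..T}" for s
      unfolding hk_def[abs_def] using weak[OF gk compact_cball[of 0 "2 * real (Suc k)"] supp that] by blast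
    have i: "set_integrable lborel {0..t} (hk k)"
      using wk[of t] a by auto
    note split = set_integral_split[OF i a(1,2)]
    show "set_integrable lborel {a..t} (hk k)"
      by (rule split(1))
    have "(\<integral>z. gk k z \<partial>\<mu> t) - (\<integral>z. gk k z \<partial>\<mu> 0) = (LINT r:{0..t}|lborel. hk k r)"
      "(\<integral>z. gk k z \<partial>\<mu> a) - (\<integral>z. gk k z \<partial>\<mu> 0) = (LINT r:{0..a}|lborel. hk k r)"
      using wk[of t] wk[of a] a by auto
    then show "(\<integral>z. gk k z \<partial>\<mu> t) - (\<integral>z. gk k z \<partial>\<mu> a) = (LINT r:{a..t}|lborel. hk k r)"
      using split(2) by linarith
  qed
  have lim_g: "(\<lambda>k. \<integral>z. gk k z \<partial>\<mu> r) \<longlonglongrightarrow> (\<integral>z. g z \<partial>\<mu> r)" if r: "r \<in> {a..t}" for r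
  proof (rule integral_dominated_convergence[where w = "\<lambda>z. c * (bracket z * \<omega> z)"])
    have "(\<lambda>k. gk k z) \<longlonglongrightarrow> g z * 1" for z
      unfolding gk_def by (intro tendsto_intros cutoff_tendsto)
    then show "AE z in \<mu> r. (\<lambda>k. gk k z) \<longlonglongrightarrow> g z"
      by (intro AE_I2) simp
  qed (use r in_T w gk_le meas in \<open>auto intro: measurable_\<mu>\<close>)
  have lim_h: "(\<lambda>k. hk k r) \<longlonglongrightarrow> h r" if r: "r \<in> {a..t}" for r
    unfolding hk_def h_def
  proof (rule integral_dominated_convergence[where w = "\<lambda>z. C * (49 * c) * (1 + moment r) * (bracket z * \<omega> z)"])
    have "(\<lambda>k. b r z \<bullet> \<gamma>k k z) \<longlonglongrightarrow> b r z \<bullet> (1 *\<^sub>R \<gamma> z + g z *\<^sub>R 0)" for z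
      unfolding \<gamma>k_def by (intro tendsto_intros cutoff_tendsto)
    then show "AE z in \<mu> r. (\<lambda>k. b r z \<bullet> \<gamma>k k z) \<longlonglongrightarrow> b r z \<bullet> \<gamma> z"
      by (intro AE_I2) simp
    show "AE z in \<mu> r. norm (b r z \<bullet> \<gamma>k k z) \<le> C * (49 * c) * (1 + moment r) * (bracket z * \<omega> z)" for k
      using flux_integrable(2)[OF in_T[OF r] meas(4) \<omega>(2) w[OF r] \<gamma>k_le] by (intro AE_I2) simp
  qed (use r in_T w meas b_measurable in \<open>auto intro!: measurable_\<mu>\<close>)
  \<comment> \<open>The majorant in time is constant; this is where the uniform bound
    \<open>B\<close> on the weighted integrals enters.\<close>
  define M where "M = C * (49 * c) * (1 + B) * B"
  have hk_le: "\<bar>hk k r\<bar> \<le> M" if r: "r \<in> {a..t}" for k r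
  proof -
    have "moment r \<le> (\<integral>z. bracket z * \<omega> z \<partial>\<mu> r)"
      unfolding moment_def
    proof (rule integral_mono[OF integrable_bracket[OF in_T[OF r]] w[OF r]])
      show "bracket z \<le> bracket z * \<omega> z" for z
        using mult_left_mono[OF \<omega>(2) bracket_nonneg, of z z] by simp
    qed
    then have "C * (49 * c) * (1 + moment r) * (\<integral>z. bracket z * \<omega> z \<partial>\<mu> r) \<le> M"
      unfolding M_def using wB[OF r] C_nonneg c moment_nonneg[of r]
      by (intro mult_mono mult_left_mono add_left_mono) auto
    then show ?thesis
      using flux_integrable(3)[OF in_T[OF r] meas(4) \<omega>(2) w[OF r] \<gamma>k_le] unfolding hk_def
      by (rule order_trans[rotated])
  qed
  have dom: "integrable lborel (\<lambda>r. indicator {a..t} r *\<^sub>R M)"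
    by (intro integrable_scaleR_left integrable_real_indicator) (auto simp: emeasure_lborel_Icc_eq)
  have m_k: "(\<lambda>r. indicator {a..t} r *\<^sub>R hk k r) \<in> borel_measurable lborel" for k
    using weak_k(1)[of k] unfolding set_integrable_def by (rule borel_measurable_integrable)
  have lim_ind: "(\<lambda>k. indicator {a..t} r *\<^sub>R hk k r) \<longlonglongrightarrow> indicator {a..t} r *\<^sub>R h r" for r
    using lim_h[of r] by (cases "r \<in> {a..t}") auto
  \<comment> \<open>Measurability in time of the limit flux is not given; it is inherited from the
    truncated fluxes, for which the weak formulation provides it.\<close>
  have m: "(\<lambda>r. indicator {a..t} r *\<^sub>R h r) \<in> borel_measurable lborel"
    by (rule borel_measurable_LIMSEQ_real[OF lim_ind m_k])
  have bd: "AE r in lborel. norm (indicator {a..t} r *\<^sub>R hk k r) \<le> indicator {a..t} r *\<^sub>R M" for k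
    by (rule AE_I2) (auto simp: indicator_def hk_le)
  have "set_integrable lborel {a..t} h"
    unfolding set_integrable_def
    by (rule integrable_dominated_convergence[OF m m_k dom AE_I2[OF lim_ind] bd])
  then show "set_integrable lborel {a..t} (\<lambda>r. \<integral>z. b r z \<bullet> \<gamma> z \<partial>\<mu> r)"
    by (simp add: h_def[abs_def])
  have "(\<lambda>k. LINT r:{a..t}|lborel. hk k r) \<longlonglongrightarrow> (LINT r:{a..t}|lborel. h r)"
    unfolding set_lebesgue_integral_def
    by (rule integral_dominated_convergence[OF m m_k dom AE_I2[OF lim_ind] bd])
  moreover have "(\<lambda>k. (\<integral>z. gk k z \<partial>\<mu> t) - (\<integral>z. gk k z \<partial>\<mu> a)) \<longlonglongrightarrow> (\<integral>z. g z \<partial>\<mu> t) - (\<integral>z. g z \<partial>\<mu> a)"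
    using a by (intro tendsto_diff lim_g) auto
  ultimately have "(\<integral>z. g z \<partial>\<mu> t) - (\<integral>z. g z \<partial>\<mu> a) = (LINT r:{a..t}|lborel. h r)"
    unfolding weak_k(2) by (rule LIMSEQ_unique[rotated])
  then show "(\<integral>z. g z \<partial>\<mu> t) - (\<integral>z. g z \<partial>\<mu> a) = (LINT r:{a..t}|lborel. \<integral>z. b r z \<bullet> \<gamma> z \<partial>\<mu> r)"
    by (simp add: h_def[abs_def])
qed

section \<open>Propagation of moments\<close>

lemma norm_gradient_bracket: "norm (inverse (bracket z) *\<^sub>R z) \<le> 1"
  using norm_le_bracket[of z] bracket_pos[of z] by (simp add: divide_simps flip: divide_inverse_commute)

text \<open>The bracket can be tested with only where its own integral is bounded, hence the
  conditional form: a bound \<open>B\<close> on the interval yields a Lipschitz constant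
  proportional to \<open>B\<close>.\<close>

lemma moment_diff_le:
  assumes "0 \<le> s" "s \<le> t" "t \<le> T" and le: "\<And>r. r \<in> {s..t} \<Longrightarrow> moment r \<le> B"
  shows "\<bar>moment t - moment s\<bar> \<le> C * (1 + C) * B * (t - s)"
proof -
  have in_T: "r \<in> {0..T}" if "r \<in> {s..t}" for r
    using that assms by auto
  have 1: "integrable (\<mu> r) (\<lambda>z. bracket z * 1)" "(\<integral>z. bracket z * 1 \<partial>\<mu> r) \<le> B" if "r \<in> {s..t}" for r
    using integrable_bracket[OF in_T[OF that]] le[OF that] by (simp_all add: moment_def)
  note w = weak_extended[OF assms(1-3) C1_gradient_bracket, of "\<lambda>z. 1" 1, OF _ _ _ _ 1]
  have i: "set_integrable lborel {s..t} (\<lambda>r. \<integral>z. b r z \<bullet> (inverse (bracket z) *\<^sub>R z) \<partial>\<mu> r)"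
    by (rule w(1)) (auto simp: norm_gradient_bracket[simplified] bracket_pos less_imp_le)
  have e: "moment t - moment s = (LINT r:{s..t}|lborel. \<integral>z. b r z \<bullet> (inverse (bracket z) *\<^sub>R z) \<partial>\<mu> r)"
    unfolding moment_def
    by (rule w(2)) (auto simp: norm_gradient_bracket[simplified] bracket_pos less_imp_le)
  show ?thesis
    unfolding e
  proof (rule set_integral_abs_le_const[OF i assms(2)])
    fix r assume r: "r \<in> {s..t}"
    have "\<bar>\<integral>z. b r z \<bullet> (inverse (bracket z) *\<^sub>R z) \<partial>\<mu> r\<bar> \<le> C * (1 + C) * moment r"
      by (rule flux_le_moment[OF in_T[OF r] C1_gradientD(5)[OF C1_gradient_bracket] norm_gradient_bracket])
    also have "\<dots> \<le> C * (1 + C) * B"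
      using le[OF r] C_nonneg by (intro mult_left_mono) auto
    finally show "\<bar>\<integral>z. b r z \<bullet> (inverse (bracket z) *\<^sub>R z) \<partial>\<mu> r\<bar> \<le> C * (1 + C) * B" .
  qed
qed

text \<open>On a short interval the supremum S exceeds \<open>moment s\<close> by at most S/2, and
  S/2 is absorbed. Absorption needs S finite, which is all that \<open>bdd\<close> is for: the
  factor 2 does not depend on N. The order of s and t is arbitrary, so the comparison also runs
  backwards in time.\<close>

lemma moment_short_time:
  assumes "0 \<le> a" "e \<le> T" and short: "2 * (C * (1 + C)) * (e - a) \<le> 1"
    and bdd: "\<exists>N. \<forall>r\<in>{a..e}. moment r \<le> N" and st: "s \<in> {a..e}" "t \<in> {a..e}"
  shows "moment t \<le> 2 * moment s"
proof -
  define S where "S = Sup (moment ` {a..e})"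
  have bdd': "bdd_above (moment ` {a..e})"
    using bdd by (auto simp: bdd_above_def)
  have le_S: "moment r \<le> S" if "r \<in> {a..e}" for r
    unfolding S_def using bdd' that by (intro cSup_upper) auto
  have S: "0 \<le> S"
    using le_S[OF st(1)] moment_nonneg[of s] by linarith
  have "moment r \<le> moment s + S / 2" if r: "r \<in> {a..e}" for r
  proof -
    have "moment r - moment s \<le> C * (1 + C) * S * \<bar>r - s\<bar>"
      using moment_diff_le[of s r S] moment_diff_le[of r s S] r st assms(1,2) le_S
      by (cases "s \<le> r") auto
    also have "\<dots> \<le> C * (1 + C) * S * (e - a)"
      using r st S C_nonneg by (intro mult_left_mono) auto
    also have "\<dots> = (2 * (C * (1 + C)) * (e - a)) * (S / 2)"
      by simp
    also have "\<dots> \<le> 1 * (S / 2)"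
      using S by (intro mult_right_mono short) auto
    finally show ?thesis by simp
  qed
  then have "Sup (moment ` {a..e}) \<le> moment s + S / 2"
    using st by (intro cSup_least) auto
  then have "S \<le> moment s + S / 2"
    by (simp add: S_def)
  then show ?thesis
    using le_S[OF st(2)] by linarith
qed

text \<open>This is lower semicontinuity in time: the moment is the supremum of truncated moments,
  each of which is continuous by weak continuity.\<close>

lemma closed_moment_le: "closed {t \<in> {0..T}. moment t \<le> N}"
proof -
  define m where "m k t = (\<integral>z. bracket z * cutoff (real (Suc k)) z \<partial>\<mu> t)" for k t
  have cont: "continuous_on {0..T} (m k)" for k
    unfolding m_def[abs_def]
  proof (rule weakly_continuous)
    show "continuous_on UNIV (\<lambda>z. bracket z * cutoff (real (Suc k)) (z::'a))"
      by (intro continuous_intros C1_gradientD(3)[OF C1_gradient_bracket] C1_gradientD(3)[OF C1_gradient_cutoff])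
    show "compact (cball (0::'a) (2 * real (Suc k)))"
      by simp
    show "bracket z * cutoff (real (Suc k)) z = 0" if "z \<notin> cball 0 (2 * real (Suc k))" for z :: 'a
      using cutoff_support[OF _ that] by simp
  qed
  have iff: "moment t \<le> N \<longleftrightarrow> (\<forall>k. m k t \<le> N)" if t: "t \<in> {0..T}" for t
  proof
    have i: "integrable (\<mu> t) (\<lambda>z. bracket z * cutoff (real (Suc k)) z)" for k
      by (rule integrable_bound[OF t integrable_bracket[OF t]])
        (auto simp: abs_mult cutoff_bounds mult_left_le simp del: of_nat_Suc)
    {
      assume "moment t \<le> N"
      moreover have "m k t \<le> moment t" for k
        unfolding m_def moment_def
        by (rule integral_mono[OF i integrable_bracket[OF t]])
          (auto simp: cutoff_bounds bracket_pos less_imp_le mult_left_le)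
      ultimately show "\<forall>k. m k t \<le> N"
        by (meson order_trans)
    }
    assume le: "\<forall>k. m k t \<le> N"
    have lim: "(\<lambda>k. bracket z * cutoff (real (Suc k)) z) \<longlonglongrightarrow> bracket z" for z :: 'a
      using tendsto_mult[OF tendsto_const cutoff_tendsto(1)[of z], of "bracket z"] by simp
    show "moment t \<le> N"
      unfolding moment_def
      by (rule integral_Fatou(2)[OF i _ lim])
        (use le in \<open>auto simp: m_def cutoff_bounds bracket_pos less_imp_le simp del: of_nat_Suc\<close>)
  qed
  have "{t \<in> {0..T}. moment t \<le> N} = (\<Inter>k. {t \<in> {0..T}. m k t \<le> N})"
    using iff by auto
  also have "closed \<dots>"
    by (intro closed_INT ballI continuous_on_closed_Collect_le cont continuous_on_const closed_atLeastAtMost)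
  finally show ?thesis .
qed

text \<open>
  A finite lower semicontinuous function is locally bounded on a dense open set of times. On a gap
  of the exceptional closed set the moment is controlled by its value at the left endpoint of the
  gap, and by Baire's theorem these values are bounded on some portion of the exceptional set,
  which is therefore empty.
\<close>

lemma moment_bounded: "\<exists>B. \<forall>t\<in>{0..T}. moment t \<le> B"
proof -
  define \<U> where "\<U> = {U. open U \<and> (\<exists>N. \<forall>r\<in>U \<inter> {0..T}. moment r \<le> N)}"
  have compact_bdd: "\<exists>N. \<forall>r\<in>{x..y}. moment r \<le> N" if xy: "{x..y} \<subseteq> {0..T}" "{x..y} \<subseteq> \<Union>\<U>" for x y
  proof -
    obtain \<V> where \<V>: "\<V> \<subseteq> \<U>" "finite \<V>" "{x..y} \<subseteq> \<Union>\<V>"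
      using compactE[OF compact_Icc xy(2)] unfolding \<U>_def by auto
    then have "\<forall>U\<in>\<V>. \<exists>N. \<forall>r\<in>U \<inter> {0..T}. moment r \<le> N"
      by (auto simp: \<U>_def)
    then obtain N where N: "\<And>U r. U \<in> \<V> \<Longrightarrow> r \<in> U \<inter> {0..T} \<Longrightarrow> moment r \<le> N U"
      by metis
    have "moment r \<le> (\<Sum>U\<in>\<V>. \<bar>N U\<bar>)" if r: "r \<in> {x..y}" for r
    proof -
      obtain U where U: "U \<in> \<V>" "r \<in> U" using r \<V>(3) by blast
      then have "moment r \<le> \<bar>N U\<bar>" using N[of U r] r xy(1) by fastforce
      also have "\<dots> \<le> (\<Sum>U\<in>\<V>. \<bar>N U\<bar>)"
        by (rule member_le_sum) (use U \<V> in auto)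
      finally show ?thesis .
    qed
    then show ?thesis by blast
  qed
  define P where "P = {0..T} - \<Union>\<U>"
  have "open (\<Union>\<U>)"
    by (auto simp: \<U>_def)
  then have closed_P: "closed P"
    unfolding P_def by (intro closed_Diff closed_atLeastAtMost)
  have "P = {}"
  proof (rule ccontr)
    assume ne: "P \<noteq> {}"
    \<comment> \<open>Relatively open subsets of \<open>P\<close> with empty intersection, because
      each single moment is finite. By Baire some \<open>G n\<close> is not dense in
      \<open>P\<close>, so near some p in \<open>P\<close> the moment is at most n along
      \<open>P\<close>.\<close>
    define G where "G n = P - {t \<in> {0..T}. moment t \<le> real n}" for n
    have "\<Inter>(range G) = {}"
    proof -
      have "t \<notin> \<Inter>(range G)" for t
      proof -
        obtain n where "moment t \<le> real n" using real_arch_simple by blast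
        then have "t \<notin> G n" by (auto simp: G_def P_def)
        then show ?thesis by blast
      qed
      then show ?thesis by blast
    qed
    then have "\<not> P \<subseteq> closure (\<Inter>(range G))"
      using ne by simp
    moreover have "openin (top_of_set P) (G n)" for n
    proof -
      have "G n = P \<inter> - {t \<in> {0..T}. moment t \<le> real n}"
        by (auto simp: G_def)
      then show ?thesis
        using closed_moment_le by (simp add: openin_open_Int open_Compl)
    qed
    ultimately obtain n where "\<not> P \<subseteq> closure (G n)"
      using Baire[OF closed_P, of "range G"] by fastforce
    then obtain p where p: "p \<in> P" "p \<notin> closure (G n)" by blast
    then obtain \<epsilon> where \<epsilon>: "\<epsilon> > 0" "\<And>y. y \<in> G n \<Longrightarrow> \<epsilon> \<le> dist y p"
      unfolding closure_approachable by (auto simp: not_less)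
    have p_T: "0 \<le> p" "p \<le> T" using p(1) by (auto simp: P_def)
    \<comment> \<open>The first bound keeps the neighbourhood of p away from \<open>G n\<close>, the
      second makes intervals of length 2 \<delta> short in the sense of
      \<open>moment_short_time\<close>; the summand 1 covers C = 0.\<close>
    define \<delta> where "\<delta> = min (\<epsilon> / 2) (1 / (4 * (C * (1 + C)) + 1))"
    have CC: "0 \<le> C * (1 + C)" using C_nonneg by simp
    have \<delta>: "0 < \<delta>" "\<delta> < \<epsilon>"
      using \<epsilon>(1) CC by (auto simp: \<delta>_def min_less_iff_disj add_nonneg_pos)
    have short: "2 * (C * (1 + C)) * (2 * \<delta>) \<le> 1"
    proof -
      have "4 * (C * (1 + C)) * \<delta> \<le> 4 * (C * (1 + C)) * (1 / (4 * (C * (1 + C)) + 1))"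
        using CC by (intro mult_left_mono) (auto simp: \<delta>_def)
      also have "\<dots> \<le> 1" using CC by (simp add: divide_le_eq)
      finally show ?thesis by (simp add: algebra_simps)
    qed
    \<comment> \<open>The left end \<open>a0\<close> may lie outside \<open>P\<close>, so its moment
      is included in the bound; a gap that begins before the neighbourhood is then treated as if it
      began at \<open>a0\<close>.\<close>
    define a0 where "a0 = max 0 (p - \<delta>)"
    define N where "N = max (real n) (moment a0)"
    have P_le: "moment r \<le> N" if "r \<in> P" "r \<in> {a0..p + \<delta>}" for r
    proof (rule ccontr)
      assume "\<not> moment r \<le> N"
      then have "r \<in> G n" using that by (auto simp: G_def N_def)
      from \<epsilon>(2)[OF this] show False using that \<delta> by (auto simp: dist_real_def a0_def)
    qed
    have near: "moment t \<le> 2 * N" if t: "t \<in> {a0..p + \<delta>}" "t \<le> T" for t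
    proof -
      define A where "A = (P \<inter> {a0..t}) \<union> {a0}"
      have A: "closed A" "A \<noteq> {}" "bdd_above A"
        unfolding A_def using closed_P t(1) by (auto intro!: closed_Un closed_Int closed_insert simp: bdd_above_def)
      define a where "a = Sup A"
      have aA: "a \<in> A" unfolding a_def by (rule closed_contains_Sup[OF A(2,3,1)])
      have a: "a0 \<le> a" "a \<le> t" using aA t(1) by (auto simp: A_def)
      have N0: "0 \<le> N" by (simp add: N_def)
      have ma: "moment a \<le> N"
        using aA P_le[of a] t(1) by (auto simp: A_def N_def)
      show ?thesis
      proof (cases "a = t")
        case True
        then show ?thesis using ma N0 by simp
      next
        case False
        have a0: "0 \<le> a0" by (simp add: a0_def)
        have len: "2 * (C * (1 + C)) * (t - x) \<le> 1" if "a \<le> x" for x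
        proof -
          have "2 * (C * (1 + C)) * (t - x) \<le> 2 * (C * (1 + C)) * (2 * \<delta>)"
            using CC t(1) a that by (intro mult_left_mono) (auto simp: a0_def)
          then show ?thesis using short by linarith
        qed
        \<comment> \<open>Compactness bounds the moment on each {r..t} with a < r, but not uniformly
          as r tends to a. Comparing backwards from t gives the uniform bound 2
          \<open>moment t\<close>. Together with the finite value at a this bounds {a..t}, and only
          then is the forward comparison from a allowed.\<close>
        have bwd: "moment r \<le> 2 * moment t" if r: "a < r" "r \<le> t" for r
        proof (rule moment_short_time[of r t])
          have "x \<notin> P" if "x \<in> {r..t}" for x
          proof
            assume "x \<in> P"
            then have "x \<in> A" using that r a by (auto simp: A_def)
            from cSup_upper[OF this A(3)] show False using that r by (simp add: a_def)
          qed
          then show "\<exists>N. \<forall>x\<in>{r..t}. moment x \<le> N"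
            using r a a0 t(2) by (intro compact_bdd) (auto simp: P_def)
          show "2 * (C * (1 + C)) * (t - r) \<le> 1"
            using r by (intro len) simp
        qed (use r a a0 t(2) in auto)
        have "moment t \<le> 2 * moment a"
        proof (rule moment_short_time[of a t])
          show "\<exists>N. \<forall>x\<in>{a..t}. moment x \<le> N"
          proof (intro exI ballI)
            fix x assume "x \<in> {a..t}"
            then show "moment x \<le> max (moment a) (2 * moment t)"
              using bwd[of x] by (cases "x = a") (auto simp: le_max_iff_disj)
          qed
          show "2 * (C * (1 + C)) * (t - a) \<le> 1"
            by (intro len) simp
        qed (use a a0 t(2) in auto)
        then show ?thesis using ma by simp
      qed
    qed
    have "ball p \<delta> \<in> \<U>"
    proof -
      have "moment r \<le> 2 * N" if "r \<in> ball p \<delta> \<inter> {0..T}" for r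
        using that by (intro near) (auto simp: dist_real_def a0_def)
      then show ?thesis unfolding \<U>_def using open_ball by blast
    qed
    then have "p \<in> \<Union>\<U>" using \<delta>(1) by (meson UnionI centre_in_ball)
    then show False using p(1) by (simp add: P_def)
  qed
  then show ?thesis using compact_bdd[of 0 T] by (auto simp: P_def)
qed

text \<open>The uniform moment bound makes the constant 1 an admissible test function, and its
  gradient vanishes.\<close>

lemma mass_conserved:
  assumes t: "t \<in> {0..T}" shows "measure (\<mu> t) UNIV = measure (\<mu> 0) UNIV"
proof -
  obtain B where B: "\<And>t. t \<in> {0..T} \<Longrightarrow> moment t \<le> B" using moment_bounded by blast
  have "(\<integral>z. 1 \<partial>\<mu> t) - (\<integral>z. 1 \<partial>\<mu> 0) = (LINT r:{0..t}|lborel. \<integral>z. b r z \<bullet> 0 \<partial>\<mu> r)"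
    by (rule weak_extended(2)[OF _ _ _ C1_gradient_const, of 0 t "\<lambda>z. 1" _ 1 B])
      (use t B integrable_bracket bracket_ge_1 in \<open>auto simp: moment_def\<close>)
  then show ?thesis
    using t T_nonneg by (simp add: space_\<mu> set_lebesgue_integral_def)
qed

text \<open>The regularised weights have bounded gradient and \<open>bracket z * norm (\<nabla>g z) \<le> 2 * g z\<close>, so
  the growth rate of their integrals does not depend on the regularisation parameter \<open>R\<close>.\<close>

lemma second_moment_bounded:
  assumes i0: "integrable (\<mu> 0) (\<lambda>z. bracket z * bracket z)"
  shows "\<exists>B. \<forall>t\<in>{0..T}. integrable (\<mu> t) (\<lambda>z. bracket z * bracket z) \<and> (\<integral>z. bracket z * bracket z \<partial>\<mu> t) \<le> B"
proof -
  obtain B where B: "\<And>t. t \<in> {0..T} \<Longrightarrow> moment t \<le> B" using moment_bounded by blast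
  have B0: "0 \<le> B" using B[of 0] moment_nonneg[of 0] T_nonneg by simp
  define E where "E = 2 * C * (1 + B)"
  have E0: "0 \<le> E" using C_nonneg B0 by (simp add: E_def)
  \<comment> \<open>R \<sigma> / (R + \<sigma>) with \<sigma> the squared bracket is bounded by R,
    tends to \<sigma> as R grows, and has derivative (R / (R + \<sigma>))^2 in \<sigma>, which gives
    the logarithmic-type gradient bound.\<close>
  define g where "g R z = R * (1 + z \<bullet> z) / (R + (1 + z \<bullet> z))" for R and z :: 'a
  define \<gamma> where "\<gamma> R z = (R / (R + (1 + z \<bullet> z)))\<^sup>2 *\<^sub>R (0 + 2 *\<^sub>R z)" for R and z :: 'a
  have pos: "0 < R + (1 + z \<bullet> z)" if "0 < R" for R and z :: 'a
    using that by (simp add: add_pos_nonneg)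
  have grad: "C1_gradient (g R) (\<gamma> R)" if R: "0 < R" for R
    unfolding g_def[abs_def] \<gamma>_def[abs_def]
  proof (rule C1_gradient_compose[OF C1_gradient_add[OF C1_gradient_const C1_gradient_inner_self],
        where f = "\<lambda>\<sigma>. R * \<sigma> / (R + \<sigma>)" and f' = "\<lambda>\<sigma>. (R / (R + \<sigma>))\<^sup>2"])
    fix z :: 'a
    show "((\<lambda>\<sigma>. R * \<sigma> / (R + \<sigma>)) has_real_derivative (R / (R + (1 + z \<bullet> z)))\<^sup>2) (at (1 + z \<bullet> z))"
      using pos[OF R, of z] by (auto intro!: derivative_eq_intros simp: power2_eq_square field_simps)
    show "continuous_on (range (\<lambda>z::'a. 1 + z \<bullet> z)) (\<lambda>\<sigma>. (R / (R + \<sigma>))\<^sup>2)"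
      using pos[OF R] by (intro continuous_intros) (auto simp: less_imp_neq[symmetric])
  qed
  have g_bounds: "0 \<le> g R z" "g R z \<le> R" if "0 < R" for R and z :: 'a
    using that pos[OF that, of z] by (auto simp: g_def divide_simps algebra_simps)
  have g_le: "g R z \<le> bracket z * bracket z" if "0 < R" for R and z :: 'a
  proof -
    have "g R z = R / (R + (1 + z \<bullet> z)) * (1 + z \<bullet> z)" by (simp add: g_def)
    also have "\<dots> \<le> 1 * (1 + z \<bullet> z)"
      using that pos[OF that, of z] by (intro mult_right_mono) (auto simp: divide_simps)
    finally show ?thesis by (simp flip: power2_eq_square add: bracket_sq)
  qed
  have bracket_\<gamma>: "bracket z * norm (\<gamma> R z) \<le> 2 * g R z" if R: "0 < R" for R and z :: 'a
  proof -
    define q where "q = R / (R + (1 + z \<bullet> z))"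
    have q: "0 \<le> q" "q \<le> 1" using R pos[OF R, of z] by (auto simp: q_def divide_simps)
    have "bracket z * norm (\<gamma> R z) = 2 * (q\<^sup>2 * (bracket z * norm z))"
      by (simp add: \<gamma>_def q_def)
    also have "\<dots> \<le> 2 * (q * (bracket z * bracket z))"
      using q norm_le_bracket[of z] mult_left_mono[OF q(2,1)]
      by (intro mult_left_mono mult_mono) (auto simp: power2_eq_square)
    also have "\<dots> = 2 * g R z"
      by (simp add: g_def q_def bracket_sq flip: power2_eq_square)
    finally show ?thesis .
  qed
  have \<gamma>_le: "norm (\<gamma> R z) \<le> 2 * R" if R: "0 < R" for R and z :: 'a
  proof -
    have "norm (\<gamma> R z) \<le> bracket z * norm (\<gamma> R z)"
      using mult_right_mono[OF bracket_ge_1 norm_ge_zero, of "\<gamma> R z" z] by simp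
    then show ?thesis using bracket_\<gamma>[OF R, of z] g_bounds[OF R, of z] by linarith
  qed
  define K where "K = exp (E * T) * (\<integral>z. bracket z * bracket z \<partial>\<mu> 0)"
  have bound: "(\<integral>z. g R z \<partial>\<mu> t) \<le> K" and integ: "integrable (\<mu> t) (g R)"
    if R: "0 < R" and t: "t \<in> {0..T}" for R t
  proof -
    define F where "F t = (\<integral>z. g R z \<partial>\<mu> t)" for t
    have int_g: "integrable (\<mu> r) (g R)" if "r \<in> {0..T}" for r
      by (rule integrable_bound[OF that integrable_const[OF that, of R] C1_gradientD(4)[OF grad[OF R]]])
        (use g_bounds[OF R] in auto)
    then show "integrable (\<mu> t) (g R)" using t .
    have F_nonneg: "0 \<le> F r" for r
      unfolding F_def by (rule Bochner_Integration.integral_nonneg) (rule g_bounds[OF R])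
    have F_le: "F r \<le> C * R" if r: "r \<in> {0..T}" for r
    proof -
      have "F r \<le> (\<integral>z. R \<partial>\<mu> r)"
        unfolding F_def using g_bounds[OF R] by (intro integral_mono int_g integrable_const r)
      also have "\<dots> \<le> C * R"
        unfolding integral_const[OF r] using R by (intro mult_right_mono mass_le r) auto
      finally show ?thesis .
    qed
    have flux: "\<bar>\<integral>z. b r z \<bullet> \<gamma> R z \<partial>\<mu> r\<bar> \<le> E * F r" if r: "r \<in> {0..T}" for r
    proof -
      have bd: "\<bar>b r z \<bullet> \<gamma> R z\<bar> \<le> E * g R z" for z
      proof -
        have "\<bar>b r z \<bullet> \<gamma> R z\<bar> \<le> norm (b r z) * norm (\<gamma> R z)"
          by (rule Cauchy_Schwarz_ineq2)
        also have "\<dots> \<le> (C * (bracket z + moment r)) * norm (\<gamma> R z)"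
          using b_bound[OF r, of z] by (intro mult_right_mono) (auto simp: moment_def)
        also have "\<dots> \<le> (C * (bracket z + bracket z * B)) * norm (\<gamma> R z)"
          using C_nonneg B0 B[OF r] mult_right_mono[OF bracket_ge_1 B0, of z]
          by (intro mult_right_mono mult_left_mono add_left_mono) auto
        also have "\<dots> = C * (1 + B) * (bracket z * norm (\<gamma> R z))"
          by (simp add: algebra_simps)
        also have "\<dots> \<le> C * (1 + B) * (2 * g R z)"
          using C_nonneg B0 by (intro mult_left_mono bracket_\<gamma>[OF R]) auto
        finally show ?thesis by (simp add: E_def)
      qed
      have "(\<lambda>z. b r z \<bullet> \<gamma> R z) \<in> borel_measurable borel"
        using b_measurable[OF r] C1_gradientD(5)[OF grad[OF R]] by measurable
      from integral_abs_le[OF r integrable_mult_right[OF int_g[OF r]] this bd]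
      show ?thesis by (simp add: F_def)
    qed
    \<comment> \<open>\<open>D\<close> is left open since the estimate is used twice: with a crude
      constant to obtain Lipschitz continuity, then with the sharper one that this continuity
      provides.\<close>
    have diff: "F t \<le> F s + D * (t - s)" if st: "0 \<le> s" "s \<le> t" "t \<le> T"
      and D: "\<And>r. r \<in> {s..t} \<Longrightarrow> E * F r \<le> D" for s t D
    proof -
      have 1: "integrable (\<mu> r) (\<lambda>z. bracket z * 1)" "(\<integral>z. bracket z * 1 \<partial>\<mu> r) \<le> B" if "r \<in> {s..t}" for r
        using integrable_bracket[of r] B[of r] that st by (simp_all add: moment_def)
      have gR: "\<bar>g R z\<bar> \<le> 2 * R * (bracket z * 1)" for z
      proof -
        have "2 * R * 1 \<le> 2 * R * bracket z"
          using R by (intro mult_left_mono bracket_ge_1) auto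
        then show ?thesis
          using g_bounds[OF R, of z] R by linarith
      qed
      note w = weak_extended[OF st grad[OF R] borel_measurable_const order.refl gR _ 1]
      have i: "set_integrable lborel {s..t} (\<lambda>r. \<integral>z. b r z \<bullet> \<gamma> R z \<partial>\<mu> r)"
        by (rule w(1)) (simp_all add: \<gamma>_le[OF R])
      have "F t - F s = (LINT r:{s..t}|lborel. \<integral>z. b r z \<bullet> \<gamma> R z \<partial>\<mu> r)"
        unfolding F_def by (rule w(2)) (simp_all add: \<gamma>_le[OF R])
      also have "\<dots> \<le> D * (t - s)"
      proof (rule set_integral_le_const[OF i st(2)])
        fix r assume r: "r \<in> {s..t}"
        then have "r \<in> {0..T}" using st by auto
        then show "(\<integral>z. b r z \<bullet> \<gamma> R z \<partial>\<mu> r) \<le> D"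
          using flux[of r] D[OF r] by linarith
      qed
      finally show ?thesis by linarith
    qed
    \<comment> \<open>This constant depends on R, but it enters only the error of order (t - s)^2
      and so disappears in \<open>gronwall_approx\<close>; the rate \<open>E\<close> is free of
      R.\<close>
    define L where "L = E * (C * R)"
    have L0: "0 \<le> L" using E0 C_nonneg R by (simp add: L_def)
    have lip: "F t \<le> F s + L * (t - s)" if st: "0 \<le> s" "s \<le> t" "t \<le> T" for s t
      by (rule diff[OF st]) (use st F_le E0 in \<open>auto simp: L_def intro!: mult_left_mono\<close>)
    have step: "F t \<le> F s + E * (t - s) * F s + E * L * (t - s)\<^sup>2" if st: "0 \<le> s" "s \<le> t" "t \<le> T" for s t
    proof -
      have "F t \<le> F s + E * (F s + L * (t - s)) * (t - s)"
      proof (rule diff[OF st])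
        fix r assume r: "r \<in> {s..t}"
        have "F r \<le> F s + L * (r - s)"
          using r st by (intro lip) auto
        also have "\<dots> \<le> F s + L * (t - s)"
          using r L0 by (intro add_left_mono mult_left_mono) auto
        finally show "E * F r \<le> E * (F s + L * (t - s))"
          using E0 by (rule mult_left_mono)
      qed
      then show ?thesis by (simp add: algebra_simps power2_eq_square)
    qed
    have "F t \<le> exp (E * t) * F 0"
      by (rule gronwall_approx[of t F "E * L"]) (use t E0 L0 F_nonneg step in auto)
    also have "\<dots> \<le> exp (E * T) * F 0"
      using t E0 by (intro mult_right_mono F_nonneg) (auto intro!: mult_left_mono)
    also have "\<dots> \<le> K"
      unfolding K_def F_def using T_nonneg
      by (intro mult_left_mono integral_mono int_g i0 g_le R) auto
    finally show "(\<integral>z. g R z \<partial>\<mu> t) \<le> K" by (simp add: F_def)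
  qed
  have "integrable (\<mu> t) (\<lambda>z. bracket z * bracket z) \<and> (\<integral>z. bracket z * bracket z \<partial>\<mu> t) \<le> K"
    if t: "t \<in> {0..T}" for t
  proof -
    have lim: "(\<lambda>k. g (real (Suc k)) z) \<longlonglongrightarrow> bracket z * bracket z" for z
    proof -
      have "(\<lambda>k. \<sigma> / (\<sigma> * inverse (real (Suc k)) + 1)) \<longlonglongrightarrow> \<sigma> / (\<sigma> * 0 + 1)" for \<sigma> :: real
        by (intro tendsto_intros LIMSEQ_inverse_real_of_nat) simp
      moreover have "g (real (Suc k)) z = (1 + z \<bullet> z) / ((1 + z \<bullet> z) * inverse (real (Suc k)) + 1)" for k
        using pos[of "real (Suc k)" z] by (simp add: g_def field_simps del: of_nat_Suc)
      ultimately show ?thesis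
        by (simp add: bracket_sq flip: power2_eq_square del: of_nat_Suc)
    qed
    have "0 < real (Suc k)" for k by simp
    note F = integral_Fatou[OF integ[OF this t] g_bounds(1)[OF this] lim bound[OF this t]]
    show ?thesis using F by blast
  qed
  then show ?thesis by blast
qed

end

section \<open>Interaction energies\<close>

lemma C1_gradient_segment_bound:
  assumes g: "C1_gradient g \<gamma>" and le: "\<And>\<xi>. \<xi> \<in> closed_segment x y \<Longrightarrow> norm (\<gamma> \<xi>) \<le> M"
  shows "\<bar>g y - g x\<bar> \<le> M * norm (y - x)"
proof -
  have "norm (g y - g x) \<le> M * norm (y - x)"
  proof (rule differentiable_bound[OF convex_closed_segment])
    fix \<xi> assume "\<xi> \<in> closed_segment x y"
    show "(g has_derivative (\<lambda>h. \<gamma> \<xi> \<bullet> h)) (at \<xi> within closed_segment x y)"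
      by (rule C1_gradientD(1)[OF g])
    have "onorm (\<lambda>h. \<gamma> \<xi> \<bullet> h) \<le> norm (\<gamma> \<xi>)"
      by (rule onorm_le) (simp add: Cauchy_Schwarz_ineq2)
    then show "onorm (\<lambda>h. \<gamma> \<xi> \<bullet> h) \<le> M"
      using le[OF \<open>\<xi> \<in> closed_segment x y\<close>] by linarith
  qed auto
  then show ?thesis by simp
qed

text \<open>A quadratic remainder bound survives integration, so potentials are differentiated
  through it instead of under the integral sign. It also treats radial functions at the
  origin.\<close>

lemma has_derivative_quadratic_remainder:
  fixes f :: "'a::real_normed_vector \<Rightarrow> 'b::real_normed_vector"
  assumes f': "bounded_linear f'"
    and le: "\<And>h. norm h \<le> 1 \<Longrightarrow> norm (f (z + h) - f z - f' h) \<le> K * (norm h)\<^sup>2"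
  shows "(f has_derivative f') (at z)"
proof (rule has_derivativeI_sandwich[of 1, OF _ f'])
  show "((\<lambda>y. K * norm (y - z)) \<longlongrightarrow> 0) (at z)"
    by (auto intro!: tendsto_eq_intros)
  fix y assume y: "y \<noteq> z" "dist y z < 1"
  have "norm (f y - f z - f' (y - z)) \<le> K * (norm (y - z))\<^sup>2"
    using le[of "y - z"] y(2) by (simp add: dist_norm)
  then show "norm (f y - f z - f' (y - z)) / norm (y - z) \<le> K * norm (y - z)"
    using y(1) by (simp add: divide_le_eq power2_eq_square mult.assoc)
qed simp

text \<open>A product in place of the natural sum: the majorant of a pair kernel then factorises
  under double integrals.\<close>

lemma norm_diff_le_bracket: "norm (x - y) \<le> 2 * (bracket x * bracket y)"
proof -
  have "norm (x - y) \<le> bracket x * 1 + 1 * bracket y"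
    using norm_triangle_ineq4[of x y] norm_le_bracket[of x] norm_le_bracket[of y] by simp
  also have "\<dots> \<le> bracket x * bracket y + bracket x * bracket y"
    by (intro add_mono mult_mono bracket_ge_1) auto
  finally show ?thesis by simp
qed

lemma one_le_bracket_mult: "1 \<le> bracket x * bracket y"
  using mult_mono[OF bracket_ge_1[of x] bracket_ge_1[of y]] by simp

text \<open>Second derivatives of \<open>G\<close> appear only after pairing \<open>A\<close> with a
  fixed w: scalar gradients suffice, and w \<bullet> A, reflected and shifted, is itself a test
  function. They may grow linearly because the derivative of \<phi>(|y|) y is of size L |y| when
  \<phi>' is merely bounded by L.\<close>

locale interaction_energy =
  fixes G :: "'a::euclidean_space \<Rightarrow> real" and A :: "'a \<Rightarrow> 'a" and c :: real
  assumes grad_G: "C1_gradient G A" and G_even: "G (- z) = G z"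
    and G_le: "\<bar>G z\<bar> \<le> c * (norm z)\<^sup>2" and A_le: "norm (A z) \<le> c * norm z" and c_nonneg: "0 \<le> c"
    and grad_A: "\<exists>D. C1_gradient (\<lambda>z. w \<bullet> A z) D \<and> (\<forall>z. norm (D z) \<le> c * norm w * (1 + norm z))"
begin

lemma A_lipschitz: "norm (A y - A x) \<le> c * (1 + norm x + norm (y - x)) * norm (y - x)"
proof -
  \<comment> \<open>Pairing with the increment itself turns the scalar mean value estimate into a
    bound on its norm.\<close>
  define w where "w = A y - A x"
  obtain D where D: "C1_gradient (\<lambda>z. w \<bullet> A z) D" "\<And>z. norm (D z) \<le> c * norm w * (1 + norm z)"
    using grad_A[of w] by blast
  have "\<bar>w \<bullet> A y - w \<bullet> A x\<bar> \<le> (c * norm w * (1 + norm x + norm (y - x))) * norm (y - x)"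
  proof (rule C1_gradient_segment_bound[OF D(1)])
    fix \<xi> assume "\<xi> \<in> closed_segment x y"
    then have "norm (\<xi> - x) \<le> norm (y - x)"
      using segment_bound(1) by (simp add: norm_minus_commute)
    then have "norm \<xi> \<le> norm x + norm (y - x)"
      using norm_triangle_ineq2[of \<xi> x] by linarith
    then have "c * norm w * (1 + norm \<xi>) \<le> c * norm w * (1 + norm x + norm (y - x))"
      using c_nonneg by (intro mult_left_mono) auto
    then show "norm (D \<xi>) \<le> c * norm w * (1 + norm x + norm (y - x))"
      using D(2)[of \<xi>] by linarith
  qed
  then have "norm w * norm w \<le> norm w * (c * (1 + norm x + norm (y - x)) * norm (y - x))"
    by (simp add: w_def inner_diff_right[symmetric] dot_square_norm power2_eq_square ac_simps)
  then show ?thesis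
    unfolding w_def[symmetric]
    using c_nonneg by (cases "norm w = 0") auto
qed

lemma G_taylor:
  "\<bar>G (z + h) - G z - A z \<bullet> h\<bar> \<le> c * (1 + norm z + norm h) * (norm h)\<^sup>2"
proof -
  have g: "C1_gradient (\<lambda>\<xi>. G \<xi> - A z \<bullet> \<xi>) (\<lambda>\<xi>. A \<xi> - A z)"
    unfolding C1_gradient_def
    by (auto intro!: derivative_eq_intros C1_gradientD(1)[OF grad_G] continuous_intros C1_gradientD(2)[OF grad_G]
        simp: inner_diff_left)
  have "\<bar>(G (z + h) - A z \<bullet> (z + h)) - (G z - A z \<bullet> z)\<bar>
    \<le> (c * (1 + norm z + norm h) * norm h) * norm ((z + h) - z)"
  proof (rule C1_gradient_segment_bound[OF g])
    fix \<xi> assume "\<xi> \<in> closed_segment z (z + h)"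
    then have "norm (\<xi> - z) \<le> norm h"
      using segment_bound(1)[of \<xi> z "z + h"] by (simp add: norm_minus_commute)
    then have "c * (1 + norm z + norm (\<xi> - z)) * norm (\<xi> - z) \<le> c * (1 + norm z + norm h) * norm h"
      using c_nonneg by (intro mult_mono mult_left_mono) auto
    then show "norm (A \<xi> - A z) \<le> c * (1 + norm z + norm h) * norm h"
      using A_lipschitz[of \<xi> z] by linarith
  qed
  then show ?thesis
    by (simp add: inner_add_right power2_eq_square algebra_simps)
qed

lemma G_diff_le: "\<bar>G (x - y)\<bar> \<le> (4 * c) * ((bracket x * bracket x) * (bracket y * bracket y))"
proof -
  have "\<bar>G (x - y)\<bar> \<le> c * (norm (x - y))\<^sup>2" by (rule G_le)
  also have "\<dots> \<le> c * (2 * (bracket x * bracket y))\<^sup>2"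
    using c_nonneg by (intro mult_left_mono power_mono norm_diff_le_bracket) auto
  finally show ?thesis by (simp add: power2_eq_square algebra_simps)
qed

lemma A_diff_le: "norm (A (x - y)) \<le> (2 * c) * (bracket x * bracket y)"
proof -
  have "norm (A (x - y)) \<le> c * norm (x - y)" by (rule A_le)
  also have "\<dots> \<le> c * (2 * (bracket x * bracket y))"
    using c_nonneg by (intro mult_left_mono norm_diff_le_bracket) auto
  finally show ?thesis by simp
qed

end

section \<open>Unit mass, quadratic test functions and pair integrals\<close>

locale unit_transport = weak_transport +
  assumes mass0: "measure (\<mu> 0) UNIV = 1" and second0: "integrable (\<mu> 0) (\<lambda>z. bracket z * bracket z)"
begin

lemma mass_1: "t \<in> {0..T} \<Longrightarrow> measure (\<mu> t) UNIV = 1"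
  using mass_conserved mass0 by simp

lemma integrable_bracket_sq: "t \<in> {0..T} \<Longrightarrow> integrable (\<mu> t) (\<lambda>z. bracket z * bracket z)"
  using second_moment_bounded[OF second0] by blast

definition bound :: real where
  "bound = (SOME B. 1 \<le> B \<and> (\<forall>t\<in>{0..T}. moment t \<le> B \<and> (\<integral>z. bracket z * bracket z \<partial>\<mu> t) \<le> B))"

lemma bound: "1 \<le> bound" "t \<in> {0..T} \<Longrightarrow> moment t \<le> bound"
  "t \<in> {0..T} \<Longrightarrow> (\<integral>z. bracket z * bracket z \<partial>\<mu> t) \<le> bound"
proof -
  obtain B1 B2 where B: "\<And>t. t \<in> {0..T} \<Longrightarrow> moment t \<le> B1"
    "\<And>t. t \<in> {0..T} \<Longrightarrow> (\<integral>z. bracket z * bracket z \<partial>\<mu> t) \<le> B2"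
    using moment_bounded second_moment_bounded[OF second0] by blast
  have "1 \<le> max 1 (max B1 B2) \<and>
      (\<forall>t\<in>{0..T}. moment t \<le> max 1 (max B1 B2) \<and> (\<integral>z. bracket z * bracket z \<partial>\<mu> t) \<le> max 1 (max B1 B2))"
    using B by (auto simp: le_max_iff_disj)
  note * = someI[of "\<lambda>B. 1 \<le> B \<and> (\<forall>t\<in>{0..T}. moment t \<le> B \<and> (\<integral>z. bracket z * bracket z \<partial>\<mu> t) \<le> B)", OF this,
      folded bound_def]
  show "1 \<le> bound" "t \<in> {0..T} \<Longrightarrow> moment t \<le> bound"
    "t \<in> {0..T} \<Longrightarrow> (\<integral>z. bracket z * bracket z \<partial>\<mu> t) \<le> bound"
    using * by auto
qed

definition rate :: real where "rate = C * (1 + bound) * bound"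

lemma rate_nonneg: "0 \<le> rate"
  using C_nonneg bound(1) by (simp add: rate_def)

lemma flux_quadratic:
  assumes r: "r \<in> {0..T}" and \<gamma>: "\<gamma> \<in> borel_measurable borel" and le: "\<And>z. norm (\<gamma> z) \<le> c * bracket z"
  shows "integrable (\<mu> r) (\<lambda>z. b r z \<bullet> \<gamma> z)" "\<bar>\<integral>z. b r z \<bullet> \<gamma> z \<partial>\<mu> r\<bar> \<le> rate * c"
proof -
  have c: "0 \<le> c"
    using le[of 0] bracket_pos[of "0::'a"] norm_ge_zero[of "\<gamma> 0"] by (smt (verit) mult_neg_pos)
  note f = flux_integrable[OF r \<gamma> bracket_ge_1 integrable_bracket_sq[OF r] le]
  show "integrable (\<mu> r) (\<lambda>z. b r z \<bullet> \<gamma> z)" by (rule f(1))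
  have "C * c * (1 + moment r) * (\<integral>z. bracket z * bracket z \<partial>\<mu> r) \<le> C * c * (1 + bound) * bound"
    using bound(1) bound(2,3)[OF r] C_nonneg c moment_nonneg[of r]
    by (intro mult_mono mult_left_mono add_left_mono) (auto intro!: Bochner_Integration.integral_nonneg)
  then show "\<bar>\<integral>z. b r z \<bullet> \<gamma> z \<partial>\<mu> r\<bar> \<le> rate * c"
    using f(3) by (simp add: rate_def algebra_simps)
qed

lemma weak_quadratic:
  assumes st: "0 \<le> s" "s \<le> t" "t \<le> T" and g: "C1_gradient g \<gamma>"
    and g_le: "\<And>z. \<bar>g z\<bar> \<le> c * (bracket z * bracket z)" and \<gamma>_le: "\<And>z. norm (\<gamma> z) \<le> c * bracket z"
  shows "set_integrable lborel {s..t} (\<lambda>r. \<integral>z. b r z \<bullet> \<gamma> z \<partial>\<mu> r)"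
    "(\<integral>z. g z \<partial>\<mu> t) - (\<integral>z. g z \<partial>\<mu> s) = (LINT r:{s..t}|lborel. \<integral>z. b r z \<bullet> \<gamma> z \<partial>\<mu> r)"
    "\<bar>(\<integral>z. g z \<partial>\<mu> t) - (\<integral>z. g z \<partial>\<mu> s)\<bar> \<le> rate * c * (t - s)"
proof -
  have 1: "r \<in> {0..T}" if "r \<in> {s..t}" for r using that st by auto
  note w = weak_extended[OF st g bracket_measurable bracket_ge_1 g_le \<gamma>_le
      integrable_bracket_sq[OF 1] bound(3)[OF 1]]
  show i: "set_integrable lborel {s..t} (\<lambda>r. \<integral>z. b r z \<bullet> \<gamma> z \<partial>\<mu> r)" by (rule w(1))
  show e: "(\<integral>z. g z \<partial>\<mu> t) - (\<integral>z. g z \<partial>\<mu> s) = (LINT r:{s..t}|lborel. \<integral>z. b r z \<bullet> \<gamma> z \<partial>\<mu> r)" by (rule w(2))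
  show "\<bar>(\<integral>z. g z \<partial>\<mu> t) - (\<integral>z. g z \<partial>\<mu> s)\<bar> \<le> rate * c * (t - s)"
    unfolding e by (rule set_integral_abs_le_const[OF i st(2) flux_quadratic(2)[OF 1 C1_gradientD(5)[OF g] \<gamma>_le]])
qed

text \<open>The majorant is a product of squared brackets, so finite second moments give Fubini. The
  times s and t are kept apart because the energy increment pairs the measures at two different
  times.\<close>

lemma integrable_pair:
  fixes H :: "'a \<Rightarrow> 'a \<Rightarrow> 'b::{banach, second_countable_topology}"
  assumes s: "s \<in> {0..T}" and t: "t \<in> {0..T}" and H: "case_prod H \<in> borel_measurable borel"
    and le: "\<And>x y. norm (H x y) \<le> k * ((bracket x * bracket x) * (bracket y * bracket y))"
  shows "integrable (\<mu> s \<Otimes>\<^sub>M \<mu> t) (case_prod H)" "integrable (\<mu> t) (H x)" "integrable (\<mu> s) (\<lambda>x. H x y)"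
    "integrable (\<mu> s) (\<lambda>x. \<integral>y. H x y \<partial>\<mu> t)" "integrable (\<mu> t) (\<lambda>y. \<integral>x. H x y \<partial>\<mu> s)"
    "(\<integral>x. \<integral>y. H x y \<partial>\<mu> t \<partial>\<mu> s) = (\<integral>y. \<integral>x. H x y \<partial>\<mu> s \<partial>\<mu> t)"
proof -
  interpret s: finite_measure "\<mu> s" by (rule finite_\<mu>[OF s])
  interpret t: finite_measure "\<mu> t" by (rule finite_\<mu>[OF t])
  interpret pair_sigma_finite "\<mu> s" "\<mu> t" ..
  have sets: "sets (\<mu> s \<Otimes>\<^sub>M \<mu> t) = sets (borel :: ('a \<times> 'a) measure)"
    unfolding borel_prod[symmetric] by (rule sets_pair_measure_cong[OF sets_\<mu>[OF s] sets_\<mu>[OF t]])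
  have m: "case_prod H \<in> borel_measurable (\<mu> s \<Otimes>\<^sub>M \<mu> t)"
    using H measurable_cong_sets[OF sets refl] by blast
  have m1: "H x \<in> borel_measurable borel" for x
    using measurable_compose[OF _ H, of "\<lambda>y. (x, y)" borel] by (simp add: borel_measurable_Pair)
  have m2: "(\<lambda>x. H x y) \<in> borel_measurable borel" for y
    using measurable_compose[OF _ H, of "\<lambda>x. (x, y)" borel] by (simp add: borel_measurable_Pair)
  have iy: "integrable (\<mu> t) (\<lambda>y. k * ((bracket x * bracket x) * (bracket y * bracket y)))" for x
    by (intro integrable_mult_right integrable_bracket_sq[OF t])
  show 2: "integrable (\<mu> t) (H x)" for x
    by (rule integrable_bound[OF t iy m1 le])
  show "integrable (\<mu> s) (\<lambda>x. H x y)"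
    by (rule integrable_bound[OF s _ m2 le]) (intro integrable_mult_right integrable_mult_left integrable_bracket_sq[OF s])
  show i: "integrable (\<mu> s \<Otimes>\<^sub>M \<mu> t) (case_prod H)"
  proof (rule Fubini_integrable[OF m])
    show "AE x in \<mu> s. integrable (\<mu> t) (\<lambda>y. case_prod H (x, y))"
      using 2 by simp
    have "(\<lambda>x. \<integral>y. norm (H x y) \<partial>\<mu> t) \<in> borel_measurable (\<mu> s)"
      using m by (intro t.borel_measurable_lebesgue_integral) (simp add: case_prod_beta')
    moreover have "norm (\<integral>y. norm (H x y) \<partial>\<mu> t)
        \<le> norm (k * ((bracket x * bracket x) * (\<integral>y. bracket y * bracket y \<partial>\<mu> t)))" for x
    proof -
      have "(\<integral>y. norm (H x y) \<partial>\<mu> t) \<le> (\<integral>y. k * ((bracket x * bracket x) * (bracket y * bracket y)) \<partial>\<mu> t)"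
        using 2 iy le by (intro integral_mono) auto
      also have "\<dots> = k * ((bracket x * bracket x) * (\<integral>y. bracket y * bracket y \<partial>\<mu> t))"
        by simp
      finally show ?thesis
        by (subst real_norm_def) (auto simp: abs_of_nonneg intro: order_trans[OF _ abs_ge_self])
    qed
    ultimately show "integrable (\<mu> s) (\<lambda>x. \<integral>y. norm (case_prod H (x, y)) \<partial>\<mu> t)"
      by (intro Bochner_Integration.integrable_bound[OF
            integrable_mult_right[OF integrable_mult_left[OF integrable_bracket_sq[OF s]]]] AE_I2) auto
  qed
  show "integrable (\<mu> s) (\<lambda>x. \<integral>y. H x y \<partial>\<mu> t)"
    using integrable_fst[OF i] .
  show "integrable (\<mu> t) (\<lambda>y. \<integral>x. H x y \<partial>\<mu> s)"
    using integrable_snd[OF i] .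
  show "(\<integral>x. \<integral>y. H x y \<partial>\<mu> t \<partial>\<mu> s) = (\<integral>y. \<integral>x. H x y \<partial>\<mu> s \<partial>\<mu> t)"
    using Fubini_integral[OF i] by simp
qed

text \<open>Exchanging the two particles flips the sign of an odd kernel.\<close>

lemma odd_kernel_symmetrize:
  fixes p \<Theta> :: "'a \<Rightarrow> 'a"
  assumes t: "t \<in> {0..T}" and p: "continuous_on UNIV p" "\<And>z. norm (p z) \<le> k * bracket z"
    and \<Theta>: "continuous_on UNIV \<Theta>" "\<And>z. \<Theta> (- z) = - \<Theta> z" "\<And>z. norm (\<Theta> z) \<le> k * norm z"
  shows "2 * (\<integral>z. p z \<bullet> (\<integral>y. \<Theta> (z - y) \<partial>\<mu> t) \<partial>\<mu> t) = (\<integral>z. \<integral>y. (p z - p y) \<bullet> \<Theta> (z - y) \<partial>\<mu> t \<partial>\<mu> t)"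
proof -
  have k: "0 \<le> k"
    using p(2)[of 0] bracket_pos[of "0::'a"] norm_ge_zero[of "p 0"] by (smt (verit) mult_neg_pos)
  have \<Theta>_le: "norm (\<Theta> (x - y)) \<le> (2 * k) * (bracket x * bracket y)" for x y
  proof -
    have "norm (\<Theta> (x - y)) \<le> k * norm (x - y)" by (rule \<Theta>(3))
    also have "\<dots> \<le> k * (2 * (bracket x * bracket y))"
      using k by (intro mult_left_mono norm_diff_le_bracket)
    finally show ?thesis by simp
  qed
  have pair_le: "norm (p x \<bullet> \<Theta> (x - y)) \<le> (2 * k * k) * ((bracket x * bracket x) * (bracket y * bracket y))" for x y
  proof -
    have "norm (p x \<bullet> \<Theta> (x - y)) \<le> norm (p x) * norm (\<Theta> (x - y))"
      by (simp add: Cauchy_Schwarz_ineq2)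
    also have "\<dots> \<le> (k * bracket x) * ((2 * k) * (bracket x * bracket y))"
      by (intro mult_mono p(2) \<Theta>_le) (use k in auto)
    also have "\<dots> \<le> (k * bracket x) * ((2 * k) * (bracket x * (bracket y * bracket y)))"
      using k mult_left_mono[OF bracket_ge_1 bracket_nonneg, of y y] by (intro mult_left_mono) auto
    finally show ?thesis by (simp add: algebra_simps)
  qed
  have "continuous_on UNIV (\<lambda>q. p (fst q) \<bullet> \<Theta> (fst q - snd q))"
    by (intro continuous_intros continuous_on_compose2[OF p(1)] continuous_on_compose2[OF \<Theta>(1)]) auto
  then have m: "(\<lambda>(x, y). p x \<bullet> \<Theta> (x - y)) \<in> borel_measurable borel"
    by (intro borel_measurable_continuous_onI) (simp add: case_prod_beta')
  note I = integrable_pair[OF t t m pair_le]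
  have i\<Theta>: "integrable (\<mu> t) (\<lambda>y. \<Theta> (z - y))" for z
    by (rule integrable_bound[OF t _ _ \<Theta>_le])
      (auto intro!: integrable_bracket[OF t] borel_measurable_continuous_onI continuous_intros
        continuous_on_compose2[OF \<Theta>(1)])
  have odd: "p x \<bullet> \<Theta> (x - y) = - (p x \<bullet> \<Theta> (y - x))" for x y
    using \<Theta>(2)[of "y - x"] by simp
  have iy: "integrable (\<mu> t) (\<lambda>y. p y \<bullet> \<Theta> (z - y))" for z
    using I(3)[of z] by (subst (asm) odd) simp
  have iyy: "integrable (\<mu> t) (\<lambda>z. \<integral>y. p y \<bullet> \<Theta> (z - y) \<partial>\<mu> t)"
    using I(5) by (subst (asm) odd) simp
  have swap: "(\<integral>z. \<integral>y. p y \<bullet> \<Theta> (z - y) \<partial>\<mu> t \<partial>\<mu> t) = - (\<integral>z. \<integral>y. p z \<bullet> \<Theta> (z - y) \<partial>\<mu> t \<partial>\<mu> t)"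
    using I(6) by (subst (asm) (2) odd) simp
  have "(\<integral>z. \<integral>y. (p z - p y) \<bullet> \<Theta> (z - y) \<partial>\<mu> t \<partial>\<mu> t)
    = (\<integral>z. (\<integral>y. p z \<bullet> \<Theta> (z - y) \<partial>\<mu> t) - (\<integral>y. p y \<bullet> \<Theta> (z - y) \<partial>\<mu> t) \<partial>\<mu> t)"
    unfolding inner_diff_left
    by (intro Bochner_Integration.integral_cong refl Bochner_Integration.integral_diff I(2) iy)
  also have "\<dots> = (\<integral>z. \<integral>y. p z \<bullet> \<Theta> (z - y) \<partial>\<mu> t \<partial>\<mu> t) - (\<integral>z. \<integral>y. p y \<bullet> \<Theta> (z - y) \<partial>\<mu> t \<partial>\<mu> t)"
    by (intro Bochner_Integration.integral_diff I(4) iyy)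
  also have "\<dots> = 2 * (\<integral>z. \<integral>y. p z \<bullet> \<Theta> (z - y) \<partial>\<mu> t \<partial>\<mu> t)"
    unfolding swap by simp
  also have "(\<integral>z. \<integral>y. p z \<bullet> \<Theta> (z - y) \<partial>\<mu> t \<partial>\<mu> t) = (\<integral>z. p z \<bullet> (\<integral>y. \<Theta> (z - y) \<partial>\<mu> t) \<partial>\<mu> t)"
    by (intro Bochner_Integration.integral_cong refl integral_inner_right i\<Theta>)
  finally show ?thesis by simp
qed

text \<open>Variance through two independent copies: the cross term of |z - y|^2 integrates to |m|^2
  and unit mass preserves the squares. Through this identity a functional of differences controls
  the spread around the mean.\<close>

lemma variance:
  assumes t: "t \<in> {0..T}"
  shows "integrable (\<mu> t) (\<lambda>z. (norm (z - (\<integral>y. y \<partial>\<mu> t)))\<^sup>2)"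
    "(\<integral>z. \<integral>y. (norm (z - y))\<^sup>2 \<partial>\<mu> t \<partial>\<mu> t) = 2 * (\<integral>z. (norm (z - (\<integral>y. y \<partial>\<mu> t)))\<^sup>2 \<partial>\<mu> t)"
proof -
  define m where "m = (\<integral>y. y \<partial>\<mu> t)"
  define V where "V = (\<integral>z. z \<bullet> z \<partial>\<mu> t)"
  have space: "measure (\<mu> t) (space (\<mu> t)) = 1"
    using mass_1[OF t] space_\<mu>[OF t] by simp
  have "integrable (\<mu> t) (\<lambda>z. bracket z * bracket z - 1)"
    by (intro Bochner_Integration.integrable_diff integrable_bracket_sq[OF t] integrable_const[OF t])
  then have iV: "integrable (\<mu> t) (\<lambda>z. z \<bullet> z)"
    by (simp add: bracket_sq flip: power2_eq_square)
  have expand: "(norm (z - y))\<^sup>2 = z \<bullet> z - 2 * (z \<bullet> y) + y \<bullet> y" for z y :: 'a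
    by (simp add: power2_norm_eq_inner inner_diff inner_commute algebra_simps)
  have ii: "integrable (\<mu> t) (\<lambda>z. z \<bullet> y)" "(\<integral>z. z \<bullet> y \<partial>\<mu> t) = m \<bullet> y"
    "integrable (\<mu> t) (\<lambda>z. y \<bullet> z)" "(\<integral>z. y \<bullet> z \<partial>\<mu> t) = y \<bullet> m" for y
    unfolding m_def using integrable_id[OF t] by simp_all
  have i1: "integrable (\<mu> t) (\<lambda>z. (norm (z - y))\<^sup>2)" for y
    unfolding expand by (simp add: iV ii integrable_const[OF t])
  then show "integrable (\<mu> t) (\<lambda>z. (norm (z - (\<integral>y. y \<partial>\<mu> t)))\<^sup>2)" .
  have e1: "(\<integral>z. (norm (z - y))\<^sup>2 \<partial>\<mu> t) = V - 2 * (m \<bullet> y) + y \<bullet> y" for y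
    unfolding expand by (simp add: iV ii integrable_const[OF t] V_def space)
  have "(\<integral>y. (norm (z - y))\<^sup>2 \<partial>\<mu> t) = V - 2 * (m \<bullet> z) + z \<bullet> z" for z
    using e1[of z] by (simp add: norm_minus_commute)
  then have "(\<integral>z. \<integral>y. (norm (z - y))\<^sup>2 \<partial>\<mu> t \<partial>\<mu> t) = (\<integral>z. V - 2 * (m \<bullet> z) + z \<bullet> z \<partial>\<mu> t)"
    by simp
  also have "\<dots> = V - 2 * (m \<bullet> m) + V"
    by (simp add: iV ii integrable_const[OF t] V_def space)
  finally show "(\<integral>z. \<integral>y. (norm (z - y))\<^sup>2 \<partial>\<mu> t \<partial>\<mu> t) = 2 * (\<integral>z. (norm (z - (\<integral>y. y \<partial>\<mu> t)))\<^sup>2 \<partial>\<mu> t)"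
    using e1[of m] by (simp add: m_def[symmetric])
qed

end

section \<open>Potentials generated by the measure, and decay of the energy\<close>

locale energy_transport = unit_transport \<mu> b T C + interaction_energy G A c
  for \<mu> :: "real \<Rightarrow> 'a::euclidean_space measure" and b T C
    and G :: "'a \<Rightarrow> real" and A :: "'a \<Rightarrow> 'a" and c
begin

definition potential :: "real \<Rightarrow> 'a \<Rightarrow> real" where
  "potential t z = (\<integral>y. G (z - y) \<partial>\<mu> t)"

definition potential_grad :: "real \<Rightarrow> 'a \<Rightarrow> 'a" where
  "potential_grad t z = (\<integral>y. A (z - y) \<partial>\<mu> t)"

definition energy :: "real \<Rightarrow> real" where
  "energy t = (\<integral>z. potential t z \<partial>\<mu> t)"

lemma G_pair_measurable: "(\<lambda>(x, y). G (x - y)) \<in> borel_measurable borel"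
proof (rule borel_measurable_continuous_onI)
  have "continuous_on UNIV (\<lambda>p. G (fst p - snd p))"
    by (rule continuous_on_compose2[OF C1_gradientD(3)[OF grad_G]]) (auto intro!: continuous_intros)
  then show "continuous_on UNIV (\<lambda>(x, y). G (x - y))"
    by (simp add: case_prod_beta')
qed

lemmas G_pair = integrable_pair[OF _ _ G_pair_measurable G_diff_le[folded real_norm_def]]

lemma A_measurable: "(\<lambda>y. A (z - y)) \<in> borel_measurable borel"
  by (rule borel_measurable_continuous_onI[OF continuous_on_compose2[OF C1_gradientD(2)[OF grad_G]]])
    (auto intro!: continuous_intros)

lemma A_integrable:
  assumes t: "t \<in> {0..T}" shows "integrable (\<mu> t) (\<lambda>y. A (z - y))"
  by (rule integrable_bound[OF t _ A_measurable A_diff_le])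
    (intro integrable_mult_right integrable_bracket[OF t])

lemma potential_grad_le:
  assumes t: "t \<in> {0..T}" shows "norm (potential_grad t z) \<le> (2 * c * bound) * bracket z"
proof -
  have i: "integrable (\<mu> t) (\<lambda>y. (2 * c) * (bracket z * bracket y))"
    by (intro integrable_mult_right integrable_bracket[OF t])
  have "norm (potential_grad t z) \<le> (\<integral>y. (2 * c) * (bracket z * bracket y) \<partial>\<mu> t)"
    unfolding potential_grad_def
    by (rule Bochner_Integration.integral_norm_bound_integral[OF A_integrable[OF t] i A_diff_le])
  also have "\<dots> = (2 * c * moment t) * bracket z"
    by (simp add: moment_def)
  also have "\<dots> \<le> (2 * c * bound) * bracket z"
    using c_nonneg by (intro mult_right_mono mult_left_mono bound(2)[OF t]) auto
  finally show ?thesis .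
qed

lemma potential_le:
  assumes t: "t \<in> {0..T}" shows "\<bar>potential t z\<bar> \<le> (4 * c * bound) * (bracket z * bracket z)"
proof -
  have i: "integrable (\<mu> t) (\<lambda>y. (4 * c) * ((bracket z * bracket z) * (bracket y * bracket y)))"
    by (intro integrable_mult_right integrable_bracket_sq[OF t])
  have "norm (potential t z) \<le> (\<integral>y. (4 * c) * ((bracket z * bracket z) * (bracket y * bracket y)) \<partial>\<mu> t)"
    unfolding potential_def
    by (rule Bochner_Integration.integral_norm_bound_integral[OF G_pair(2)[OF t t] i])
      (use G_diff_le in simp)
  also have "\<dots> = (4 * c * (\<integral>y. bracket y * bracket y \<partial>\<mu> t)) * (bracket z * bracket z)"
    by simp
  also have "\<dots> \<le> (4 * c * bound) * (bracket z * bracket z)"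
    using c_nonneg by (intro mult_right_mono mult_left_mono bound(3)[OF t]) auto
  finally show ?thesis by simp
qed

lemma C1_gradient_potential:
  assumes t: "t \<in> {0..T}" shows "C1_gradient (potential t) (potential_grad t)"
  unfolding C1_gradient_def
proof safe
  note iG = G_pair(2)[OF t t]
  have second_order: "\<bar>potential t (z + h) - potential t z - potential_grad t z \<bullet> h\<bar>
    \<le> (4 * c * bound * bracket z) * (norm h)\<^sup>2" if h: "norm h \<le> 1" for z h
  proof -
    have i: "integrable (\<mu> t) (\<lambda>y. G (z + h - y) - G (z - y) - A (z - y) \<bullet> h)"
      by (intro Bochner_Integration.integrable_diff iG integrable_inner_left A_integrable[OF t])
    have iw: "integrable (\<mu> t) (\<lambda>y. (4 * c * (norm h)\<^sup>2 * bracket z) * bracket y)"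
      by (intro integrable_mult_right integrable_bracket[OF t])
    have "potential t (z + h) - potential t z - potential_grad t z \<bullet> h
      = (\<integral>y. G (z + h - y) - G (z - y) - A (z - y) \<bullet> h \<partial>\<mu> t)"
      unfolding potential_def potential_grad_def
      by (simp add: Bochner_Integration.integral_diff iG integrable_inner_left A_integrable[OF t])
    moreover have "norm (\<integral>y. G (z + h - y) - G (z - y) - A (z - y) \<bullet> h \<partial>\<mu> t)
        \<le> (\<integral>y. (4 * c * (norm h)\<^sup>2 * bracket z) * bracket y \<partial>\<mu> t)"
    proof (rule Bochner_Integration.integral_norm_bound_integral[OF i iw])
      fix y
      have "norm (G (z + h - y) - G (z - y) - A (z - y) \<bullet> h) \<le> c * (1 + norm (z - y) + norm h) * (norm h)\<^sup>2"
        using G_taylor[of "z - y" h] by (simp add: algebra_simps)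
      \<comment> \<open>The factor 4 is 2 for 1 + |h| \<le> 2 and 2 for |z - y|, each measured
        against the product of the brackets.\<close>
      also have "\<dots> \<le> c * (4 * (bracket z * bracket y)) * (norm h)\<^sup>2"
        using h norm_diff_le_bracket[of z y] one_le_bracket_mult[of z y] c_nonneg
        by (intro mult_right_mono mult_left_mono) auto
      finally show "norm (G (z + h - y) - G (z - y) - A (z - y) \<bullet> h)
          \<le> (4 * c * (norm h)\<^sup>2 * bracket z) * bracket y"
        by (simp add: algebra_simps)
    qed
    moreover have "(\<integral>y. (4 * c * (norm h)\<^sup>2 * bracket z) * bracket y \<partial>\<mu> t)
        \<le> (4 * c * bound * bracket z) * (norm h)\<^sup>2"
    proof -
      have "(4 * c * (norm h)\<^sup>2 * bracket z) * moment t \<le> (4 * c * (norm h)\<^sup>2 * bracket z) * bound"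
        using c_nonneg by (intro mult_left_mono bound(2)[OF t]) auto
      then show ?thesis by (simp add: moment_def algebra_simps)
    qed
    ultimately show ?thesis by simp
  qed
  fix z
  show "(potential t has_derivative (\<lambda>h. potential_grad t z \<bullet> h)) (at z)"
    by (rule has_derivative_quadratic_remainder[OF bounded_linear_inner_right,
          where K = "4 * c * bound * bracket z"])
      (simp add: second_order)
next
  have lip: "norm (potential_grad t y - potential_grad t z)
      \<le> (c * bound * (3 * bracket z + norm (y - z))) * norm (y - z)" for y z
  proof -
    define k where "k = c * norm (y - z) * (3 * bracket z + norm (y - z))"
    have k: "0 \<le> k" using c_nonneg by (simp add: k_def)
    have iw: "integrable (\<mu> t) (\<lambda>x. k * bracket x)"
      by (intro integrable_mult_right integrable_bracket[OF t])
    have "potential_grad t y - potential_grad t z = (\<integral>x. A (y - x) - A (z - x) \<partial>\<mu> t)"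
      unfolding potential_grad_def by (simp add: A_integrable[OF t])
    also have "norm \<dots> \<le> (\<integral>x. k * bracket x \<partial>\<mu> t)"
    proof (rule Bochner_Integration.integral_norm_bound_integral[OF Bochner_Integration.integrable_diff[OF
            A_integrable[OF t] A_integrable[OF t]] iw])
      fix x
      have "norm (A (y - x) - A (z - x)) \<le> c * (1 + norm (z - x) + norm (y - z)) * norm (y - z)"
        using A_lipschitz[of "y - x" "z - x"] by simp
      also have "1 + norm (z - x) + norm (y - z) \<le> (3 * bracket z + norm (y - z)) * bracket x"
      proof -
        have "norm (y - z) * 1 \<le> norm (y - z) * bracket x"
          by (intro mult_left_mono bracket_ge_1) auto
        then show ?thesis
          using norm_diff_le_bracket[of z x] one_le_bracket_mult[of z x] by (simp add: algebra_simps)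
      qed
      then have "c * (1 + norm (z - x) + norm (y - z)) * norm (y - z)
          \<le> c * ((3 * bracket z + norm (y - z)) * bracket x) * norm (y - z)"
        using c_nonneg by (intro mult_right_mono mult_left_mono) auto
      finally show "norm (A (y - x) - A (z - x)) \<le> k * bracket x"
        by (simp add: k_def algebra_simps)
    qed
    also have "\<dots> \<le> k * bound"
      using mult_left_mono[OF bound(2)[OF t] k] by (simp add: moment_def)
    finally show ?thesis by (simp add: k_def algebra_simps)
  qed
  show "continuous_on UNIV (potential_grad t)"
  proof (rule continuous_at_imp_continuous_on, safe)
    fix z
    have "((\<lambda>y. potential_grad t y - potential_grad t z) \<longlongrightarrow> 0) (at z)"
    proof (rule Lim_null_comparison[OF always_eventually])
      show "\<forall>y. norm (potential_grad t y - potential_grad t z)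
          \<le> (c * bound * (3 * bracket z + norm (y - z))) * norm (y - z)"
        using lip by blast
      show "((\<lambda>y. (c * bound * (3 * bracket z + norm (y - z))) * norm (y - z)) \<longlongrightarrow> 0) (at z)"
        by (auto intro!: tendsto_eq_intros)
    qed
    then show "isCont (potential_grad t) z"
      by (simp add: isCont_def LIM_zero_iff)
  qed
qed

text \<open>Only the measure moves: y \<mapsto> w \<bullet> A (z - y) is a fixed test function, so
  its integral is Lipschitz in time. Choosing w as the increment of the gradient converts this into
  a bound on the norm.\<close>

lemma potential_grad_time:
  assumes st: "0 \<le> s" "s \<le> t" "t \<le> T"
  shows "norm (potential_grad t z - potential_grad s z) \<le> (rate * 3 * c * (t - s)) * bracket z"
proof -
  have sT: "s \<in> {0..T}" and tT: "t \<in> {0..T}" using st by auto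
  define w where "w = potential_grad t z - potential_grad s z"
  obtain D where D: "C1_gradient (\<lambda>z. w \<bullet> A z) D" "\<And>z. norm (D z) \<le> c * norm w * (1 + norm z)"
    using grad_A[of w] by blast
  have grad: "C1_gradient (\<lambda>y. w \<bullet> A (z - y)) (\<lambda>y. - D (z - y))"
    unfolding C1_gradient_def
  proof safe
    fix y
    have "((\<lambda>y. z - y) has_derivative (\<lambda>h. - h)) (at y)"
      by (auto intro!: derivative_eq_intros)
    from diff_chain_at[OF this C1_gradientD(1)[OF D(1)]]
    show "((\<lambda>y. w \<bullet> A (z - y)) has_derivative (\<lambda>h. - D (z - y) \<bullet> h)) (at y)"
      by (simp add: o_def)
    show "continuous_on UNIV (\<lambda>y. - D (z - y))"
      by (intro continuous_on_minus continuous_on_compose2[OF C1_gradientD(2)[OF D(1)]]) (auto intro!: continuous_intros)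
  qed
  define k where "k = 3 * c * norm w * bracket z"
  have "norm w * norm w = w \<bullet> potential_grad t z - w \<bullet> potential_grad s z"
    by (simp add: w_def inner_diff_right[symmetric] dot_square_norm power2_eq_square)
  also have "\<dots> = (\<integral>y. w \<bullet> A (z - y) \<partial>\<mu> t) - (\<integral>y. w \<bullet> A (z - y) \<partial>\<mu> s)"
    unfolding potential_grad_def by (simp add: A_integrable[OF sT] A_integrable[OF tT])
  also have "\<dots> \<le> rate * k * (t - s)"
  proof (rule order_trans[OF abs_ge_self weak_quadratic(3)[OF st grad]])
    fix y
    have "\<bar>w \<bullet> A (z - y)\<bar> \<le> norm w * norm (A (z - y))"
      by (rule Cauchy_Schwarz_ineq2)
    also have "\<dots> \<le> norm w * ((2 * c) * (bracket z * bracket y))"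
      by (intro mult_left_mono A_diff_le) auto
    also have "\<dots> \<le> norm w * ((3 * c) * (bracket z * (bracket y * bracket y)))"
      using c_nonneg mult_left_mono[OF bracket_ge_1 bracket_nonneg, of y y]
      by (intro mult_left_mono mult_mono) auto
    finally show "\<bar>w \<bullet> A (z - y)\<bar> \<le> k * (bracket y * bracket y)"
      by (simp add: k_def algebra_simps)
    have "norm (- D (z - y)) \<le> c * norm w * (1 + norm (z - y))"
      using D(2) by simp
    also have "\<dots> \<le> c * norm w * (3 * (bracket z * bracket y))"
      using c_nonneg norm_diff_le_bracket[of z y] one_le_bracket_mult[of z y]
      by (intro mult_left_mono) auto
    finally show "norm (- D (z - y)) \<le> k * bracket y"
      by (simp add: k_def algebra_simps)
  qed
  finally have "norm w * norm w \<le> norm w * ((rate * 3 * c * (t - s)) * bracket z)"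
    by (simp add: k_def algebra_simps)
  then show ?thesis
    unfolding w_def[symmetric] using rate_nonneg c_nonneg st
    by (cases "norm w = 0") auto
qed

lemma potential_integrable: "s \<in> {0..T} \<Longrightarrow> t \<in> {0..T} \<Longrightarrow> integrable (\<mu> s) (potential t)"
  unfolding potential_def[abs_def] by (rule G_pair(4))

lemma potential_swap:
  assumes "s \<in> {0..T}" "t \<in> {0..T}"
  shows "(\<integral>z. potential t z \<partial>\<mu> s) = (\<integral>z. potential s z \<partial>\<mu> t)"
proof -
  have "G (x - y) = G (y - x)" for x y
    using G_even[of "x - y"] by simp
  then show ?thesis
    unfolding potential_def using G_pair(6)[OF assms] by simp
qed

lemma energy_decay:
  assumes pos: "\<And>t. t \<in> {0..T} \<Longrightarrow> 0 \<le> energy t"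
    and diss: "\<And>t. t \<in> {0..T} \<Longrightarrow> 2 * (\<integral>z. b t z \<bullet> potential_grad t z \<partial>\<mu> t) \<le> - \<kappa> * energy t"
    and \<kappa>: "0 \<le> \<kappa>"
  shows "energy T \<le> exp (- \<kappa> * T) * energy 0"
proof -
  define flux where "flux s t r = (\<integral>z. b r z \<bullet> (potential_grad t z + potential_grad s z) \<partial>\<mu> r)" for s t r
  define K1 where "K1 = rate * (8 * c * bound)"
  define K2 where "K2 = 2 * rate * (rate * 3 * c)"
  have K1: "0 \<le> K1" and K2: "0 \<le> K2"
    using rate_nonneg c_nonneg bound(1) by (auto simp: K1_def K2_def)
  note meas = C1_gradientD(5)[OF C1_gradient_potential]
  have incr: "set_integrable lborel {s..t} (flux s t)"
    "energy t - energy s = (LINT r:{s..t}|lborel. flux s t r)"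
    "\<bar>energy t - energy s\<bar> \<le> K1 * (t - s)"
    if st: "0 \<le> s" "s \<le> t" "t \<le> T" for s t
  proof -
    have sT: "s \<in> {0..T}" and tT: "t \<in> {0..T}" using st by auto
    note grad = C1_gradient_add[OF C1_gradient_potential[OF tT] C1_gradient_potential[OF sT]]
    have le: "\<bar>potential t z + potential s z\<bar> \<le> (8 * c * bound) * (bracket z * bracket z)" for z
      using potential_le[OF sT, of z] potential_le[OF tT, of z] by simp
    have "norm (potential_grad t z + potential_grad s z) \<le> (4 * c * bound) * bracket z" for z
      using norm_triangle_ineq[of "potential_grad t z" "potential_grad s z"]
        potential_grad_le[OF sT, of z] potential_grad_le[OF tT, of z] by simp
    moreover have "(4 * c * bound) * bracket z \<le> (8 * c * bound) * bracket z" for z :: 'a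
      using c_nonneg bound(1) by (intro mult_right_mono) auto
    ultimately have le': "norm (potential_grad t z + potential_grad s z) \<le> (8 * c * bound) * bracket z" for z
      by (rule order_trans)
    note w = weak_quadratic[OF st grad le le']
    show "set_integrable lborel {s..t} (flux s t)"
      unfolding flux_def[abs_def] by (rule w(1))
    \<comment> \<open>Let B(s,t) be the integral of \<open>potential t\<close> against
      \<open>\<mu> s\<close>. Since \<open>G\<close> is even, B(s,t) = B(t,s), so the mixed terms
      cancel and B(t,t) - B(s,s) remains.\<close>
    have e: "energy t - energy s = (\<integral>z. potential t z + potential s z \<partial>\<mu> t) - (\<integral>z. potential t z + potential s z \<partial>\<mu> s)"
      using potential_swap[OF sT tT]
      by (simp add: energy_def potential_integrable[OF sT sT] potential_integrable[OF sT tT]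
          potential_integrable[OF tT sT] potential_integrable[OF tT tT])
    show "energy t - energy s = (LINT r:{s..t}|lborel. flux s t r)"
      unfolding flux_def e by (rule w(2))
    show "\<bar>energy t - energy s\<bar> \<le> K1 * (t - s)"
      unfolding K1_def e by (rule w(3))
  qed
  \<comment> \<open>The dissipation estimate needs field and potential at the same time r. Replacing
    each of the two frozen gradients by the one at r costs order t - s; \<open>K2\<close> collects
    both costs.\<close>
  have flux_le: "flux s t r \<le> - \<kappa> * energy r + K2 * (t - s)"
    if st: "0 \<le> s" "s \<le> t" "t \<le> T" and r: "r \<in> {s..t}" for s t r
  proof -
    have sT: "s \<in> {0..T}" and tT: "t \<in> {0..T}" and rT: "r \<in> {0..T}" using st r by auto
    have close: "norm (potential_grad q z - potential_grad r z) \<le> (rate * 3 * c * (t - s)) * bracket z"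
      if q: "q \<in> {s..t}" for q z
    proof -
      have "norm (potential_grad q z - potential_grad r z) \<le> (rate * 3 * c * \<bar>q - r\<bar>) * bracket z"
      proof (cases "r \<le> q")
        case True
        then show ?thesis using potential_grad_time[of r q z] q r st by simp
      next
        case False
        then show ?thesis using potential_grad_time[of q r z] q r st by (simp add: norm_minus_commute)
      qed
      also have "\<dots> \<le> (rate * 3 * c * (t - s)) * bracket z"
        using q r rate_nonneg c_nonneg by (intro mult_right_mono mult_left_mono) auto
      finally show ?thesis .
    qed
    have i: "integrable (\<mu> r) (\<lambda>z. b r z \<bullet> potential_grad q z)" if "q \<in> {0..T}" for q
      by (rule flux_quadratic(1)[OF rT meas[OF that] potential_grad_le[OF that]])
    have d: "(\<integral>z. b r z \<bullet> potential_grad q z \<partial>\<mu> r)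
        \<le> (\<integral>z. b r z \<bullet> potential_grad r z \<partial>\<mu> r) + rate * (rate * 3 * c * (t - s))" if q: "q \<in> {s..t}" for q
    proof -
      have qT: "q \<in> {0..T}" using q st by auto
      have "(\<integral>z. b r z \<bullet> potential_grad q z \<partial>\<mu> r) - (\<integral>z. b r z \<bullet> potential_grad r z \<partial>\<mu> r)
        = (\<integral>z. b r z \<bullet> (potential_grad q z - potential_grad r z) \<partial>\<mu> r)"
        by (simp add: inner_diff_right i[OF qT] i[OF rT])
      also have "\<dots> \<le> rate * (rate * 3 * c * (t - s))"
        by (rule order_trans[OF abs_ge_self flux_quadratic(2)[OF rT _ close[OF q]]])
          (intro borel_measurable_diff meas[OF qT] meas[OF rT])
      finally show ?thesis by simp
    qed
    have "flux s t r = (\<integral>z. b r z \<bullet> potential_grad t z \<partial>\<mu> r) + (\<integral>z. b r z \<bullet> potential_grad s z \<partial>\<mu> r)"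
      unfolding flux_def by (simp add: inner_add_right i[OF sT] i[OF tT])
    also have "\<dots> \<le> 2 * (\<integral>z. b r z \<bullet> potential_grad r z \<partial>\<mu> r) + K2 * (t - s)"
      using d[of s] d[of t] st by (simp add: K2_def algebra_simps)
    finally show ?thesis using diss[OF rT] by linarith
  qed
  show ?thesis
  proof (rule gronwall_approx[OF T_nonneg pos, where K = "\<kappa> * K1 + K2"])
    show "0 \<le> \<kappa> * K1 + K2" using \<kappa> K1 K2 by simp
    fix s t assume st: "0 \<le> s" "s \<le> t" "t \<le> T"
    \<comment> \<open>The dissipation provides \<open>energy r\<close>, the Gronwall step asks for
      \<open>energy s\<close>; the Lipschitz bound \<open>K1\<close> exchanges them, again at a cost
      of order t - s before integration.\<close>
    have "(LINT r:{s..t}|lborel. flux s t r) \<le> (- \<kappa> * energy s + (\<kappa> * K1 + K2) * (t - s)) * (t - s)"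
    proof (rule set_integral_le_const[OF incr(1)[OF st] st(2)])
      fix r assume r: "r \<in> {s..t}"
      have "energy s - K1 * (t - s) \<le> energy s - K1 * (r - s)"
        using r K1 by (intro diff_left_mono mult_left_mono) auto
      also have "\<dots> \<le> energy r"
        using incr(3)[of s r] r st by (auto simp: abs_le_iff)
      finally have "\<kappa> * (energy s - K1 * (t - s)) \<le> \<kappa> * energy r"
        using \<kappa> by (rule mult_left_mono)
      then show "flux s t r \<le> - \<kappa> * energy s + (\<kappa> * K1 + K2) * (t - s)"
        using flux_le[OF st r] by (simp add: algebra_simps)
    qed
    then show "energy t \<le> energy s + - \<kappa> * (t - s) * energy s + (\<kappa> * K1 + K2) * (t - s)\<^sup>2"
      using incr(2)[OF st] by (simp add: algebra_simps power2_eq_square)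
  qed
qed

end

section \<open>The communication rate\<close>

lemma C1_gradient_cmult:
  assumes "C1_gradient g \<gamma>" shows "C1_gradient (\<lambda>z. k * g z) (\<lambda>z. k *\<^sub>R \<gamma> z)"
  using C1_gradient_mult[OF C1_gradient_const[of k] assms] by simp

lemma C1_gradient_inner_const: "C1_gradient (\<lambda>z. w \<bullet> z) (\<lambda>z. w)"
  by (auto simp: C1_gradient_def intro!: derivative_eq_intros)

lemma C1_gradient_fst:
  assumes f: "C1_gradient f \<alpha>"
  shows "C1_gradient (\<lambda>z::'a::euclidean_space \<times> 'b::euclidean_space. f (fst z)) (\<lambda>z. (\<alpha> (fst z), 0))"
  unfolding C1_gradient_def
proof safe
  fix a :: 'a and b :: 'b
  have "(fst has_derivative fst) (at (a, b))"
    by (rule has_derivative_fst[OF has_derivative_ident])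
  from diff_chain_at[OF this C1_gradientD(1)[OF f]]
  show "((\<lambda>z. f (fst z)) has_derivative (\<lambda>h. (\<alpha> (fst (a, b)), 0) \<bullet> h)) (at (a, b))"
    by (simp add: o_def inner_prod_def)
  show "continuous_on UNIV (\<lambda>z::'a \<times> 'b. (\<alpha> (fst z), 0::'b))"
    by (auto intro!: continuous_intros continuous_on_compose2[OF C1_gradientD(2)[OF f]])
qed

lemma C1_gradient_snd:
  assumes f: "C1_gradient f \<alpha>"
  shows "C1_gradient (\<lambda>z::'a::euclidean_space \<times> 'b::euclidean_space. f (snd z)) (\<lambda>z. (0, \<alpha> (snd z)))"
  unfolding C1_gradient_def
proof safe
  fix a :: 'a and b :: 'b
  have "(snd has_derivative snd) (at (a, b))"
    by (rule has_derivative_snd[OF has_derivative_ident])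
  from diff_chain_at[OF this C1_gradientD(1)[OF f]]
  show "((\<lambda>z. f (snd z)) has_derivative (\<lambda>h. (0, \<alpha> (snd (a, b))) \<bullet> h)) (at (a, b))"
    by (simp add: o_def inner_prod_def)
  show "continuous_on UNIV (\<lambda>z::'a \<times> 'b. (0::'a, \<alpha> (snd z)))"
    by (auto intro!: continuous_intros continuous_on_compose2[OF C1_gradientD(2)[OF f]])
qed

lemma C1_gradient_fst_inner_snd:
  "C1_gradient (\<lambda>z::'a::euclidean_space \<times> 'a. fst z \<bullet> snd z) (\<lambda>z. (snd z, fst z))"
  unfolding C1_gradient_def
  by (auto intro!: derivative_eq_intros continuous_intros simp: inner_prod_def inner_commute)

locale communication =
  fixes \<phi> :: "real \<Rightarrow> real" and \<phi>m \<phi>M L :: real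
  assumes smooth: "smooth_real \<phi>" and lipschitz: "L-lipschitz_on UNIV \<phi>"
    and \<phi>_even: "\<phi> (- r) = \<phi> r" and \<phi>m_pos: "0 < \<phi>m" and \<phi>_ge: "\<phi>m \<le> \<phi> r" and \<phi>_le: "\<phi> r \<le> \<phi>M"
begin

lemma \<phi>_pos: "0 < \<phi> r"
  using \<phi>m_pos \<phi>_ge[of r] by linarith

lemma \<phi>M_pos: "0 < \<phi>M"
  using \<phi>_pos[of 0] \<phi>_le[of 0] by linarith

lemma \<phi>_has_derivative: "(\<phi> has_real_derivative deriv \<phi> r) (at r)"
proof -
  have "(deriv ^^ 0) \<phi> differentiable at r"
    using smooth unfolding smooth_real_def by blast
  then show ?thesis
    by (simp add: DERIV_deriv_iff_real_differentiable)
qed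

lemma isCont_\<phi>: "isCont \<phi> r"
  using \<phi>_has_derivative DERIV_isCont by blast

lemma isCont_deriv_\<phi>: "isCont (deriv \<phi>) r"
proof -
  have "(deriv ^^ 1) \<phi> differentiable at r"
    using smooth unfolding smooth_real_def by blast
  then show ?thesis
    by (simp add: differentiable_imp_continuous_within)
qed

lemma continuous_on_\<phi>: "continuous_on S \<phi>"
  using isCont_\<phi> by (auto intro: continuous_at_imp_continuous_on)

lemma L_nonneg: "0 \<le> L"
  using lipschitz lipschitz_on_nonneg by blast

lemma \<phi>_lipschitz: "\<bar>\<phi> r - \<phi> s\<bar> \<le> L * \<bar>r - s\<bar>"
  using lipschitz_onD[OF lipschitz, of r s] by (simp add: dist_real_def)

lemma deriv_\<phi>_bound: "\<bar>deriv \<phi> r\<bar> \<le> L"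
proof -
  have "((\<lambda>h. \<bar>(\<phi> (r + h) - \<phi> r) / h\<bar>) \<longlongrightarrow> \<bar>deriv \<phi> r\<bar>) (at 0)"
    using \<phi>_has_derivative[of r] unfolding DERIV_def by (intro tendsto_rabs)
  moreover have "\<forall>\<^sub>F h in at 0. \<bar>(\<phi> (r + h) - \<phi> r) / h\<bar> \<le> L"
  proof (rule eventually_at_filter[THEN iffD2, OF always_eventually], safe)
    fix h :: real assume "h \<noteq> 0"
    then show "\<bar>(\<phi> (r + h) - \<phi> r) / h\<bar> \<le> L"
      using \<phi>_lipschitz[of "r + h" r] by (simp add: divide_le_eq)
  qed
  ultimately show ?thesis
    by (rule tendsto_upperbound) simp
qed

text \<open>\<open>sqrt\<close> is the odd extension on negative numbers, so the integrand is
  continuous on the whole line and the derivative at 0 is two-sided, as the chain rule at y = 0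
  requires. The factor 1/2 cancels the 2 from the gradient of y \<bullet> y, leaving the position
  kernel \<phi>(|y|) y.\<close>

definition \<Psi> :: "real \<Rightarrow> real" where
  "\<Psi> = (SOME F. F 0 = 0 \<and> (\<forall>s. (F has_real_derivative \<phi> (sqrt s) / 2) (at s)))"

lemma \<Psi>: "\<Psi> 0 = 0" "(\<Psi> has_real_derivative \<phi> (sqrt s) / 2) (at s)"
proof -
  have "\<exists>F. \<forall>s. -\<infinity> < ereal s \<longrightarrow> ereal s < \<infinity> \<longrightarrow> (F has_vector_derivative \<phi> (sqrt s) / 2) (at s)"
    by (rule einterval_antiderivative) (auto intro!: continuous_intros isCont_o2[OF _ isCont_\<phi>] isCont_real_sqrt)
  then obtain F where "\<And>s. (F has_real_derivative \<phi> (sqrt s) / 2) (at s)"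
    by (auto simp: has_real_derivative_iff_has_vector_derivative)
  then have "(\<lambda>s. F s - F 0) 0 = 0 \<and> (\<forall>s. ((\<lambda>s. F s - F 0) has_real_derivative \<phi> (sqrt s) / 2) (at s))"
    by (auto intro!: derivative_eq_intros)
  from someI[of "\<lambda>F. F 0 = 0 \<and> (\<forall>s. (F has_real_derivative \<phi> (sqrt s) / 2) (at s))", OF this, folded \<Psi>_def]
  show "\<Psi> 0 = 0" "(\<Psi> has_real_derivative \<phi> (sqrt s) / 2) (at s)" by auto
qed

lemma \<Psi>_bounds:
  assumes "0 \<le> s" shows "0 \<le> \<Psi> s" "\<Psi> s \<le> \<phi>M / 2 * s"
proof -
  have "0 \<le> \<Psi> s \<and> \<Psi> s \<le> \<phi>M / 2 * s"
  proof (cases "s = 0")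
    case False
    then obtain \<xi> where "\<Psi> s - \<Psi> 0 = (s - 0) * (\<phi> (sqrt \<xi>) / 2)"
      using MVT2[of 0 s \<Psi> "\<lambda>s. \<phi> (sqrt s) / 2"] \<Psi>(2) assms by auto
    then have "2 * \<Psi> s = s * \<phi> (sqrt \<xi>)"
      by (simp add: \<Psi>(1))
    moreover have "0 \<le> s * \<phi> (sqrt \<xi>)" "s * \<phi> (sqrt \<xi>) \<le> s * \<phi>M"
      using assms \<phi>_pos[of "sqrt \<xi>"] \<phi>_le[of "sqrt \<xi>"] by (auto intro!: mult_left_mono)
    ultimately show ?thesis by (simp add: mult.commute)
  qed (simp add: \<Psi>)
  then show "0 \<le> \<Psi> s" "\<Psi> s \<le> \<phi>M / 2 * s" by auto
qed

lemma C1_gradient_\<Psi>: "C1_gradient (\<lambda>y::'a::euclidean_space. \<Psi> (y \<bullet> y)) (\<lambda>y. \<phi> (norm y) *\<^sub>R y)"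
proof -
  have "C1_gradient (\<lambda>y::'a. \<Psi> (y \<bullet> y)) (\<lambda>y. (\<phi> (sqrt (y \<bullet> y)) / 2) *\<^sub>R (2 *\<^sub>R y))"
    by (rule C1_gradient_compose[OF C1_gradient_inner_self \<Psi>(2)])
      (auto intro!: continuous_intros continuous_on_compose2[OF continuous_on_\<phi>])
  then show ?thesis
    by (simp add: norm_eq_sqrt_inner)
qed

text \<open>The kink of the norm at the origin is compensated by the factor w \<bullet> y: by the
  Lipschitz bound on \<phi> the remainder (\<phi>(|h|) - \<phi>(0)) (w \<bullet> h) is quadratic in
  h.\<close>

lemma C1_gradient_radial:
  fixes w :: "'a::euclidean_space"
  defines "D \<equiv> \<lambda>y. \<phi> (norm y) *\<^sub>R w + (deriv \<phi> (norm y) * (w \<bullet> y) / norm y) *\<^sub>R y"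
  shows "C1_gradient (\<lambda>y. \<phi> (norm y) * (w \<bullet> y)) D" "norm (D y) \<le> (\<phi>M + L * norm y) * norm w"
proof -
  have tail: "norm ((deriv \<phi> (norm y) * (w \<bullet> y) / norm y) *\<^sub>R y) \<le> L * norm y * norm w" for y
  proof -
    have "norm ((deriv \<phi> (norm y) * (w \<bullet> y) / norm y) *\<^sub>R y) \<le> \<bar>deriv \<phi> (norm y)\<bar> * \<bar>w \<bullet> y\<bar>"
      by (simp add: abs_mult)
    also have "\<dots> \<le> L * (norm w * norm y)"
      by (intro mult_mono deriv_\<phi>_bound Cauchy_Schwarz_ineq2 L_nonneg) auto
    finally show ?thesis by (simp add: algebra_simps)
  qed
  have "norm (D y) \<le> \<phi> (norm y) * norm w + L * norm y * norm w"
    unfolding D_def using \<phi>_pos[of "norm y"] by (intro order_trans[OF norm_triangle_ineq] add_mono tail) simp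
  also have "\<phi> (norm y) * norm w \<le> \<phi>M * norm w"
    by (intro mult_right_mono \<phi>_le) simp
  finally show "norm (D y) \<le> (\<phi>M + L * norm y) * norm w"
    by (simp add: algebra_simps)
  \<comment> \<open>Division by zero yields zero, so the second summand of \<open>D\<close> vanishes
    at the origin and the formula gives the true gradient there.\<close>
  have D0: "D 0 = \<phi> 0 *\<^sub>R w" by (simp add: D_def)
  show "C1_gradient (\<lambda>y. \<phi> (norm y) * (w \<bullet> y)) D"
    unfolding C1_gradient_def
  proof safe
    fix y
    show "((\<lambda>y. \<phi> (norm y) * (w \<bullet> y)) has_derivative (\<lambda>h. D y \<bullet> h)) (at y)"
    proof (cases "y = 0")
      case True
      have "((\<lambda>y. \<phi> (norm y) * (w \<bullet> y)) has_derivative (\<lambda>h. D y \<bullet> h)) (at 0)"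
      proof (rule has_derivative_quadratic_remainder[OF bounded_linear_inner_right, where K = "L * norm w"])
        fix h :: 'a
        have "\<bar>(\<phi> (norm h) - \<phi> 0) * (w \<bullet> h)\<bar> \<le> (L * norm h) * (norm w * norm h)"
          unfolding abs_mult using \<phi>_lipschitz[of "norm h" 0] L_nonneg
          by (intro mult_mono Cauchy_Schwarz_ineq2) auto
        then show "norm (\<phi> (norm (0 + h)) * (w \<bullet> (0 + h)) - \<phi> (norm (0::'a)) * (w \<bullet> 0) - D y \<bullet> h) \<le> L * norm w * (norm h)\<^sup>2"
          by (simp add: True D0 power2_eq_square algebra_simps)
      qed
      then show ?thesis using True by simp
    next
      case False
      have "(\<phi> has_derivative (*) (deriv \<phi> (norm y))) (at (norm y))"
        using \<phi>_has_derivative[of "norm y"] by (simp add: has_field_derivative_def)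
      from diff_chain_at[OF has_derivative_norm[OF False] this]
      have "((\<lambda>y. \<phi> (norm y)) has_derivative (\<lambda>h. deriv \<phi> (norm y) * (h \<bullet> sgn y))) (at y)"
        by (simp add: o_def)
      from has_derivative_mult[OF this C1_gradientD(1)[OF C1_gradient_inner_const]]
      show ?thesis
        by (rule has_derivative_eq_rhs)
          (auto simp: D_def inner_add_left sgn_div_norm inner_commute algebra_simps divide_inverse)
    qed
    show "continuous_on UNIV D"
    proof (rule continuous_at_imp_continuous_on, safe)
      fix y
      show "isCont D y"
      proof (cases "y = 0")
        case True
        have "((\<lambda>y. D y - D 0) \<longlongrightarrow> 0) (at 0)"
        proof (rule Lim_null_comparison[OF always_eventually], safe)
          fix y
          have "norm (D y - D 0) \<le> norm ((\<phi> (norm y) - \<phi> 0) *\<^sub>R w)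
            + norm ((deriv \<phi> (norm y) * (w \<bullet> y) / norm y) *\<^sub>R y)"
            unfolding D0 by (rule order_trans[OF _ norm_triangle_ineq]) (simp add: D_def algebra_simps)
          also have "\<dots> \<le> (L * norm y) * norm w + L * norm y * norm w"
            using \<phi>_lipschitz[of "norm y" 0] unfolding norm_scaleR
            by (intro add_mono mult_right_mono tail[unfolded norm_scaleR]) auto
          finally show "norm (D y - D 0) \<le> 2 * L * norm w * norm y"
            by (simp add: algebra_simps)
          show "((\<lambda>y::'a. 2 * L * norm w * norm y) \<longlongrightarrow> 0) (at 0)"
            by (auto intro!: tendsto_eq_intros)
        qed
        then show ?thesis
          using True by (simp add: isCont_def LIM_zero_iff)
      next
        case False
        then show ?thesis
          unfolding D_def
          by (intro continuous_intros isCont_o2[OF _ isCont_\<phi>] isCont_o2[OF _ isCont_deriv_\<phi>]) auto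
      qed
    qed
  qed
qed

end

section \<open>The Lyapunov function\<close>

context unit_transport
begin

lemma quadratic_kernel:
  assumes t: "t \<in> {0..T}" and f: "continuous_on UNIV f" "\<And>z. \<bar>f z\<bar> \<le> k * (norm z)\<^sup>2"
  shows "integrable (\<mu> t) (\<lambda>y. f (z - y) :: real)" "integrable (\<mu> t) (\<lambda>z. \<integral>y. f (z - y) \<partial>\<mu> t)"
proof -
  have k: "0 \<le> k" if "x \<noteq> (0::'a)" for x
    using f(2)[of x] that by (smt (verit) mult_neg_pos zero_less_norm_iff zero_less_power)
  have le: "norm (f (x - y)) \<le> (4 * k) * ((bracket x * bracket x) * (bracket y * bracket y))" for x y
  proof -
    \<comment> \<open>The sign of k has to be read off at a non-zero vector, since at 0 the bound on
      f does not involve k.\<close>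
    obtain e :: 'a where "e \<in> Basis" using nonempty_Basis by blast
    then have k: "0 \<le> k" by (intro k[of e] nonzero_Basis)
    have "norm (f (x - y)) \<le> k * (norm (x - y))\<^sup>2" using f(2) by simp
    also have "\<dots> \<le> k * (2 * (bracket x * bracket y))\<^sup>2"
      using k by (intro mult_left_mono power_mono norm_diff_le_bracket) auto
    finally show ?thesis by (simp add: power2_eq_square algebra_simps)
  qed
  have "continuous_on UNIV (\<lambda>q. f (fst q - snd q))"
    by (intro continuous_on_compose2[OF f(1)] continuous_intros) auto
  then have m: "(\<lambda>(x, y). f (x - y)) \<in> borel_measurable borel"
    by (intro borel_measurable_continuous_onI) (simp add: case_prod_beta')
  show "integrable (\<mu> t) (\<lambda>y. f (z - y))" "integrable (\<mu> t) (\<lambda>z. \<integral>y. f (z - y) \<partial>\<mu> t)"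
    using integrable_pair(2,4)[OF t t m le] by auto
qed

lemma quadratic_kernel_mono:
  assumes t: "t \<in> {0..T}" and f: "continuous_on UNIV f" "\<And>z. \<bar>f z\<bar> \<le> k * (norm z)\<^sup>2"
    and g: "continuous_on UNIV g" "\<And>z. \<bar>g z\<bar> \<le> k' * (norm z)\<^sup>2" and le: "\<And>z. f z \<le> g z"
  shows "(\<integral>z. \<integral>y. f (z - y) \<partial>\<mu> t \<partial>\<mu> t) \<le> (\<integral>z. \<integral>y. g (z - y) \<partial>\<mu> t \<partial>\<mu> t)"
  by (intro integral_mono quadratic_kernel[OF t f] quadratic_kernel[OF t g] le)

end

locale herding = communication \<phi> \<phi>m \<phi>M L for \<phi> \<phi>m \<phi>M L +
  fixes lw lx lv :: real
  assumes lw_pos: "0 < lw" and lx_pos: "0 < lx" and lv_pos: "0 < lv"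
begin

text \<open>The weight of the cross term of the Lyapunov functional: small enough for the
  functional to be coercive and for the cross term not to spoil the velocity damping.\<close>

definition \<delta> :: real where
  "\<delta> = min (min 1 lw / 2) (lv * \<phi>m / (2 * (1 + (lv * \<phi>M)\<^sup>2 / (2 * lw))))"

definition stiffness :: "real \<Rightarrow> real" where
  "stiffness r = lw + lx * \<phi> r"

definition lyapunov :: "'v::euclidean_space \<times> 'v \<Rightarrow> real" where
  "lyapunov \<zeta> = (lw / 2 * (fst \<zeta> \<bullet> fst \<zeta>) + lx * \<Psi> (fst \<zeta> \<bullet> fst \<zeta>)) + 1 / 2 * (snd \<zeta> \<bullet> snd \<zeta>)
    + \<delta> * (fst \<zeta> \<bullet> snd \<zeta>)"

definition lyapunov_grad :: "'v::euclidean_space \<times> 'v \<Rightarrow> 'v \<times> 'v" where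
  "lyapunov_grad \<zeta> = (stiffness (norm (fst \<zeta>)) *\<^sub>R fst \<zeta> + \<delta> *\<^sub>R snd \<zeta>, snd \<zeta> + \<delta> *\<^sub>R fst \<zeta>)"

text \<open>The integrand of the force as a function of \<zeta> = z - y, where z is the particle
  acted upon; hence the minus sign.\<close>

definition pair_force :: "'v::euclidean_space \<times> 'v \<Rightarrow> 'v" where
  "pair_force \<zeta> = - (stiffness (norm (fst \<zeta>)) *\<^sub>R fst \<zeta> + (lv * \<phi> (norm (fst \<zeta>))) *\<^sub>R snd \<zeta>)"

text \<open>One generous constant for \<open>lyapunov\<close>, its gradient, the derivative of that
  gradient and \<open>pair_force\<close>. The summand with L stems from the derivative of
  \<phi>(|y|) y, the one with lv from the alignment force.\<close>

definition growth :: real where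
  "growth = 1 + 2 * lw + 2 * lx * \<phi>M + lx * L + 2 * \<delta> + lv * \<phi>M"

lemma \<delta>_pos: "0 < \<delta>"
proof -
  have "0 < 1 + (lv * \<phi>M)\<^sup>2 / (2 * lw)"
    using lw_pos by (intro add_pos_nonneg) auto
  then show ?thesis
    unfolding \<delta>_def using lw_pos lv_pos \<phi>m_pos by simp
qed

lemma \<delta>_le: "\<delta> \<le> min 1 lw / 2"
  unfolding \<delta>_def by (rule min.cobounded1)

lemma growth_ge_1: "1 \<le> growth"
  unfolding growth_def using lw_pos lx_pos lv_pos \<phi>M_pos \<delta>_pos L_nonneg by simp

lemma stiffness_bounds: "lw \<le> stiffness r" "stiffness r \<le> lw + lx * \<phi>M"
  using lx_pos \<phi>_pos[of r] \<phi>_le[of r] by (auto simp: stiffness_def)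

lemma norm_sq_prod:
  fixes \<zeta> :: "'v::euclidean_space \<times> 'v"
  shows "(norm \<zeta>)\<^sup>2 = (norm (fst \<zeta>))\<^sup>2 + (norm (snd \<zeta>))\<^sup>2"
  by (simp add: power2_norm_eq_inner inner_prod_def)

lemma cross_le: "\<bar>fst \<zeta> \<bullet> snd \<zeta>\<bar> \<le> ((norm (fst \<zeta>))\<^sup>2 + (norm (snd \<zeta>))\<^sup>2) / 2"
proof -
  have "\<bar>fst \<zeta> \<bullet> snd \<zeta>\<bar> \<le> norm (fst \<zeta>) * norm (snd \<zeta>)" by (rule Cauchy_Schwarz_ineq2)
  also have "\<dots> \<le> ((norm (fst \<zeta>))\<^sup>2 + (norm (snd \<zeta>))\<^sup>2) / 2"
    using sum_squares_bound[of "norm (fst \<zeta>)" "norm (snd \<zeta>)"] by simp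
  finally show ?thesis .
qed

text \<open>With m = min 1 lw the squares contribute at least m/2 (|y|^2 + |u|^2), the cross term
  takes away at most m/4 of it by the first bound in \<open>\<delta>\<close>, and the
  \<open>\<Psi>\<close> term is nonnegative.\<close>

lemma lyapunov_lower: "min 1 lw / 4 * (norm \<zeta>)\<^sup>2 \<le> lyapunov \<zeta>"
proof -
  define Y U where "Y = (norm (fst \<zeta>))\<^sup>2" and "U = (norm (snd \<zeta>))\<^sup>2"
  have nn: "0 \<le> Y" "0 \<le> U" by (auto simp: Y_def U_def)
  have "\<delta> * \<bar>fst \<zeta> \<bullet> snd \<zeta>\<bar> \<le> (min 1 lw / 2) * ((Y + U) / 2)"
    unfolding Y_def U_def using lw_pos by (intro mult_mono \<delta>_le cross_le) auto
  moreover have "- (\<delta> * \<bar>fst \<zeta> \<bullet> snd \<zeta>\<bar>) \<le> \<delta> * (fst \<zeta> \<bullet> snd \<zeta>)"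
    using \<delta>_pos mult_left_mono[of "- \<bar>fst \<zeta> \<bullet> snd \<zeta>\<bar>" "fst \<zeta> \<bullet> snd \<zeta>" \<delta>] by simp
  moreover have "0 \<le> lx * \<Psi> (fst \<zeta> \<bullet> fst \<zeta>)"
    using lx_pos \<Psi>_bounds(1)[of "fst \<zeta> \<bullet> fst \<zeta>"] by simp
  moreover have "min 1 lw * Y \<le> lw * Y" "min 1 lw * U \<le> 1 * U"
    using nn by (intro mult_right_mono; simp)+
  ultimately have "min 1 lw / 4 * (Y + U) \<le> (lw / 2 * Y + lx * \<Psi> (fst \<zeta> \<bullet> fst \<zeta>)) + 1 / 2 * U + \<delta> * (fst \<zeta> \<bullet> snd \<zeta>)"
    by (simp add: algebra_simps)
  then show ?thesis
    by (simp add: lyapunov_def norm_sq_prod Y_def U_def power2_norm_eq_inner)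
qed

lemma lyapunov_nonneg: "0 \<le> lyapunov \<zeta>"
  using lyapunov_lower[of \<zeta>] lw_pos by (smt (verit) divide_nonneg_pos min_def mult_nonneg_nonneg zero_le_power2)

lemma lyapunov_upper: "\<bar>lyapunov \<zeta>\<bar> \<le> growth * (norm \<zeta>)\<^sup>2"
proof -
  define Y U where "Y = (norm (fst \<zeta>))\<^sup>2" and "U = (norm (snd \<zeta>))\<^sup>2"
  have nn: "0 \<le> Y" "0 \<le> U" by (auto simp: Y_def U_def)
  have "\<delta> * (fst \<zeta> \<bullet> snd \<zeta>) \<le> \<delta> * ((Y + U) / 2)"
    using cross_le[of \<zeta>] \<delta>_pos by (intro mult_left_mono) (auto simp: Y_def U_def)
  moreover have "lx * \<Psi> (fst \<zeta> \<bullet> fst \<zeta>) \<le> lx * (\<phi>M / 2 * Y)"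
    using lx_pos \<Psi>_bounds(2)[of "fst \<zeta> \<bullet> fst \<zeta>"] by (intro mult_left_mono) (auto simp: Y_def power2_norm_eq_inner)
  ultimately have "lyapunov \<zeta> \<le> (lw / 2 * Y + lx * (\<phi>M / 2 * Y)) + 1 / 2 * U + \<delta> * ((Y + U) / 2)"
    by (simp add: lyapunov_def Y_def U_def power2_norm_eq_inner)
  also have "\<dots> \<le> growth * (Y + U)"
  proof -
    have "(lw / 2 * Y + lx * (\<phi>M / 2 * Y)) + 1 / 2 * U + \<delta> * ((Y + U) / 2)
        = (lw / 2 + lx * \<phi>M / 2 + \<delta> / 2) * Y + (1 / 2 + \<delta> / 2) * U"
      by (simp add: field_simps)
    also have "\<dots> \<le> growth * Y + growth * U"
    proof -
      have "0 \<le> lx * \<phi>M" "0 \<le> lx * L" "0 \<le> lv * \<phi>M"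
        using lx_pos lv_pos \<phi>M_pos L_nonneg by simp_all
      then have "lw / 2 + lx * \<phi>M / 2 + \<delta> / 2 \<le> growth" "1 / 2 + \<delta> / 2 \<le> growth"
        using lw_pos \<delta>_pos by (simp_all add: growth_def)
      then show ?thesis using nn by (intro add_mono mult_right_mono)
    qed
    finally show ?thesis by (simp add: distrib_left)
  qed
  finally show ?thesis
    using lyapunov_nonneg[of \<zeta>] by (simp add: norm_sq_prod Y_def U_def)
qed

lemma norm_lyapunov_grad: "norm (lyapunov_grad \<zeta>) \<le> growth * norm \<zeta>"
proof -
  define N where "N = norm \<zeta>"
  have N: "norm (fst \<zeta>) \<le> N" "norm (snd \<zeta>) \<le> N" "0 \<le> N"
    using norm_fst_le[of "fst \<zeta>" "snd \<zeta>"] norm_snd_le[of "snd \<zeta>" "fst \<zeta>"] by (auto simp: N_def)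
  have "norm (lyapunov_grad \<zeta>) \<le> norm (stiffness (norm (fst \<zeta>)) *\<^sub>R fst \<zeta> + \<delta> *\<^sub>R snd \<zeta>) + norm (snd \<zeta> + \<delta> *\<^sub>R fst \<zeta>)"
    unfolding lyapunov_grad_def by (rule norm_Pair_le)
  also have "\<dots> \<le> ((lw + lx * \<phi>M) * N + \<delta> * N) + (N + \<delta> * N)"
    using N \<delta>_pos stiffness_bounds[of "norm (fst \<zeta>)"] lw_pos
    by (intro add_mono order_trans[OF norm_triangle_ineq]) (auto intro!: mult_mono)
  also have "\<dots> \<le> growth * N"
  proof -
    have "0 \<le> lw * N" "0 \<le> lx * \<phi>M * N" "0 \<le> lx * L * N" "0 \<le> lv * \<phi>M * N"
      using N lw_pos lx_pos lv_pos \<phi>M_pos L_nonneg by simp_all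
    then show ?thesis by (simp add: growth_def algebra_simps)
  qed
  finally show ?thesis by (simp add: N_def)
qed

lemma C1_gradient_lyapunov: "C1_gradient (lyapunov :: 'v::euclidean_space \<times> 'v \<Rightarrow> real) lyapunov_grad"
proof -
  note f = C1_gradient_fst[OF C1_gradient_add[OF C1_gradient_cmult[OF C1_gradient_inner_self, of "lw / 2"]
        C1_gradient_cmult[OF C1_gradient_\<Psi>, of lx]]]
  note s = C1_gradient_snd[OF C1_gradient_cmult[OF C1_gradient_inner_self, of "1 / 2"]]
  show ?thesis
    using C1_gradient_add[OF C1_gradient_add[OF f s] C1_gradient_cmult[OF C1_gradient_fst_inner_snd, of \<delta>]]
    unfolding lyapunov_def[abs_def] lyapunov_grad_def[abs_def] stiffness_def
    by (simp add: scaleR_add_left algebra_simps)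
qed

text \<open>Paired with w, the gradient is linear in \<zeta> except for the summand containing
  \<phi>(|y|) (w1 \<bullet> y), which is the case of \<open>C1_gradient_radial\<close>.\<close>

lemma lyapunov_grad_C1:
  fixes w :: "'v::euclidean_space \<times> 'v"
  shows "\<exists>D. C1_gradient (\<lambda>\<zeta>. w \<bullet> lyapunov_grad \<zeta>) D \<and> (\<forall>\<zeta>. norm (D \<zeta>) \<le> growth * norm w * (1 + norm \<zeta>))"
proof -
  obtain w1 w2 where w: "w = (w1, w2)" by (cases w)
  define R where "R y = \<phi> (norm y) *\<^sub>R w1 + (deriv \<phi> (norm y) * (w1 \<bullet> y) / norm y) *\<^sub>R y" for y
  have R: "C1_gradient (\<lambda>y. \<phi> (norm y) * (w1 \<bullet> y)) R" "\<And>y. norm (R y) \<le> (\<phi>M + L * norm y) * norm w1"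
    unfolding R_def[abs_def] by (rule C1_gradient_radial)+
  define D where "D \<zeta> = (((lw *\<^sub>R w1 + \<delta> *\<^sub>R w2) + lx *\<^sub>R R (fst \<zeta>), 0) + (0, \<delta> *\<^sub>R w1 + w2))" for \<zeta> :: "'v \<times> 'v"
  note f = C1_gradient_fst[OF C1_gradient_add[OF C1_gradient_inner_const[of "lw *\<^sub>R w1 + \<delta> *\<^sub>R w2"]
        C1_gradient_cmult[OF R(1), of lx]]]
  note s = C1_gradient_snd[OF C1_gradient_inner_const[of "\<delta> *\<^sub>R w1 + w2"]]
  have "w \<bullet> lyapunov_grad \<zeta> = ((lw *\<^sub>R w1 + \<delta> *\<^sub>R w2) \<bullet> fst \<zeta> + lx * (\<phi> (norm (fst \<zeta>)) * (w1 \<bullet> fst \<zeta>)))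
      + (\<delta> *\<^sub>R w1 + w2) \<bullet> snd \<zeta>" for \<zeta> :: "'v \<times> 'v"
    by (simp add: w lyapunov_grad_def stiffness_def inner_add_left inner_add_right algebra_simps)
  then have 1: "C1_gradient (\<lambda>\<zeta>. w \<bullet> lyapunov_grad \<zeta>) D"
    using C1_gradient_add[OF f s] unfolding D_def[abs_def] by simp
  have "norm (D \<zeta>) \<le> growth * norm w * (1 + norm \<zeta>)" for \<zeta>
  proof -
    define N W where "N = norm \<zeta>" and "W = norm w"
    have N: "norm (fst \<zeta>) \<le> N" "0 \<le> N"
      using norm_fst_le[of "fst \<zeta>" "snd \<zeta>"] by (auto simp: N_def)
    have W: "norm w1 \<le> W" "norm w2 \<le> W" "0 \<le> W"
      using norm_fst_le[of w1 w2] norm_snd_le[of w2 w1] by (auto simp: W_def w)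
    have "norm (R (fst \<zeta>)) \<le> (\<phi>M + L * N) * W"
      using R(2)[of "fst \<zeta>"] N W L_nonneg \<phi>M_pos
      by (elim order_trans) (intro mult_mono add_mono, auto)
    then have "norm (lx *\<^sub>R R (fst \<zeta>)) \<le> lx * ((\<phi>M + L * N) * W)"
      using lx_pos by simp
    moreover have "norm (lw *\<^sub>R w1 + \<delta> *\<^sub>R w2) \<le> lw * W + \<delta> * W"
      using W lw_pos \<delta>_pos by (intro order_trans[OF norm_triangle_ineq] add_mono) auto
    ultimately have 1: "norm ((lw *\<^sub>R w1 + \<delta> *\<^sub>R w2) + lx *\<^sub>R R (fst \<zeta>)) \<le> lw * W + \<delta> * W + lx * ((\<phi>M + L * N) * W)"
      by (intro norm_triangle_le) linarith
    have 2: "norm (\<delta> *\<^sub>R w1 + w2) \<le> \<delta> * W + W"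
      using W \<delta>_pos by (intro order_trans[OF norm_triangle_ineq] add_mono) auto
    have "norm (D \<zeta>) \<le> norm ((lw *\<^sub>R w1 + \<delta> *\<^sub>R w2) + lx *\<^sub>R R (fst \<zeta>)) + norm (\<delta> *\<^sub>R w1 + w2)"
      unfolding D_def by (simp add: norm_Pair_le)
    also have "\<dots> \<le> (lw * W + \<delta> * W + lx * ((\<phi>M + L * N) * W)) + (\<delta> * W + W)"
      using 1 2 by (rule add_mono)
    also have "\<dots> \<le> growth * W * (1 + N)"
    proof -
      have "0 \<le> lw * W" "0 \<le> lx * \<phi>M * W" "0 \<le> lx * L * W" "0 \<le> lv * \<phi>M * W"
        "0 \<le> lw * W * N" "0 \<le> lx * \<phi>M * W * N" "0 \<le> lx * L * W * N" "0 \<le> lv * \<phi>M * W * N" "0 \<le> \<delta> * W * N" "0 \<le> W * N"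
        using N W lw_pos lx_pos lv_pos \<phi>M_pos L_nonneg \<delta>_pos by simp_all
      then show ?thesis using W N by (simp add: growth_def algebra_simps)
    qed
    finally show ?thesis by (simp add: N_def W_def)
  qed
  then show ?thesis using 1 by blast
qed

lemma interaction_energy_lyapunov:
  "interaction_energy (lyapunov :: 'v::euclidean_space \<times> 'v \<Rightarrow> real) lyapunov_grad growth"
proof
  show "lyapunov (- \<zeta>) = lyapunov \<zeta>" for \<zeta> :: "'v \<times> 'v"
    by (simp add: lyapunov_def)
  show "0 \<le> growth" using growth_ge_1 by simp
qed (rule C1_gradient_lyapunov lyapunov_upper norm_lyapunov_grad lyapunov_grad_C1)+

text \<open>The minimum is the coefficient of |y|^2 + |u|^2 left in the dissipation after half of
  each good term is spent; dividing by \<open>growth\<close> converts that quadratic form into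
  \<open>lyapunov\<close>.\<close>

definition decay :: real where
  "decay = min (lv * \<phi>m / 2) (\<delta> * lw / 2) / growth"

lemma decay_pos: "0 < decay"
  using lv_pos \<phi>m_pos \<delta>_pos lw_pos growth_ge_1 by (simp add: decay_def)

text \<open>The left side is the production of one pair after symmetrisation. Writing \<kappa> for
  the stiffness and f = lv \<phi>(|y|), the two terms \<kappa> (y \<bullet> u) cancel, which is the
  gain from the potential. What remains is \<delta> |u|^2 - f |u|^2 - \<delta> \<kappa> |y|^2 -
  \<delta> f (y \<bullet> u).\<close>

lemma dissipation:
  "(snd \<zeta>, snd \<zeta> + \<delta> *\<^sub>R fst \<zeta>) \<bullet> (fst (lyapunov_grad \<zeta>), pair_force \<zeta>) \<le> - decay * lyapunov \<zeta>"
proof -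
  define y u where "y = fst \<zeta>" and "u = snd \<zeta>"
  define Y U where "Y = norm y" and "U = norm u"
  define \<kappa> f M where "\<kappa> = stiffness Y" and "f = lv * \<phi> Y" and "M = lv * \<phi>M"
  have nn: "0 \<le> Y" "0 \<le> U" by (auto simp: Y_def U_def)
  have f: "lv * \<phi>m \<le> f" "f \<le> M" "0 \<le> f"
    using lv_pos \<phi>_ge[of Y] \<phi>_le[of Y] \<phi>_pos[of Y] by (auto simp: f_def M_def)
  have "(snd \<zeta>, snd \<zeta> + \<delta> *\<^sub>R fst \<zeta>) \<bullet> (fst (lyapunov_grad \<zeta>), pair_force \<zeta>)
    = \<delta> * (u \<bullet> u) - f * (u \<bullet> u) - \<delta> * \<kappa> * (y \<bullet> y) - \<delta> * f * (y \<bullet> u)"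
    by (simp add: lyapunov_grad_def pair_force_def y_def u_def \<kappa>_def f_def Y_def inner_add_left inner_add_right
        inner_diff_left inner_diff_right inner_commute algebra_simps)
  also have "\<dots> = \<delta> * U\<^sup>2 - f * U\<^sup>2 - \<delta> * \<kappa> * Y\<^sup>2 - \<delta> * f * (y \<bullet> u)"
    by (simp add: Y_def U_def power2_norm_eq_inner)
  also have "\<dots> \<le> \<delta> * U\<^sup>2 - lv * \<phi>m * U\<^sup>2 - \<delta> * lw * Y\<^sup>2 + \<delta> * (M * (Y * U))"
  proof -
    have "lv * \<phi>m * U\<^sup>2 \<le> f * U\<^sup>2" using f by (intro mult_right_mono) auto
    moreover have "\<delta> * lw * Y\<^sup>2 \<le> \<delta> * \<kappa> * Y\<^sup>2"
      using \<delta>_pos stiffness_bounds(1)[of Y] by (intro mult_right_mono mult_left_mono) (auto simp: \<kappa>_def)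
    moreover have "- (f * (y \<bullet> u)) \<le> M * (Y * U)"
    proof -
      have "- (f * (y \<bullet> u)) \<le> f * \<bar>y \<bullet> u\<bar>"
        using f(3) mult_left_mono[of "- (y \<bullet> u)" "\<bar>y \<bullet> u\<bar>" f] by simp
      also have "\<dots> \<le> M * (Y * U)"
        unfolding Y_def U_def using f by (intro mult_mono Cauchy_Schwarz_ineq2) auto
      finally show ?thesis .
    qed
    then have "- (\<delta> * f * (y \<bullet> u)) \<le> \<delta> * (M * (Y * U))"
      using \<delta>_pos mult_left_mono[of "- (f * (y \<bullet> u))" "M * (Y * U)" \<delta>] by simp
    ultimately show ?thesis by linarith
  qed
  \<comment> \<open>Young's inequality, weighted so that the mixed term uses exactly half of the
    position damping \<delta> lw Y^2.\<close>
  also have "M * (Y * U) \<le> lw / 2 * Y\<^sup>2 + M\<^sup>2 / (2 * lw) * U\<^sup>2"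
  proof -
    have "0 \<le> (lw * Y - M * U)\<^sup>2 / (2 * lw)" using lw_pos by simp
    also have "\<dots> = lw / 2 * Y\<^sup>2 + M\<^sup>2 / (2 * lw) * U\<^sup>2 - M * (Y * U)"
      using lw_pos by (simp add: field_simps power2_eq_square)
    finally show ?thesis by simp
  qed
  then have "\<delta> * U\<^sup>2 - lv * \<phi>m * U\<^sup>2 - \<delta> * lw * Y\<^sup>2 + \<delta> * (M * (Y * U))
    \<le> (\<delta> * (1 + M\<^sup>2 / (2 * lw)) - lv * \<phi>m) * U\<^sup>2 - \<delta> * lw / 2 * Y\<^sup>2"
    using mult_left_mono[of "M * (Y * U)" "lw / 2 * Y\<^sup>2 + M\<^sup>2 / (2 * lw) * U\<^sup>2" \<delta>] \<delta>_pos
    by (simp add: algebra_simps)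
  \<comment> \<open>The second bound in \<open>\<delta>\<close> is designed for this: the growth of
    |u|^2 caused by the cross term consumes at most half of the alignment damping.\<close>
  also have "\<dots> \<le> - (lv * \<phi>m / 2) * U\<^sup>2 - \<delta> * lw / 2 * Y\<^sup>2"
  proof -
    have q: "0 < 1 + M\<^sup>2 / (2 * lw)"
      using lw_pos by (intro add_pos_nonneg) auto
    have "\<delta> \<le> lv * \<phi>m / (2 * (1 + M\<^sup>2 / (2 * lw)))"
      by (simp add: \<delta>_def M_def)
    then have "\<delta> * (1 + M\<^sup>2 / (2 * lw)) \<le> lv * \<phi>m / (2 * (1 + M\<^sup>2 / (2 * lw))) * (1 + M\<^sup>2 / (2 * lw))"
      using q by (intro mult_right_mono) auto
    also have "\<dots> = lv * \<phi>m / 2"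
    proof -
      have "x / (2 * Q) * Q = x / 2" if "0 < Q" for x Q :: real
        using that by simp
      then show ?thesis using q .
    qed
    finally show ?thesis by (intro diff_right_mono mult_right_mono) auto
  qed
  also have "\<dots> \<le> - (decay * growth) * (Y\<^sup>2 + U\<^sup>2)"
  proof -
    have "decay * growth \<le> lv * \<phi>m / 2" "decay * growth \<le> \<delta> * lw / 2"
      using growth_ge_1 by (auto simp: decay_def)
    then have "decay * growth * U\<^sup>2 \<le> lv * \<phi>m / 2 * U\<^sup>2" "decay * growth * Y\<^sup>2 \<le> \<delta> * lw / 2 * Y\<^sup>2"
      by (intro mult_right_mono; simp)+
    then show ?thesis by (simp add: algebra_simps)
  qed
  also have "\<dots> \<le> - decay * lyapunov \<zeta>"
  proof -
    have "lyapunov \<zeta> \<le> growth * (Y\<^sup>2 + U\<^sup>2)"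
      using lyapunov_upper[of \<zeta>] by (simp add: norm_sq_prod Y_def U_def y_def u_def)
    then have "decay * lyapunov \<zeta> \<le> decay * (growth * (Y\<^sup>2 + U\<^sup>2))"
      using decay_pos by (intro mult_left_mono) auto
    then show ?thesis by simp
  qed
  finally show ?thesis by simp
qed

lemma continuous_on_stiffness: "continuous_on S f \<Longrightarrow> continuous_on S (\<lambda>x. stiffness (f x))"
  unfolding stiffness_def by (intro continuous_intros continuous_on_compose2[OF continuous_on_\<phi>]) auto

lemma continuous_on_pair_force: "continuous_on S pair_force"
  unfolding pair_force_def[abs_def]
  by (intro continuous_intros continuous_on_stiffness continuous_on_compose2[OF continuous_on_\<phi>]) auto

lemma norm_pair_force: "norm (pair_force \<zeta>) \<le> growth * norm \<zeta>"
proof -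
  define N where "N = norm \<zeta>"
  have N: "norm (fst \<zeta>) \<le> N" "norm (snd \<zeta>) \<le> N" "0 \<le> N"
    using norm_fst_le[of "fst \<zeta>" "snd \<zeta>"] norm_snd_le[of "snd \<zeta>" "fst \<zeta>"] by (auto simp: N_def)
  have "norm (pair_force \<zeta>) \<le> (lw + lx * \<phi>M) * N + (lv * \<phi>M) * N"
    unfolding pair_force_def norm_minus_cancel
    using N stiffness_bounds[of "norm (fst \<zeta>)"] lw_pos lv_pos \<phi>_le[of "norm (fst \<zeta>)"] \<phi>_pos[of "norm (fst \<zeta>)"]
    by (intro order_trans[OF norm_triangle_ineq] add_mono) (auto simp: abs_mult intro!: mult_mono)
  also have "\<dots> \<le> growth * N"
  proof -
    have "0 \<le> lw * N" "0 \<le> lx * \<phi>M * N" "0 \<le> lx * L * N" "0 \<le> \<delta> * N"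
      using N lw_pos lx_pos \<phi>M_pos L_nonneg \<delta>_pos by simp_all
    then show ?thesis using N by (simp add: growth_def algebra_simps)
  qed
  finally show ?thesis by (simp add: N_def)
qed

end

section \<open>Herding\<close>

locale herding_transport = herding \<phi> \<phi>m \<phi>M L lw lx lv + unit_transport \<mu> b T C
  for \<phi> :: "real \<Rightarrow> real" and \<phi>m \<phi>M L lw lx lv :: real
    and \<mu> :: "real \<Rightarrow> ('v::euclidean_space \<times> 'v) measure" and b T C +
  assumes b_eq: "t \<in> {0..T} \<Longrightarrow> b t z = (snd z, \<integral>y. pair_force (z - y) \<partial>\<mu> t)"
begin

sublocale energy_transport \<mu> b T C lyapunov lyapunov_grad growth
  by (intro energy_transport.intro unit_transport_axioms interaction_energy_lyapunov)

lemma energy_dissipation: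
  assumes t: "t \<in> {0..T}"
  shows "2 * (\<integral>z. b t z \<bullet> potential_grad t z \<partial>\<mu> t) \<le> - decay * energy t"
proof -
  \<comment> \<open>The field has one local component (velocity) and one integral component (force),
    while the second component of the potential gradient has an affine kernel and the first does
    not. Crossing the components gathers the genuine integrals in \<open>\<Theta>\<close> and the
    affine expressions in \<open>p\<close>, the shape that \<open>odd_kernel_symmetrize\<close>
    needs.\<close>
  define \<Theta> where "\<Theta> \<zeta> = (fst (lyapunov_grad \<zeta>), pair_force \<zeta>)" for \<zeta> :: "'v \<times> 'v"
  define p where "p z = (snd z, snd (potential_grad t z))" for z
  define m where "m = (\<integral>z. z \<partial>\<mu> t)"
  define \<rho> where "\<rho> \<zeta> = (snd \<zeta>, snd \<zeta> + \<delta> *\<^sub>R fst \<zeta>)" for \<zeta> :: "'v \<times> 'v"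
  have cont_\<Theta>: "continuous_on S \<Theta>" for S
    unfolding \<Theta>_def[abs_def] lyapunov_grad_def fst_conv
    by (intro continuous_intros continuous_on_stiffness continuous_on_pair_force)
  have norm_\<Theta>: "norm (\<Theta> \<zeta>) \<le> (2 * growth) * norm \<zeta>" for \<zeta>
  proof -
    have "norm (\<Theta> \<zeta>) \<le> norm (fst (lyapunov_grad \<zeta>)) + norm (pair_force \<zeta>)"
      unfolding \<Theta>_def by (rule norm_Pair_le)
    also have "norm (fst (lyapunov_grad \<zeta>)) \<le> norm (lyapunov_grad \<zeta>)"
      by (metis norm_fst_le prod.collapse)
    finally show ?thesis
      using norm_lyapunov_grad[of \<zeta>] norm_pair_force[of \<zeta>] by linarith
  qed
  have i\<Theta>: "integrable (\<mu> t) (\<lambda>y. \<Theta> (z - y))" for z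
  proof (rule integrable_bound[OF t])
    show "integrable (\<mu> t) (\<lambda>y. (2 * growth) * (2 * (bracket z * bracket y)))"
      by (intro integrable_mult_right integrable_bracket[OF t])
    show "(\<lambda>y. \<Theta> (z - y)) \<in> borel_measurable borel"
      by (intro borel_measurable_continuous_onI continuous_on_compose2[OF cont_\<Theta>] continuous_intros) auto
    show "norm (\<Theta> (z - y)) \<le> (2 * growth) * (2 * (bracket z * bracket y))" for y
      using growth_ge_1 by (intro order_trans[OF norm_\<Theta>] mult_left_mono norm_diff_le_bracket) auto
  qed
  have flux: "b t z \<bullet> potential_grad t z = p z \<bullet> (\<integral>y. \<Theta> (z - y) \<partial>\<mu> t)" for z
  proof -
    have "fst (\<integral>y. \<Theta> (z - y) \<partial>\<mu> t) = (\<integral>y. fst (lyapunov_grad (z - y)) \<partial>\<mu> t)"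
      using integral_bounded_linear[OF bounded_linear_fst i\<Theta>[of z]] by (simp add: \<Theta>_def)
    also have "\<dots> = fst (potential_grad t z)"
      unfolding potential_grad_def by (rule integral_bounded_linear[OF bounded_linear_fst A_integrable[OF t]])
    finally have 1: "fst (\<integral>y. \<Theta> (z - y) \<partial>\<mu> t) = fst (potential_grad t z)" .
    have 2: "snd (\<integral>y. \<Theta> (z - y) \<partial>\<mu> t) = (\<integral>y. pair_force (z - y) \<partial>\<mu> t)"
      using integral_bounded_linear[OF bounded_linear_snd i\<Theta>[of z]] by (simp add: \<Theta>_def)
    show ?thesis
      by (simp add: b_eq[OF t] p_def inner_prod_def 1 2 inner_commute)
  qed
  \<comment> \<open>The kernel u + \<delta> y is linear, so for a unit mass integration evaluates it
    at z - m. In \<open>p z - p y\<close> the mean m then cancels.\<close>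
  have snd_grad: "snd (potential_grad t z) = snd (\<rho> (z - m))" for z
  proof -
    have bl: "bounded_linear (\<lambda>\<zeta>::'v \<times> 'v. snd \<zeta> + \<delta> *\<^sub>R fst \<zeta>)"
      by (intro bounded_linear_add bounded_linear_snd bounded_linear_scaleR_right[THEN bounded_linear_compose]
          bounded_linear_fst)
    have i: "integrable (\<mu> t) (\<lambda>y. z - y)"
      by (intro Bochner_Integration.integrable_diff integrable_const[OF t] integrable_id[OF t])
    have "snd (potential_grad t z) = (\<integral>y. snd (lyapunov_grad (z - y)) \<partial>\<mu> t)"
      unfolding potential_grad_def by (rule integral_bounded_linear[OF bounded_linear_snd A_integrable[OF t], symmetric])
    also have "\<dots> = (\<integral>y. snd (z - y) + \<delta> *\<^sub>R fst (z - y) \<partial>\<mu> t)"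
      by (simp only: lyapunov_grad_def snd_conv)
    also have "\<dots> = snd (\<integral>y. z - y \<partial>\<mu> t) + \<delta> *\<^sub>R fst (\<integral>y. z - y \<partial>\<mu> t)"
      by (rule integral_bounded_linear[OF bl i])
    also have "(\<integral>y. z - y \<partial>\<mu> t) = z - m"
      using mass_1[OF t] space_\<mu>[OF t]
      by (simp add: m_def integrable_const[OF t] integrable_id[OF t])
    finally show ?thesis by (simp add: \<rho>_def)
  qed
  have p_diff: "p z - p y = \<rho> (z - y)" for z y
    by (simp add: p_def snd_grad \<rho>_def algebra_simps)
  define k where "k = 1 + 2 * growth * bound + 2 * growth"
  have k: "1 + 2 * growth * bound \<le> k" "2 * growth \<le> k"
    using growth_ge_1 bound(1) by (auto simp: k_def)
  have sym: "2 * (\<integral>z. p z \<bullet> (\<integral>y. \<Theta> (z - y) \<partial>\<mu> t) \<partial>\<mu> t)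
      = (\<integral>z. \<integral>y. (p z - p y) \<bullet> \<Theta> (z - y) \<partial>\<mu> t \<partial>\<mu> t)"
  proof (rule odd_kernel_symmetrize[OF t _ _ cont_\<Theta>, of p k])
    show "continuous_on UNIV p"
      unfolding p_def[abs_def]
      by (intro continuous_intros C1_gradientD(2)[OF C1_gradient_potential[OF t]])
    show "norm (p z) \<le> k * bracket z" for z
    proof -
      have "norm (p z) \<le> norm (snd z) + norm (snd (potential_grad t z))"
        unfolding p_def by (rule norm_Pair_le)
      also have "\<dots> \<le> norm z + norm (potential_grad t z)"
        by (intro add_mono) (metis norm_snd_le prod.collapse)+
      also have "\<dots> \<le> (1 + 2 * growth * bound) * bracket z"
        using norm_le_bracket[of z] potential_grad_le[OF t, of z] by (simp add: algebra_simps)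
      also have "\<dots> \<le> k * bracket z"
        by (intro mult_right_mono k) simp
      finally show ?thesis .
    qed
    show "\<Theta> (- \<zeta>) = - \<Theta> \<zeta>" for \<zeta>
      by (simp add: \<Theta>_def lyapunov_grad_def pair_force_def)
    show "norm (\<Theta> \<zeta>) \<le> k * norm \<zeta>" for \<zeta>
      by (rule order_trans[OF norm_\<Theta>]) (intro mult_right_mono k norm_ge_zero)
  qed
  have "(\<integral>z. \<integral>y. \<rho> (z - y) \<bullet> \<Theta> (z - y) \<partial>\<mu> t \<partial>\<mu> t) \<le> (\<integral>z. \<integral>y. - decay * lyapunov (z - y) \<partial>\<mu> t \<partial>\<mu> t)"
  proof (rule quadratic_kernel_mono[OF t])
    show "continuous_on UNIV (\<lambda>\<zeta>. \<rho> \<zeta> \<bullet> \<Theta> \<zeta>)"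
      unfolding \<rho>_def by (intro continuous_intros cont_\<Theta>)
    show "\<bar>\<rho> \<zeta> \<bullet> \<Theta> \<zeta>\<bar> \<le> ((2 + \<delta>) * (2 * growth)) * (norm \<zeta>)\<^sup>2" for \<zeta>
    proof -
      have n: "norm (fst \<zeta>) \<le> norm \<zeta>" "norm (snd \<zeta>) \<le> norm \<zeta>"
        by (metis norm_fst_le prod.collapse) (metis norm_snd_le prod.collapse)
      have "norm (\<rho> \<zeta>) \<le> norm (snd \<zeta>) + norm (snd \<zeta> + \<delta> *\<^sub>R fst \<zeta>)"
        unfolding \<rho>_def by (rule norm_Pair_le)
      also have "norm (snd \<zeta> + \<delta> *\<^sub>R fst \<zeta>) \<le> norm (snd \<zeta>) + \<delta> * norm (fst \<zeta>)"
        using norm_triangle_ineq[of "snd \<zeta>" "\<delta> *\<^sub>R fst \<zeta>"] \<delta>_pos by simp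
      finally have "norm (\<rho> \<zeta>) \<le> (2 + \<delta>) * norm \<zeta>"
        using n mult_left_mono[OF n(1) less_imp_le[OF \<delta>_pos]] by (simp add: algebra_simps)
      then have "norm (\<rho> \<zeta>) * norm (\<Theta> \<zeta>) \<le> ((2 + \<delta>) * norm \<zeta>) * ((2 * growth) * norm \<zeta>)"
        using \<delta>_pos by (intro mult_mono norm_\<Theta>) auto
      then show ?thesis
        using Cauchy_Schwarz_ineq2[of "\<rho> \<zeta>" "\<Theta> \<zeta>"] by (simp add: power2_eq_square algebra_simps)
    qed
    show "continuous_on UNIV (\<lambda>\<zeta>. - decay * lyapunov (\<zeta> :: 'v \<times> 'v))"
      by (intro continuous_intros C1_gradientD(3)[OF C1_gradient_lyapunov])
    show "\<bar>- decay * lyapunov \<zeta>\<bar> \<le> (decay * growth) * (norm \<zeta>)\<^sup>2" for \<zeta> :: "'v \<times> 'v"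
      using mult_left_mono[OF lyapunov_upper[of \<zeta>], of decay] decay_pos by (simp add: abs_mult mult.assoc)
    show "\<rho> \<zeta> \<bullet> \<Theta> \<zeta> \<le> - decay * lyapunov \<zeta>" for \<zeta>
      unfolding \<rho>_def \<Theta>_def by (rule dissipation)
  qed
  also have "\<dots> = - decay * energy t"
    by (simp add: energy_def potential_def)
  finally show ?thesis
    unfolding flux sym p_diff .
qed

text \<open>The coercivity constant min 1 lw / 4 and the factor 2 of \<open>variance\<close> combine
  to 2 / min 1 lw. The right side depends on T only through the exponential: the moment bounds on
  {0..T}, which may deteriorate with T, do not appear in it.\<close>

lemma variance_decay:
  "(\<integral>z. (norm (z - (\<integral>y. y \<partial>\<mu> T)))\<^sup>2 \<partial>\<mu> T)
    \<le> 2 / min 1 lw * (\<integral>z. \<integral>y. lyapunov (z - y) \<partial>\<mu> 0 \<partial>\<mu> 0) * exp (- decay * T)"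
proof -
  have T: "T \<in> {0..T}" using T_nonneg by simp
  have c: "0 < min 1 lw" using lw_pos by simp
  define W where "W = (\<integral>z. (norm (z - (\<integral>y. y \<partial>\<mu> T)))\<^sup>2 \<partial>\<mu> T)"
  have nonneg: "0 \<le> energy t" for t
    unfolding energy_def potential_def by (intro Bochner_Integration.integral_nonneg lyapunov_nonneg)
  have "min 1 lw / 2 * W = (\<integral>z. \<integral>y. min 1 lw / 4 * (norm (z - y))\<^sup>2 \<partial>\<mu> T \<partial>\<mu> T)"
    using variance(2)[OF T] by (simp add: W_def)
  also have "\<dots> \<le> (\<integral>z. \<integral>y. lyapunov (z - y) \<partial>\<mu> T \<partial>\<mu> T)"
  proof (rule quadratic_kernel_mono[OF T])
    show "continuous_on UNIV (\<lambda>\<zeta> :: 'v \<times> 'v. min 1 lw / 4 * (norm \<zeta>)\<^sup>2)"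
      by (intro continuous_intros)
    show "\<bar>min 1 lw / 4 * (norm \<zeta>)\<^sup>2\<bar> \<le> min 1 lw / 4 * (norm \<zeta>)\<^sup>2" for \<zeta> :: "'v \<times> 'v"
      using c by (simp add: abs_mult)
  qed (rule C1_gradientD(3)[OF C1_gradient_lyapunov] lyapunov_upper lyapunov_lower)+
  also have "\<dots> = energy T"
    by (simp add: energy_def potential_def)
  also have "\<dots> \<le> exp (- decay * T) * energy 0"
    using energy_decay[of decay] nonneg energy_dissipation decay_pos by simp
  finally have "2 / min 1 lw * (min 1 lw / 2 * W) \<le> 2 / min 1 lw * (exp (- decay * T) * energy 0)"
    using c by (intro mult_left_mono) auto
  then show ?thesis
    using c by (simp add: W_def energy_def potential_def mult_ac)
qed

end

section \<open>From measure-valued solutions to the transport setting\<close>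

text \<open>By continuity a violation at t persists on an interval to the right of t, which has
  positive Lebesgue measure and stays in the domain even for t = 0.\<close>

lemma AE_le_imp_le_continuous:
  fixes u :: "real \<Rightarrow> real"
  assumes ae: "AE t in lborel. t \<in> {0..<T} \<longrightarrow> u t \<le> C" and u: "continuous_on {0..<T} u" and t: "t \<in> {0..<T}"
  shows "u t \<le> C"
proof (rule ccontr)
  assume "\<not> u t \<le> C"
  then have "0 < u t - C" by simp
  then obtain d where d: "0 < d" "\<And>s. s \<in> {0..<T} \<Longrightarrow> dist s t < d \<Longrightarrow> dist (u s) (u t) < u t - C"
    using u t unfolding continuous_on_iff by metis
  define e where "e = min (t + d) T"
  have e: "t < e" using d t by (auto simp: e_def)
  have lt: "C < u s" if "s \<in> {t<..<e}" for s
    using d(2)[of s] that t by (auto simp: e_def dist_real_def)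
  have "AE s in lborel. s \<notin> {t<..<e}"
    using ae
  proof eventually_elim
    case (elim s)
    then show ?case using lt[of s] t by (auto simp: e_def)
  qed
  then have "{t<..<e} \<in> null_sets lborel"
    by (subst (asm) AE_iff_null_sets[symmetric]) auto
  then show False
    using e by (simp add: null_sets_def)
qed

context herding
begin

lemma herding_force_eq:
  fixes M :: "((real^'n) \<times> (real^'n)) measure"
  shows "herding_force lw lx lv \<phi> M z = (\<integral>y. pair_force (z - y) \<partial>M)"
  unfolding herding_force_def
  by (cases z) (auto simp: pair_force_def stiffness_def case_prod_beta' algebra_simps intro!: Bochner_Integration.integral_cong)

context
  fixes \<mu>0 :: "((real^'n) \<times> (real^'n)) measure" and \<mu> :: "real \<Rightarrow> ((real^'n) \<times> (real^'n)) measure"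
  assumes solution: "\<And>T. 0 < T \<Longrightarrow> measure_valued_solution lw lx lv \<phi> T \<mu>0 \<mu>"
begin

definition field :: "real \<Rightarrow> (real^'n) \<times> (real^'n) \<Rightarrow> (real^'n) \<times> (real^'n)" where
  "field t z = (snd z, herding_force lw lx lv \<phi> (\<mu> t) z)"

text \<open>Multiplying by a transition in time turns a stationary test function into an admissible one.\<close>

lemma solution_weak:
  assumes g: "C1_gradient g \<gamma>" and K: "compact K" and supp: "\<And>z. z \<notin> K \<Longrightarrow> g z = 0" and t: "0 \<le> t"
  shows "set_integrable lborel {0..t} (\<lambda>r. \<integral>z. field r z \<bullet> \<gamma> z \<partial>\<mu> r)"
    "(\<integral>z. g z \<partial>\<mu> t) - (\<integral>z. g z \<partial>\<mu>0) = (LINT r:{0..t}|lborel. \<integral>z. field r z \<bullet> \<gamma> z \<partial>\<mu> r)"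
proof -
  \<comment> \<open>The factor is 1 up to time t and 0 from t + 1 on. The support in time {0..t + 1}
    is thus compact inside [0, t + 2), and the factor is invisible on {0..t}.\<close>
  let ?\<eta> = "\<lambda>s. transition (s - t)" and ?\<eta>' = "\<lambda>s. transition' (s - t)"
  let ?D = "UNIV \<times> {0..<t + 2} :: (((real^'n) \<times> (real^'n)) \<times> real) set"
  define G where "G p = g (fst p) * ?\<eta> (snd p)" for p
  define Gt where "Gt p = g (fst p) * ?\<eta>' (snd p)" for p
  define Gx where "Gx p = ?\<eta> (snd p) *\<^sub>R fst (\<gamma> (fst p))" for p
  define Gv where "Gv p = ?\<eta> (snd p) *\<^sub>R snd (\<gamma> (fst p))" for p
  have cont_\<eta>: "continuous_on S transition" for S
    by (rule DERIV_continuous_on[OF transition_has_derivative])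
  have "C1_test_function (t + 2) G Gt Gx Gv"
    unfolding C1_test_function_def
  proof (intro conjI ballI)
    fix p :: "((real^'n) \<times> (real^'n)) \<times> real"
    have 1: "((\<lambda>p. g (fst p)) has_derivative (\<lambda>h. \<gamma> (fst p) \<bullet> fst h)) (at p within ?D)"
      by (rule has_derivative_compose[OF has_derivative_fst[OF has_derivative_ident] C1_gradientD(1)[OF g]])
    have "(transition has_derivative (*) (transition' (snd p - t))) (at (snd p - t))"
      using transition_has_derivative[of "snd p - t" UNIV] by (simp add: has_field_derivative_def)
    moreover have "((\<lambda>p. snd p - t) has_derivative (\<lambda>h. snd h)) (at p within ?D)"
      by (auto intro!: derivative_eq_intros)
    ultimately have 2: "((\<lambda>p. ?\<eta> (snd p)) has_derivative (\<lambda>h. ?\<eta>' (snd p) * snd h)) (at p within ?D)"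
      by (rule has_derivative_compose[rotated])
    show "(G has_derivative (\<lambda>((hx, hv), ht). Gx p \<bullet> hx + Gv p \<bullet> hv + Gt p * ht)) (at p within ?D)"
      unfolding G_def[abs_def]
      by (rule has_derivative_eq_rhs[OF has_derivative_mult[OF 1 2]])
        (auto simp: Gx_def Gv_def Gt_def inner_prod_def algebra_simps)
  next
    have cont: "continuous_on ?D (\<lambda>p. g (fst p))" "continuous_on ?D (\<lambda>p. \<gamma> (fst p))"
      "continuous_on ?D (\<lambda>p. ?\<eta> (snd p))" "continuous_on ?D (\<lambda>p. ?\<eta>' (snd p))"
      by (auto intro!: continuous_intros continuous_on_compose2[OF C1_gradientD(3)[OF g]]
          continuous_on_compose2[OF C1_gradientD(2)[OF g]] continuous_on_compose2[OF cont_\<eta>[of UNIV]]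
          continuous_on_compose2[OF continuous_on_transition'[of UNIV]])
    show "continuous_on ?D Gt" "continuous_on ?D Gx" "continuous_on ?D Gv"
      unfolding Gt_def[abs_def] Gx_def[abs_def] Gv_def[abs_def] by (intro continuous_intros cont)+
  next
    show "\<exists>K. compact K \<and> K \<subseteq> ?D \<and> (\<forall>p\<in>?D - K. G p = 0)"
    proof (intro exI conjI ballI)
      show "compact (K \<times> {0..t + 1})"
        by (intro compact_Times K compact_Icc)
      show "K \<times> {0..t + 1} \<subseteq> ?D" by auto
      fix p assume "p \<in> ?D - K \<times> {0..t + 1}"
      then have "fst p \<notin> K \<or> 1 \<le> snd p - t" by (cases p) auto
      then show "G p = 0"
        using supp[of "fst p"] transition_eq_0(1)[of "snd p - t"] by (auto simp: G_def)
    qed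
  qed
  with solution[of "t + 2"] t have *:
    "let h = (\<lambda>s. \<integral>z. Gt (z, s) + snd z \<bullet> Gx (z, s) + herding_force lw lx lv \<phi> (\<mu> s) z \<bullet> Gv (z, s) \<partial>\<mu> s)
     in \<forall>r \<in> {0..<t + 2}. set_integrable lborel {0..r} h
        \<and> (\<integral>z. G (z, r) \<partial>\<mu> r) - (\<integral>z. G (z, 0) \<partial>\<mu>0) = (LINT s:{0..r}|lborel. h s)"
    unfolding measure_valued_solution_def by simp
  define h where "h s = (\<integral>z. Gt (z, s) + snd z \<bullet> Gx (z, s) + herding_force lw lx lv \<phi> (\<mu> s) z \<bullet> Gv (z, s) \<partial>\<mu> s)" for s
  have h: "set_integrable lborel {0..t} h"
    "(\<integral>z. G (z, t) \<partial>\<mu> t) - (\<integral>z. G (z, 0) \<partial>\<mu>0) = (LINT s:{0..t}|lborel. h s)"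
    using * t unfolding Let_def h_def[abs_def] by auto
  have eq: "h s = (\<integral>z. field s z \<bullet> \<gamma> z \<partial>\<mu> s)" if "s \<in> {0..t}" for s
    using that by (simp add: h_def Gt_def Gx_def Gv_def transition_eq_1 transition'_eq_0 field_def inner_prod_def)
  show "set_integrable lborel {0..t} (\<lambda>r. \<integral>z. field r z \<bullet> \<gamma> z \<partial>\<mu> r)"
    using h(1) by (subst set_integrable_cong[OF refl refl eq[symmetric]])
  have "(LINT r:{0..t}|lborel. h r) = (LINT r:{0..t}|lborel. \<integral>z. field r z \<bullet> \<gamma> z \<partial>\<mu> r)"
    by (rule set_lebesgue_integral_cong) (simp_all add: eq)
  then show "(\<integral>z. g z \<partial>\<mu> t) - (\<integral>z. g z \<partial>\<mu>0) = (LINT r:{0..t}|lborel. \<integral>z. field r z \<bullet> \<gamma> z \<partial>\<mu> r)"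
    using h(2) t by (simp add: G_def transition_eq_1)
qed

text \<open>At time 0 the right side is an integral over a single point. The notion of solution does
  not identify \<open>\<mu> 0\<close> with \<open>\<mu>0\<close>; agreement on compactly supported
  C^1 functions is what the weak formulation yields.\<close>

lemma solution_initial:
  assumes "C1_gradient g \<gamma>" "compact K" "\<And>z. z \<notin> K \<Longrightarrow> g z = 0"
  shows "(\<integral>z. g z \<partial>\<mu> 0) = (\<integral>z. g z \<partial>\<mu>0)"
  using solution_weak(2)[OF assms, of 0] set_integral_abs_le_const[OF solution_weak(1)[OF assms, of 0], of "\<bar>\<integral>z. field 0 z \<bullet> \<gamma> z \<partial>\<mu> 0\<bar>"]
  by auto

lemma solution_measure:
  assumes "0 \<le> t"
  shows "sets (\<mu> t) = sets borel" "finite_measure (\<mu> t)" "integrable (\<mu> t) (\<lambda>z. z)"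
  using solution[of "t + 1"] assms unfolding measure_valued_solution_def finite_radon_measure_def by auto

lemma solution_continuous:
  fixes g :: "(real^'n) \<times> (real^'n) \<Rightarrow> real"
  assumes "continuous_on UNIV g" "compact K" "\<And>z. z \<notin> K \<Longrightarrow> g z = 0"
  shows "continuous_on {0..<T} (\<lambda>t. \<integral>z. g z \<partial>\<mu> t)"
proof (cases "0 < T")
  case True
  obtain B where B: "\<And>z. z \<in> K \<Longrightarrow> norm z \<le> B"
    using compact_imp_bounded[OF assms(2)] by (auto simp: bounded_iff)
  have "g z = 0" if "B + 1 \<le> norm z" for z
    using B[of z] that by (intro assms(3)) auto
  then have "\<forall>\<^sub>F z in at_infinity. g z = 0"
    by (auto simp: eventually_at_infinity)
  then have "(g \<longlongrightarrow> 0) at_infinity"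
    by (rule tendsto_eventually)
  then have "C0_function g"
    using assms(1) by (simp add: C0_function_def)
  then show ?thesis
    using solution[OF True] unfolding measure_valued_solution_def by blast
qed simp

text \<open>The essential bound becomes a bound at every time: truncated masses are continuous in
  time, so they obey it everywhere, and Fatou removes the truncation. The total mass itself is not
  yet known to be continuous.\<close>

lemma solution_mass_bounded: "\<exists>m\<ge>0. \<forall>t\<in>{0..T}. measure (\<mu> t) UNIV \<le> m"
proof (cases "0 \<le> T")
  case True
  then obtain m where m: "AE t in lborel. t \<in> {0..<T + 1} \<longrightarrow> measure (\<mu> t) UNIV \<le> m"
    using solution[of "T + 1"] unfolding measure_valued_solution_def by auto
  have "measure (\<mu> t) UNIV \<le> m" if t: "t \<in> {0..T}" for t
  proof -
    let ?c = "\<lambda>k z::(real^'n) \<times> (real^'n). cutoff (real (Suc k)) z"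
    have int_c: "integrable (\<mu> s) (?c k)" if "0 \<le> s" for s k
    proof (rule finite_measure.integrable_const_bound[OF solution_measure(2)[OF that], of _ 1])
      show "?c k \<in> borel_measurable (\<mu> s)"
        using measurable_cong_sets[OF solution_measure(1)[OF that] refl] cutoff_measurable by blast
    qed (simp add: cutoff_bounds del: of_nat_Suc)
    have space: "space (\<mu> s) = UNIV" if "0 \<le> s" for s
      using sets_eq_imp_space_eq[OF solution_measure(1)[OF that]] by simp
    have "(\<integral>z. ?c k z \<partial>\<mu> t) \<le> m" for k
    proof (rule AE_le_imp_le_continuous[where u = "\<lambda>t. \<integral>z. ?c k z \<partial>\<mu> t" and T = "T + 1"])
      show "continuous_on {0..<T + 1} (\<lambda>t. \<integral>z. ?c k z \<partial>\<mu> t)"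
        by (rule solution_continuous[OF C1_gradientD(3)[OF C1_gradient_cutoff] compact_cball[of 0 "2 * real (Suc k)"] cutoff_support])
          (simp_all del: of_nat_Suc)
      show "AE t in lborel. t \<in> {0..<T + 1} \<longrightarrow> (\<integral>z. ?c k z \<partial>\<mu> t) \<le> m"
        using m
      proof eventually_elim
        case (elim s)
        show ?case
        proof
          assume s: "s \<in> {0..<T + 1}"
          have "(\<integral>z. ?c k z \<partial>\<mu> s) \<le> (\<integral>z. 1 \<partial>\<mu> s)"
            using s by (intro integral_mono int_c finite_measure.integrable_const solution_measure cutoff_bounds) auto
          also have "\<dots> = measure (\<mu> s) UNIV"
            using s space by simp
          finally show "(\<integral>z. ?c k z \<partial>\<mu> s) \<le> m"
            using elim s by simp
        qed
      qed
      show "t \<in> {0..<T + 1}" using t by simp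
    qed
    then have "(\<integral>z. 1 \<partial>\<mu> t) \<le> m"
      using t by (intro integral_Fatou(2)[OF int_c cutoff_bounds(1) cutoff_tendsto(1)]) auto
    then show ?thesis
      using t space by simp
  qed
  then show ?thesis
    by (intro exI[of _ "max m 0"]) (auto simp: le_max_iff_disj)
qed auto

text \<open>Both properties pass from \<open>\<mu>0\<close> to \<open>\<mu> 0\<close> through
  cutoffs: the truncated integrals agree, and for \<open>\<mu>0\<close> a cutoff of radius beyond
  the support is 1 almost everywhere.\<close>

lemma solution_initial_moments:
  assumes \<mu>0: "finite_radon_measure \<mu>0" "compactly_supported \<mu>0" "measure \<mu>0 UNIV = 1"
  shows "measure (\<mu> 0) UNIV = 1" "integrable (\<mu> 0) (\<lambda>z. bracket z * bracket z)"
proof -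
  let ?c = "\<lambda>k z::(real^'n) \<times> (real^'n). cutoff (real (Suc k)) z"
  have sets0: "sets \<mu>0 = sets borel" and fin0: "finite_measure \<mu>0"
    using \<mu>0(1) by (auto simp: finite_radon_measure_def)
  have sets: "sets (\<mu> 0) = sets borel" and fin: "finite_measure (\<mu> 0)"
    using solution_measure[of 0] by auto
  have space: "space \<mu>0 = UNIV" "space (\<mu> 0) = UNIV"
    using sets_eq_imp_space_eq[OF sets0] sets_eq_imp_space_eq[OF sets] by simp_all
  obtain K where K: "compact K" "emeasure \<mu>0 (- K) = 0"
    using \<mu>0(2) by (auto simp: compactly_supported_def)
  have ae: "AE z in \<mu>0. z \<in> K"
    by (rule AE_I[of _ _ "- K"]) (use K compact_imp_closed[OF K(1)] in \<open>auto simp: sets0\<close>)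
  obtain B where B: "\<And>z. z \<in> K \<Longrightarrow> norm z \<le> B"
    using compact_imp_bounded[OF K(1)] by (auto simp: bounded_iff)
  define g where "g k z = bracket z * bracket z * ?c k z" for k z
  have meas: "?c k \<in> borel_measurable borel" "g k \<in> borel_measurable borel" for k
    unfolding g_def[abs_def] by measurable
  have meas0: "f \<in> borel_measurable \<mu>0" "f \<in> borel_measurable (\<mu> 0)" if "f \<in> borel_measurable borel"
    for f :: "(real^'n) \<times> (real^'n) \<Rightarrow> real"
    using that measurable_cong_sets[OF sets0 refl] measurable_cong_sets[OF sets refl] by blast+
  have int_c: "integrable (\<mu> 0) (?c k)" for k
    by (rule finite_measure.integrable_const_bound[OF fin, of _ 1])
      (simp_all add: cutoff_bounds meas meas0 del: of_nat_Suc)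
  have supp: "z \<notin> cball 0 (2 * real (Suc k)) \<Longrightarrow> ?c k z = 0" for k z
    by (rule cutoff_support) simp
  have g_bound: "norm (g k z) \<le> (1 + 2 * real (Suc k)) * (1 + 2 * real (Suc k))" for k z
  proof (cases "z \<in> cball 0 (2 * real (Suc k))")
    case True
    then have "bracket z \<le> 1 + 2 * real (Suc k)"
      using bracket_le[of z] by simp
    then have "bracket z * bracket z * ?c k z \<le> (1 + 2 * real (Suc k)) * (1 + 2 * real (Suc k)) * 1"
      by (intro mult_mono cutoff_bounds) auto
    then show ?thesis
      by (simp add: g_def abs_mult cutoff_bounds del: of_nat_Suc)
  next
    case False
    then show ?thesis by (simp add: g_def supp del: of_nat_Suc)
  qed
  have int_g: "integrable (\<mu> 0) (g k)" "integrable \<mu>0 (g k)" for k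
    by (rule finite_measure.integrable_const_bound[OF fin AE_I2[OF g_bound] meas0(2)[OF meas(2)]],
        rule finite_measure.integrable_const_bound[OF fin0 AE_I2[OF g_bound] meas0(1)[OF meas(2)]])
  have c_1: "(\<integral>z. ?c k z \<partial>\<mu> 0) = 1" if k: "B \<le> real (Suc k)" for k
  proof -
    have "(\<integral>z. ?c k z \<partial>\<mu> 0) = (\<integral>z. ?c k z \<partial>\<mu>0)"
      by (rule solution_initial[OF C1_gradient_cutoff compact_cball supp])
    also have "\<dots> = (\<integral>z. 1 \<partial>\<mu>0)"
    proof (rule integral_cong_AE)
      show "AE z in \<mu>0. ?c k z = 1"
        using ae by eventually_elim (use B k in \<open>fastforce intro: cutoff_eq_1(1)\<close>)
    qed (simp_all add: meas meas0 del: of_nat_Suc)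
    finally show ?thesis using \<mu>0(3) space by simp
  qed
  obtain N :: nat where N: "B \<le> real N" using real_arch_simple by blast
  have "(\<lambda>k. \<integral>z. ?c k z \<partial>\<mu> 0) \<longlonglongrightarrow> (\<integral>z. 1 \<partial>\<mu> 0)"
    by (rule integral_dominated_convergence[where w = "\<lambda>z. 1"])
      (auto intro!: cutoff_tendsto(1) meas0 meas finite_measure.integrable_const[OF fin]
        simp: cutoff_bounds simp del: of_nat_Suc)
  moreover have "\<forall>\<^sub>F k in sequentially. (\<integral>z. ?c k z \<partial>\<mu> 0) = 1"
    unfolding eventually_sequentially using N c_1
    by (intro exI[of _ N]) (auto intro!: c_1 simp del: of_nat_Suc elim!: order_trans)
  ultimately have "(\<integral>z. 1 \<partial>\<mu> 0) = (1::real)"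
    by (rule LIMSEQ_unique[OF _ tendsto_eventually])
  then show "measure (\<mu> 0) UNIV = 1" using space by simp
  have lim: "(\<lambda>k. g k z) \<longlonglongrightarrow> bracket z * bracket z" for z
    using tendsto_mult[OF tendsto_const cutoff_tendsto(1)[of z], of "bracket z * bracket z"]
    by (simp add: g_def)
  have "(\<integral>z. g k z \<partial>\<mu> 0) \<le> (1 + B) * (1 + B)" for k
  proof -
    have "(\<integral>z. g k z \<partial>\<mu> 0) = (\<integral>z. g k z \<partial>\<mu>0)"
      unfolding g_def
      by (rule solution_initial[OF C1_gradient_mult[OF C1_gradient_mult[OF C1_gradient_bracket C1_gradient_bracket]
              C1_gradient_cutoff] compact_cball[of 0 "2 * real (Suc k)"]]) (use supp in \<open>simp del: of_nat_Suc\<close>)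
    also have "\<dots> \<le> (\<integral>z. (1 + B) * (1 + B) \<partial>\<mu>0)"
    proof (rule integral_mono_AE[OF int_g(2) finite_measure.integrable_const[OF fin0]])
      show "AE z in \<mu>0. g k z \<le> (1 + B) * (1 + B)"
        using ae
      proof eventually_elim
        case (elim z)
        have z: "bracket z \<le> 1 + B"
          using bracket_le[of z] B[OF elim] by linarith
        then have "bracket z * bracket z * ?c k z \<le> (1 + B) * (1 + B) * 1"
          using order_trans[OF bracket_nonneg z] by (intro mult_mono cutoff_bounds) auto
        then show ?case by (simp add: g_def)
      qed
    qed
    also have "\<dots> = (1 + B) * (1 + B)" using \<mu>0(3) space by simp
    finally show ?thesis .
  qed
  moreover have "0 \<le> g k z" for k z
    by (simp add: g_def cutoff_bounds del: of_nat_Suc)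
  ultimately show "integrable (\<mu> 0) (\<lambda>z. bracket z * bracket z)"
    by (intro integral_Fatou(1)[OF int_g(1) _ lim])
qed

lemma solution_herding_transport:
  assumes \<mu>0: "finite_radon_measure \<mu>0" "compactly_supported \<mu>0" "measure \<mu>0 UNIV = 1" and T: "0 \<le> T"
  shows "\<exists>C. herding_transport \<phi> \<phi>m \<phi>M L lw lx lv \<mu> field T C"
proof -
  obtain m where m: "0 \<le> m" "\<And>t. t \<in> {0..T} \<Longrightarrow> measure (\<mu> t) UNIV \<le> m"
    using solution_mass_bounded by blast
  \<comment> \<open>Large enough for the mass m, for the coefficient 1 + \<open>growth\<close> * m
    of the bracket and for the coefficient \<open>growth\<close> of the moment.\<close>
  define C where "C = 1 + m + growth * (1 + m)"
  have C: "m \<le> C" "1 + growth * m \<le> C" "growth \<le> C"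
    using m(1) growth_ge_1 by (auto simp: C_def algebra_simps)
  have field_eq: "field t z = (snd z, \<integral>y. pair_force (z - y) \<partial>\<mu> t)" for t z
    by (simp add: field_def herding_force_eq)
  have weak: "weak_transport \<mu> field T C"
  proof (rule weak_transport.intro)
    fix t assume t: "t \<in> {0..T}"
    then have t0: "0 \<le> t" by simp
    interpret finite_measure "\<mu> t" by (rule solution_measure(2)[OF t0])
    have space: "space (\<mu> t) = UNIV"
      using sets_eq_imp_space_eq[OF solution_measure(1)[OF t0]] by simp
    show "sets (\<mu> t) = sets borel" "finite_measure (\<mu> t)" "integrable (\<mu> t) (\<lambda>z. z)"
      by (rule solution_measure[OF t0])+
    show "measure (\<mu> t) UNIV \<le> C" using m(2)[OF t] C(1) by linarith
    have to_\<mu>: "f \<in> borel_measurable (\<mu> t)" if "f \<in> borel_measurable borel"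
      for f :: "(real^'n) \<times> (real^'n) \<Rightarrow> 'b::real_normed_vector"
      using that measurable_cong_sets[OF solution_measure(1)[OF t0] refl] by blast
    have sets_pair: "sets (borel \<Otimes>\<^sub>M \<mu> t) = sets (borel :: (((real^'n) \<times> (real^'n)) \<times> ((real^'n) \<times> (real^'n))) measure)"
      using sets_pair_measure_cong[OF refl solution_measure(1)[OF t0], of "borel :: ((real^'n) \<times> (real^'n)) measure"]
      by (simp only: borel_prod)
    have "continuous_on UNIV (\<lambda>q. pair_force (fst q - snd q) :: real^'n)"
      by (intro continuous_on_compose2[OF continuous_on_pair_force[of UNIV]] continuous_intros) auto
    then have "(\<lambda>(z, y). pair_force (z - y) :: real^'n) \<in> borel_measurable borel"
      by (intro borel_measurable_continuous_onI) (simp add: case_prod_beta')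
    then have "(\<lambda>(z, y). pair_force (z - y) :: real^'n) \<in> borel_measurable (borel \<Otimes>\<^sub>M \<mu> t)"
      using measurable_cong_sets[OF sets_pair refl] by blast
    then have "(\<lambda>z. \<integral>y. pair_force (z - y) \<partial>\<mu> t) \<in> borel_measurable borel"
      by (rule borel_measurable_lebesgue_integral)
    then show "field t \<in> borel_measurable borel"
      unfolding field_eq[abs_def] by (intro borel_measurable_Pair borel_measurable_continuous_onI[OF continuous_on_snd[OF continuous_on_id]])
    have int_b: "integrable (\<mu> t) bracket"
    proof (rule Bochner_Integration.integrable_bound)
      show "integrable (\<mu> t) (\<lambda>z. 1 + norm z)"
        using solution_measure(3)[OF t0] by simp
    qed (simp_all add: to_\<mu> bracket_le)
    fix z
    have "norm (\<integral>y. pair_force (z - y) \<partial>\<mu> t) \<le> (\<integral>y. growth * (bracket z + bracket y) \<partial>\<mu> t)"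
    proof (rule Bochner_Integration.integral_norm_bound_integral)
      show i: "integrable (\<mu> t) (\<lambda>y. growth * (bracket z + bracket y))"
        using int_b by simp
      show le: "norm (pair_force (z - y)) \<le> growth * (bracket z + bracket y)" for y
        using growth_ge_1 norm_triangle_ineq4[of z y] norm_le_bracket[of z] norm_le_bracket[of y]
        by (intro order_trans[OF norm_pair_force] mult_left_mono) auto
      have "(\<lambda>y. pair_force (z - y)) \<in> borel_measurable borel"
        by (intro borel_measurable_continuous_onI continuous_on_compose2[OF continuous_on_pair_force[of UNIV]] continuous_intros) auto
      then show "integrable (\<mu> t) (\<lambda>y. pair_force (z - y))"
        using growth_ge_1
        by (intro Bochner_Integration.integrable_bound[OF i]) (auto intro!: AE_I2 to_\<mu> simp: le abs_mult)
    qed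
    also have "\<dots> = growth * (measure (\<mu> t) UNIV * bracket z + (\<integral>z. bracket z \<partial>\<mu> t))"
      using int_b space by simp
    also have "\<dots> \<le> growth * (m * bracket z + (\<integral>z. bracket z \<partial>\<mu> t))"
      using growth_ge_1 m(2)[OF t] by (intro mult_left_mono add_right_mono mult_right_mono) auto
    finally have "norm (field t z) \<le> bracket z + growth * (m * bracket z + (\<integral>z. bracket z \<partial>\<mu> t))"
      unfolding field_eq using norm_snd_le[of "snd z" "fst z"] norm_le_bracket[of z]
      by (intro order_trans[OF norm_Pair_le] add_mono) auto
    also have "\<dots> = (1 + growth * m) * bracket z + growth * (\<integral>z. bracket z \<partial>\<mu> t)"
      by (simp add: algebra_simps)
    also have "\<dots> \<le> C * bracket z + C * (\<integral>z. bracket z \<partial>\<mu> t)"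
      by (intro add_mono mult_right_mono C Bochner_Integration.integral_nonneg) auto
    finally show "norm (field t z) \<le> C * (bracket z + (\<integral>z. bracket z \<partial>\<mu> t))"
      by (simp add: distrib_left)
  next
    fix g :: "(real^'n) \<times> (real^'n) \<Rightarrow> real" and K
    assume g: "continuous_on UNIV g" "compact K" "\<And>z. z \<notin> K \<Longrightarrow> g z = 0"
    show "continuous_on {0..T} (\<lambda>t. \<integral>z. g z \<partial>\<mu> t)"
      by (rule continuous_on_subset[OF solution_continuous[OF g, of "T + 1"]]) auto
  next
    fix g :: "(real^'n) \<times> (real^'n) \<Rightarrow> real" and \<gamma> K t
    assume g: "C1_gradient g \<gamma>" "compact K" "\<And>z. z \<notin> K \<Longrightarrow> g z = 0" and t: "t \<in> {0..T}"
    show "set_integrable lborel {0..t} (\<lambda>r. \<integral>z. field r z \<bullet> \<gamma> z \<partial>\<mu> r) \<and>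
      (\<integral>z. g z \<partial>\<mu> t) - (\<integral>z. g z \<partial>\<mu> 0) = (LINT r:{0..t}|lborel. \<integral>z. field r z \<bullet> \<gamma> z \<partial>\<mu> r)"
      using solution_weak[OF g, of t] t solution_initial[OF g] by simp
  qed (rule T)
  have "unit_transport \<mu> field T C"
    by (intro unit_transport.intro unit_transport_axioms.intro weak solution_initial_moments[OF \<mu>0])
  then have "herding_transport \<phi> \<phi>m \<phi>M L lw lx lv \<mu> field T C"
    by (intro herding_transport.intro herding_axioms herding_transport_axioms.intro field_eq)
  then show ?thesis by blast
qed

end

end

text \<open>Integrability is asserted along with the limit because a Bochner integral of a
  non-integrable function is 0, which would make the limit alone meaningless.\<close>

theorem theorem1p3:
  fixes lw lx lv \<phi>m \<phi>M :: real
    and \<phi> :: "real \<Rightarrow> real"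
    and \<mu>0 :: "((real^'n) \<times> (real^'n)) measure"
    and \<mu> :: "real \<Rightarrow> ((real^'n) \<times> (real^'n)) measure"
  assumes "lw > 0" and "lx > 0" and "lv > 0"
    and "finite_radon_measure \<mu>0" and "compactly_supported \<mu>0" and "measure \<mu>0 UNIV = 1"
    and "smooth_real \<phi>" and "\<exists>L. L-lipschitz_on UNIV \<phi>"
    and "\<And>r. \<phi> r = \<phi> (- r)"
    and "\<And>r s. r \<ge> 0 \<Longrightarrow> s \<ge> 0 \<Longrightarrow> (\<phi> r - \<phi> s) * (r - s) \<le> 0"
    and "\<phi>m > 0" and "\<phi>M > 0" and "\<And>r. \<phi>m \<le> \<phi> r \<and> \<phi> r \<le> \<phi>M"
    and "\<And>T. T > 0 \<Longrightarrow> measure_valued_solution lw lx lv \<phi> T \<mu>0 \<mu>"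
  shows "(\<forall>t\<ge>0. integrable (\<mu> t) (\<lambda>(x, v).
            (norm (x - mean_position (\<mu> t)))\<^sup>2 + (norm (v - mean_velocity (\<mu> t)))\<^sup>2))
       \<and> ((\<lambda>t. \<integral>(x, v).
            (norm (x - mean_position (\<mu> t)))\<^sup>2 + (norm (v - mean_velocity (\<mu> t)))\<^sup>2 \<partial>\<mu> t)
          \<longlongrightarrow> 0) at_top"
proof -
  obtain L where L: "L-lipschitz_on UNIV \<phi>"
    using assms(8) by blast
  interpret herding \<phi> \<phi>m \<phi>M L lw lx lv
    by unfold_locales (use assms L in \<open>auto simp: assms(9)[symmetric]\<close>)
  define W where "W t z = (norm (z - (\<integral>y. y \<partial>\<mu> t)))\<^sup>2" for t z
  define E0 where "E0 = (\<integral>z. \<integral>y. lyapunov (z - y) \<partial>\<mu> 0 \<partial>\<mu> 0)"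
  have transport: "\<exists>C. herding_transport \<phi> \<phi>m \<phi>M L lw lx lv \<mu> (field \<mu>) t C" if "0 \<le> t" for t
    by (rule solution_herding_transport[OF _ assms(4-6) that]) (rule assms(14))
  have W_eq: "(\<lambda>(x, v). (norm (x - mean_position (\<mu> t)))\<^sup>2 + (norm (v - mean_velocity (\<mu> t)))\<^sup>2) = W t"
    if t: "0 \<le> t" for t
  proof -
    obtain C where "herding_transport \<phi> \<phi>m \<phi>M L lw lx lv \<mu> (field \<mu>) t C"
      using transport[OF t] by blast
    then interpret herding_transport \<phi> \<phi>m \<phi>M L lw lx lv \<mu> "field \<mu>" t C .
    have i: "integrable (\<mu> t) (\<lambda>z. z)"
      using t by (intro integrable_id) simp
    have "mean_position (\<mu> t) = fst (\<integral>y. y \<partial>\<mu> t)" "mean_velocity (\<mu> t) = snd (\<integral>y. y \<partial>\<mu> t)"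
      using integral_bounded_linear[OF bounded_linear_fst i] integral_bounded_linear[OF bounded_linear_snd i]
      by (simp_all add: mean_position_def mean_velocity_def case_prod_beta')
    then show ?thesis
      by (auto simp: W_def norm_sq_prod)
  qed
  \<comment> \<open>Each t serves as the final time of its own transport interval. The constant C
    obtained there varies with t, but the resulting bound does not involve it.\<close>
  have int_W: "integrable (\<mu> t) (W t)"
    and le_W: "(\<integral>z. W t z \<partial>\<mu> t) \<le> 2 / min 1 lw * E0 * exp (- decay * t)" if t: "0 \<le> t" for t
  proof -
    obtain C where "herding_transport \<phi> \<phi>m \<phi>M L lw lx lv \<mu> (field \<mu>) t C"
      using transport[OF t] by blast
    then interpret herding_transport \<phi> \<phi>m \<phi>M L lw lx lv \<mu> "field \<mu>" t C .
    show "integrable (\<mu> t) (W t)"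
      unfolding W_def[abs_def] using t by (intro variance(1)) simp
    show "(\<integral>z. W t z \<partial>\<mu> t) \<le> 2 / min 1 lw * E0 * exp (- decay * t)"
      unfolding W_def E0_def by (rule variance_decay)
  qed
  have "((\<lambda>t. \<integral>z. W t z \<partial>\<mu> t) \<longlongrightarrow> 0) at_top"
  proof (rule tendsto_sandwich[of "\<lambda>t. 0" _ _ "\<lambda>t. 2 / min 1 lw * E0 * exp (- decay * t)"])
    show "\<forall>\<^sub>F t in at_top. 0 \<le> (\<integral>z. W t z \<partial>\<mu> t)"
      by (intro always_eventually allI Bochner_Integration.integral_nonneg) (simp add: W_def)
    show "\<forall>\<^sub>F t in at_top. (\<integral>z. W t z \<partial>\<mu> t) \<le> 2 / min 1 lw * E0 * exp (- decay * t)"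
      using eventually_ge_at_top[of 0] by eventually_elim (rule le_W)
    have "filterlim (\<lambda>t. - decay * t) at_bot at_top"
      using decay_pos by (intro filterlim_tendsto_neg_mult_at_bot[OF tendsto_const _ filterlim_ident]) simp
    then have "((\<lambda>t. exp (- decay * t)) \<longlongrightarrow> 0) at_top"
      by (rule filterlim_compose[OF exp_at_bot])
    from tendsto_mult_right_zero[OF this]
    show "((\<lambda>t. 2 / min 1 lw * E0 * exp (- decay * t)) \<longlongrightarrow> 0) at_top" .
  qed simp
  moreover have "\<forall>\<^sub>F t in at_top. (\<integral>z. W t z \<partial>\<mu> t)
      = (\<integral>(x, v). (norm (x - mean_position (\<mu> t)))\<^sup>2 + (norm (v - mean_velocity (\<mu> t)))\<^sup>2 \<partial>\<mu> t)"
    using eventually_ge_at_top[of 0] by eventually_elim (simp add: W_eq)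
  ultimately have "((\<lambda>t. \<integral>(x, v).
      (norm (x - mean_position (\<mu> t)))\<^sup>2 + (norm (v - mean_velocity (\<mu> t)))\<^sup>2 \<partial>\<mu> t) \<longlongrightarrow> 0) at_top"
    by (rule Lim_transform_eventually)
  then show ?thesis
    using int_W W_eq by simp
qed

end
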